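(* Let $X(u)$, $u\ge0$, $X(0)=0$, be a Lévy subordinator with generator $$Af(x)=\int_0^{\infty}(f(x+y)-f(x))\,\nu(dy)+a\frac{\partial f}{\partial x},$$ where $a\ge0$ and $\nu$ is a Borel measure on $\{y>0\}$ with $\int_0^\infty\min(1,y)\,\nu(dy)<\infty$, and assume that there exist $\epsilon>0$, $\beta\in(0,1)$ with $\nu(dy)\ge y^{-1-\beta}dy$ for $0<y<\epsilon$. Let $Z(t)=\inf\{u:X(u)>t\}$ and let $Q(t,u)$ be the probability density of $Z(t)$. Let $Y(t)$ be a Feller process in $\mathbf{R}^d$, independent of $Z(t)$, whose generator $L$ has a domain containing $(C_\infty\cap C^2)(\mathbf{R}^d)$, with transition probabilities $T(t,x,dy)=P(Y_x(t)\in dy)$. Then: (1) The distributions of the time-changed process $Y(Z(t))$ for $t>0$ are given by $$P_x(Y(Z(t))\in dy)=\int_0^{\infty}T(u,x,dy)\,Q(t,u)\,du.$$ (2) For $f\in(C_\infty\cap C^2)(\mathbf{R}^d)$ the averages $f(t,x)=Ef(Y_x(Z(t)))$ satisfy $$A^{\star}_tf(t,x)=-L_xf(t,x)+f(x)\,A^{\star}\theta(t),$$ and their time derivatives $h=\partial f/\partial t$ satisfy, for $t>0$, $$A^{\star}_th=-L_xh+f(x)\frac{d}{dt}A^{\star}\theta(t).$$ (3) If moreover $Y(t)$ has a smooth transition probability density, $T(t,x,dy)=T(t,x,y)\,dy$, and the backward and forward equations $$\frac{\partial T}{\partial t}(t,x,y)=L_xT(t,x,y)=L_y^{\star}T(t,x,y)$$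 hold, then the distributions of $Y(Z(t))$ have smooth density $$g(t,x,y)=\int_0^{\infty}T(u,x,y)\,Q(t,u)\,du$$ satisfying $$A^{\star}g=-L_y^{\star}g+\delta(x-y)A^{\star}\theta(t)\quad\text{and}\quad A^{\star}g=-L_xg+\delta(x-y)A^{\star}\theta(t),$$ and the time derivative $h=\partial g/\partial t$ satisfies, for $t>0$, $$A^{\star}h=-L_y^{\star}h+\delta(x-y)\frac{d}{dt}A^{\star}\theta(t).$$
   Context: Here $A^{\star}$ is the dual operator of $A$, acting on the variable $t$: $$A^{\star}f(t)=\int_0^{\infty}(f(t-y)-f(t))\,\nu(dy)-a\frac{\partial f}{\partial t};$$ subscripts on operators indicate the variable on which they act; $L^\star$ is the dual of $L$; $\theta(t)$ is the indicator function equal to $1$ for $t>0$ and $0$ for $t<0$; $\delta$ is the Dirac function. $Y_x$ and $P_x$ refer to the process started at $x$. $C_\infty(\mathbf{R}^d)$ is the space of continuous functions vanishing at infinity. Under the condition on $\nu$, $X(u)$ has for $u>0$ a density $G(u,y)$, infinitely differentiable in both variables and vanishing for $y<0$, and for $t>0$ the density of $Z(t)$ is $Q(t,u)=-\frac{\partial}{\partial u}\int_{-\infty}^tG(u,y)\,dy$, $u>0$; this formula gives $Q(t,u)=0$ for $t<0$. Convention: the equations involving $A^\star$ are understood in the sense of generalized functions in $t$, where $Q$, and hence $f(t,x)$ and $g(t,x,y)$, are extended by zero to $t<0$ and time derivatives are the derivatives of these extended functions.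
   Formalization: The density g is in general singular at x=y, so "smooth density" is proved only as smoothness in (x,y), for each fixed t>0, on open sets where the integral defining g and all its formal derivatives in (x,y) are locally dominated. *)

theory Defs
  imports "HOL-Probability.Probability"
begin

section \<open>Function spaces\<close>

text \<open>Iterated partial derivatives along a list of basis vectors (head first), as honest Frechet
  partials; \<open>C_k_on\<close> and \<open>smooth_on\<close> are meant for open sets.\<close>

fun dpart :: "'a::euclidean_space list \<Rightarrow> ('a \<Rightarrow> real) \<Rightarrow> 'a \<Rightarrow> real" where
  "dpart [] f = f"
| "dpart (b # bs) f = dpart bs (\<lambda>x. frechet_derivative f (at x) b)"

definition C_k_on :: "nat \<Rightarrow> 'a::euclidean_space set \<Rightarrow> ('a \<Rightarrow> real) \<Rightarrow> bool" where
  "C_k_on k U f \<longleftrightarrow>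
     (\<forall>bs. set bs \<subseteq> Basis \<and> length bs \<le> k \<longrightarrow>
        continuous_on U (dpart bs f) \<and>
        (length bs < k \<longrightarrow> (\<forall>x\<in>U. dpart bs f differentiable at x)))"

definition smooth_on :: "'a::euclidean_space set \<Rightarrow> ('a \<Rightarrow> real) \<Rightarrow> bool" where
  "smooth_on U f \<longleftrightarrow> (\<forall>k. C_k_on k U f)"

definition C_inf :: "('a::euclidean_space \<Rightarrow> real) set" where
  "C_inf = {f. continuous_on UNIV f \<and> (f \<longlongrightarrow> 0) at_infinity}"

text \<open>\<open>C\<^sup>2\<close> either denotes all twice continuously differentiable functions or, as a Banach space, only
  those with bounded derivatives; the theorem is stated for both classes.\<close>

definition C2_fun :: "('a::euclidean_space \<Rightarrow> real) set" where
  "C2_fun = {f. C_k_on 2 UNIV f}"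

definition C2_bounded :: "('a::euclidean_space \<Rightarrow> real) set" where
  "C2_bounded = {f \<in> C2_fun. \<forall>bs. set bs \<subseteq> Basis \<and> length bs \<le> 2 \<longrightarrow> bounded (range (dpart bs f))}"

definition C1_inf :: "(real \<Rightarrow> real) set" where
  "C1_inf = {f \<in> C_inf. (\<forall>x. f field_differentiable at x) \<and> deriv f \<in> C_inf}"

definition supp :: "('a::topological_space \<Rightarrow> real) \<Rightarrow> 'a set" where
  "supp \<phi> = closure {x. \<phi> x \<noteq> 0}"

definition test_fun :: "('a::euclidean_space \<Rightarrow> real) set" where
  "test_fun = {\<phi>. smooth_on UNIV \<phi> \<and> compact (supp \<phi>)}"


section \<open>Feller kernels, their generators, Feller processes\<close>

definition kernel_op :: "(real \<Rightarrow> 'a \<Rightarrow> 'a measure) \<Rightarrow> real \<Rightarrow> ('a \<Rightarrow> real) \<Rightarrow> 'a::euclidean_space \<Rightarrow> real" where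
  "kernel_op K t f x = (LINT z|K t x. f z)"

definition has_generator_value ::
  "(real \<Rightarrow> 'a \<Rightarrow> 'a measure) \<Rightarrow> ('a::euclidean_space \<Rightarrow> real) \<Rightarrow> ('a \<Rightarrow> real) \<Rightarrow> bool" where
  "has_generator_value K f g \<longleftrightarrow> f \<in> C_inf \<and> g \<in> C_inf \<and>
     uniform_limit UNIV (\<lambda>t x. (kernel_op K t f x - f x) / t) g (at_right 0)"

definition gen_dom :: "(real \<Rightarrow> 'a \<Rightarrow> 'a measure) \<Rightarrow> ('a::euclidean_space \<Rightarrow> real) set" where
  "gen_dom K = {f. \<exists>g. has_generator_value K f g}"

definition gen :: "(real \<Rightarrow> 'a \<Rightarrow> 'a measure) \<Rightarrow> ('a::euclidean_space \<Rightarrow> real) \<Rightarrow> 'a \<Rightarrow> real" where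
  "gen K f = (THE g. has_generator_value K f g)"

definition feller_kernel :: "(real \<Rightarrow> 'a::euclidean_space \<Rightarrow> 'a measure) \<Rightarrow> bool" where
  "feller_kernel K \<longleftrightarrow>
     (\<forall>t\<ge>0. K t \<in> borel \<rightarrow>\<^sub>M prob_algebra borel) \<and>
     (\<forall>x. K 0 x = return borel x) \<and>
     (\<forall>s\<ge>0. \<forall>t\<ge>0. \<forall>x. K (s + t) x = K s x \<bind> K t) \<and>
     (\<forall>t\<ge>0. \<forall>f\<in>C_inf. kernel_op K t f \<in> C_inf) \<and>
     (\<forall>f\<in>C_inf. uniform_limit UNIV (\<lambda>t x. kernel_op K t f x) f (at_right 0))"

definition path_events :: "'w measure \<Rightarrow> (real \<Rightarrow> 'w \<Rightarrow> 'a::topological_space) \<Rightarrow> real set \<Rightarrow> 'w set set" where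
  "path_events M Y I = {Y r -` B \<inter> space M | r B. r \<in> I \<and> B \<in> sets borel}"

definition markov_process ::
  "'w measure \<Rightarrow> (real \<Rightarrow> 'a::euclidean_space \<Rightarrow> 'a measure) \<Rightarrow> (real \<Rightarrow> 'w \<Rightarrow> 'a) \<Rightarrow> bool" where
  "markov_process M K Y \<longleftrightarrow>
     (\<forall>t\<ge>0. Y t \<in> borel_measurable M) \<and>
     (\<forall>s\<ge>0. \<forall>t\<ge>0. \<forall>B\<in>sets borel.
        AE \<omega> in M. real_cond_exp M (sigma (space M) (path_events M Y {0..s}))
                      (indicator (Y (s + t) -` B \<inter> space M)) \<omega>
                    = measure (K t (Y s \<omega>)) B)"

definition cadlag_on_nonneg :: "(real \<Rightarrow> 'a::topological_space) \<Rightarrow> bool" where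
  "cadlag_on_nonneg y \<longleftrightarrow>
     (\<forall>t\<ge>0. continuous (at_right t) y) \<and> (\<forall>t>0. \<exists>l. (y \<longlongrightarrow> l) (at_left t))"

definition feller_process ::
  "'w measure \<Rightarrow> (real \<Rightarrow> 'a::euclidean_space \<Rightarrow> 'a measure) \<Rightarrow> 'a \<Rightarrow> (real \<Rightarrow> 'w \<Rightarrow> 'a) \<Rightarrow> bool" where
  "feller_process M K x Y \<longleftrightarrow>
     feller_kernel K \<and> markov_process M K Y \<and> (AE \<omega> in M. Y 0 \<omega> = x) \<and>
     (\<forall>\<omega>\<in>space M. cadlag_on_nonneg (\<lambda>t. Y t \<omega>))"

definition indep_processes ::
  "'w measure \<Rightarrow> (real \<Rightarrow> 'w \<Rightarrow> 'a::topological_space) \<Rightarrow> (real \<Rightarrow> 'w \<Rightarrow> 'b::topological_space) \<Rightarrow> bool" where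
  "indep_processes M Y Z \<longleftrightarrow>
     prob_space.indep_set M (sigma_sets (space M) (path_events M Y {0..}))
                            (sigma_sets (space M) (path_events M Z {0..}))"


section \<open>The subordinator and its inverse\<close>

definition levy_subordinator :: "'w measure \<Rightarrow> (real \<Rightarrow> 'w \<Rightarrow> real) \<Rightarrow> bool" where
  "levy_subordinator M X \<longleftrightarrow>
     (\<forall>u\<ge>0. X u \<in> borel_measurable M) \<and> (AE \<omega> in M. X 0 \<omega> = 0) \<and>
     (\<forall>s. mono s \<and> 0 \<le> s 0 \<longrightarrow>
        (\<forall>n::nat. prob_space.indep_vars M (\<lambda>_. borel) (\<lambda>i \<omega>. X (s (Suc i)) \<omega> - X (s i) \<omega>) {..<n})) \<and>
     (\<forall>s\<ge>0. \<forall>u\<ge>0. distr M borel (\<lambda>\<omega>. X (s + u) \<omega> - X s \<omega>) = distr M borel (X u)) \<and>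
     (\<forall>\<omega>\<in>space M. mono_on {0..} (\<lambda>u. X u \<omega>) \<and> (\<forall>u\<ge>0. continuous (at_right u) (\<lambda>v. X v \<omega>)))"

definition gen_A :: "real measure \<Rightarrow> real \<Rightarrow> (real \<Rightarrow> real) \<Rightarrow> real \<Rightarrow> real" where
  "gen_A \<nu> a f x = (LINT y|\<nu>. f (x + y) - f x) + a * deriv f x"

text \<open>The formula for \<open>A\<close> is required on the functions of class \<open>C\<^sup>1\<close> that vanish at infinity together
  with their derivative; it determines the law of \<open>X\<close>.\<close>

definition subordinator_with_generator ::
  "'w measure \<Rightarrow> (real \<Rightarrow> 'w \<Rightarrow> real) \<Rightarrow> real measure \<Rightarrow> real \<Rightarrow> bool" where
  "subordinator_with_generator M X \<nu> a \<longleftrightarrow> levy_subordinator M X \<and>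
     (\<forall>f\<in>C1_inf. has_generator_value (\<lambda>u x. distr M borel (\<lambda>\<omega>. x + X u \<omega>)) f (gen_A \<nu> a f))"

definition levy_measure_subordinator :: "real measure \<Rightarrow> bool" where
  "levy_measure_subordinator \<nu> \<longleftrightarrow> sets \<nu> = sets borel \<and> emeasure \<nu> {..0} = 0 \<and>
     (\<integral>\<^sup>+ y. ennreal (min 1 y) \<partial>\<nu>) < \<infinity>"

definition stable_lower_bound :: "real measure \<Rightarrow> real \<Rightarrow> real \<Rightarrow> bool" where
  "stable_lower_bound \<nu> \<epsilon> \<beta> \<longleftrightarrow>
     (\<forall>B\<in>sets borel. B \<subseteq> {0<..<\<epsilon>} \<longrightarrow>
        (\<integral>\<^sup>+ y\<in>B. ennreal (y powr (- 1 - \<beta>)) \<partial>lborel) \<le> emeasure \<nu> B)"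

text \<open>On the null event where the path stays below \<open>t\<close> forever (infimum of the empty set) the value
  of the real-valued \<open>Z(t)\<close> is irrelevant; it is set to 0 because \<open>Inf {}\<close> is unspecified and \<open>Y\<close> is
  only constrained at nonnegative times.\<close>

definition hitting_time :: "(real \<Rightarrow> 'w \<Rightarrow> real) \<Rightarrow> real \<Rightarrow> 'w \<Rightarrow> real" where
  "hitting_time X t \<omega> = (if \<exists>u\<ge>0. X u \<omega> > t then Inf {u. 0 \<le> u \<and> X u \<omega> > t} else 0)"

text \<open>\<open>Q(t,u)\<close> is minus the \<open>u\<close>-derivative of the integral of the density \<open>G(u,y)\<close> of \<open>X(u)\<close> over
  \<open>y \<le> t\<close>, i.e. of \<open>P(X(u) \<le> t)\<close>. For \<open>t < 0\<close> it vanishes since \<open>X\<close> is nonnegative.\<close>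

definition hitting_density :: "'w measure \<Rightarrow> (real \<Rightarrow> 'w \<Rightarrow> real) \<Rightarrow> real \<Rightarrow> real \<Rightarrow> real" where
  "hitting_density M X t u =
     (if 0 < u then - deriv (\<lambda>v. measure M {\<omega> \<in> space M. X v \<omega> \<le> t}) u else 0)"


section \<open>Generalized functions of \<open>t\<close> and the dual operator\<close>

text \<open>A generalized function on the line is a functional on \<open>test_fun\<close>.\<close>

type_synonym gfun = "(real \<Rightarrow> real) \<Rightarrow> real"

definition regular :: "(real \<Rightarrow> real) \<Rightarrow> gfun" where
  "regular F \<phi> = (LINT t|lborel. F t * \<phi> t)"

definition gderiv :: "gfun \<Rightarrow> gfun" where
  "gderiv u \<phi> = - u (deriv \<phi>)"

definition theta :: "real \<Rightarrow> real" where
  "theta = indicator {0<..}"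

text \<open>The formula for \<open>A\<^sup>\<star>\<close> read in the sense of generalized functions: the translate \<open>u(t - y)\<close> acts
  on \<open>\<phi>\<close> by \<open>u\<close> applied to \<open>\<phi>(t + y)\<close>.\<close>

definition A_star :: "real measure \<Rightarrow> real \<Rightarrow> gfun \<Rightarrow> gfun" where
  "A_star \<nu> a u \<phi> = (LINT y|\<nu>. u (\<lambda>t. \<phi> (t + y)) - u \<phi>) - a * gderiv u \<phi>"

text \<open>\<open>A\<^sup>\<star>u = r\<close> on the open set \<open>I\<close>; integrability excludes the default value of divergent
  integrals.\<close>

definition A_star_eq_on :: "real set \<Rightarrow> real measure \<Rightarrow> real \<Rightarrow> gfun \<Rightarrow> gfun \<Rightarrow> bool" where
  "A_star_eq_on I \<nu> a u r \<longleftrightarrow>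
     (\<forall>\<phi>\<in>test_fun. supp \<phi> \<subseteq> I \<longrightarrow>
        integrable \<nu> (\<lambda>y. u (\<lambda>t. \<phi> (t + y)) - u \<phi>) \<and> A_star \<nu> a u \<phi> = r \<phi>)"


section \<open>Averages and densities of the time-changed process\<close>

definition average ::
  "'w measure \<Rightarrow> (real \<Rightarrow> 'w \<Rightarrow> real) \<Rightarrow> ('a \<Rightarrow> real \<Rightarrow> 'w \<Rightarrow> 'a) \<Rightarrow> ('a \<Rightarrow> real) \<Rightarrow> real \<Rightarrow> 'a \<Rightarrow> real" where
  "average M X Y f t x =
     (if t < 0 then 0 else LINT \<omega>|M. f (Y x (hitting_time X t \<omega>) \<omega>))"

definition smooth_transition_density ::
  "(real \<Rightarrow> 'a::euclidean_space \<Rightarrow> 'a measure) \<Rightarrow> (real \<Rightarrow> 'a \<Rightarrow> 'a \<Rightarrow> real) \<Rightarrow> bool" where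
  "smooth_transition_density K p \<longleftrightarrow>
     (\<forall>t>0. \<forall>x. (\<forall>y. 0 \<le> p t x y) \<and> K t x = density lborel (\<lambda>y. ennreal (p t x y))) \<and>
     smooth_on {(t, x, y). 0 < t} (\<lambda>(t, x, y). p t x y)"

definition backward_equation ::
  "(real \<Rightarrow> 'a::euclidean_space \<Rightarrow> 'a measure) \<Rightarrow> (real \<Rightarrow> 'a \<Rightarrow> 'a \<Rightarrow> real) \<Rightarrow> bool" where
  "backward_equation K p \<longleftrightarrow>
     (\<forall>t>0. \<forall>x y. (\<lambda>z. p t z y) \<in> gen_dom K \<and>
        deriv (\<lambda>s. p s x y) t = gen K (\<lambda>z. p t z y) x)"

text \<open>The dual operator is defined by duality with \<open>L\<close>: the generalized function \<open>L\<^sup>\<star>q\<close> acts on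
  \<open>\<psi>\<close> as \<open>q\<close> acts on \<open>L \<psi>\<close>.\<close>

definition forward_equation ::
  "(real \<Rightarrow> 'a::euclidean_space \<Rightarrow> 'a measure) \<Rightarrow> (real \<Rightarrow> 'a \<Rightarrow> 'a \<Rightarrow> real) \<Rightarrow> bool" where
  "forward_equation K p \<longleftrightarrow>
     (\<forall>t>0. \<forall>x. \<forall>\<psi>\<in>test_fun.
        (LINT y|lborel. deriv (\<lambda>s. p s x y) t * \<psi> y) = (LINT y|lborel. p t x y * gen K \<psi> y))"

definition changed_density ::
  "(real \<Rightarrow> real \<Rightarrow> real) \<Rightarrow> (real \<Rightarrow> 'a \<Rightarrow> 'a \<Rightarrow> real) \<Rightarrow> real \<Rightarrow> 'a \<Rightarrow> 'a \<Rightarrow> real" where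
  "changed_density Q p t x y = (LINT u:{0<..}|lborel. p u x y * Q t u)"

text \<open>\<open>g(t,x,y)\<close> as a generalized function of \<open>(t,y)\<close> with parameter \<open>x\<close>: \<open>pairing g x \<psi>\<close> is the
  generalized function of \<open>t\<close> obtained by integrating against \<open>\<psi>(y)\<close>.\<close>

definition pairing :: "(real \<Rightarrow> 'a \<Rightarrow> 'a \<Rightarrow> real) \<Rightarrow> 'a::euclidean_space \<Rightarrow> ('a \<Rightarrow> real) \<Rightarrow> gfun" where
  "pairing g x \<psi> = regular (\<lambda>t. LINT y|lborel. g t x y * \<psi> y)"

text \<open>Since \<open>Q(t,u)\<close> need not vanish as \<open>u\<close> tends to 0, \<open>g\<close> need not be smooth everywhere even if \<open>p\<close> is
  (the term \<open>\<delta>(x - y)\<close> in the equation for \<open>g\<close> produces a singularity at \<open>x = y\<close>). The following open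
  sets \<open>W\<close> of pairs \<open>(x,y)\<close> are those on which the integral defining \<open>g(t,x,y)\<close> and all integrals
  obtained from it by formal differentiation converge locally uniformly (are locally dominated); for
  Brownian motion, for instance, the complement of the diagonal.\<close>

definition regular_region ::
  "(real \<Rightarrow> real \<Rightarrow> real) \<Rightarrow> (real \<Rightarrow> 'a \<Rightarrow> 'a \<Rightarrow> real) \<Rightarrow> real \<Rightarrow> ('a::euclidean_space \<times> 'a) set \<Rightarrow> bool" where
  "regular_region Q p t W \<longleftrightarrow> open W \<and>
     (\<forall>z\<in>W. \<forall>bs. set bs \<subseteq> Basis \<longrightarrow>
        (\<exists>N m. open N \<and> z \<in> N \<and> set_integrable lborel {0<..} m \<and>
           (\<forall>u>0. \<forall>w\<in>N. \<bar>dpart bs (\<lambda>(x, y). p u x y) w * Q t u\<bar> \<le> m u)))"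

end

theory Submission
  imports Defs "HOL-Real_Asymp.Real_Asymp"
begin

text \<open>Because \<open>X\<close> is nonnegative, its generator may be applied to \<open>exp (- z x)\<close>, cut off on the
  negative half-line; this yields the Laplace transform of \<open>X(u)\<close> and, as \<open>Re z\<close> tends to 0, its
  characteristic function. The lower bound on \<open>\<nu>\<close> makes the latter decay like
  \<open>exp (- c u |\<xi>| powr \<beta>)\<close>, so by Levy's inversion formula \<open>D(t,u) = P(X(u) \<le> t)\<close> is differentiable
  in \<open>u\<close>, and \<open>Q = - dD/du\<close> is the density of \<open>Z(t)\<close>. Applying the generator to the integral of
  a test function \<open>\<phi>\<close> from \<open>x\<close> to infinity gives, for \<open>s > 0\<close>, the key identity: the integral of
  \<open>\<phi>(t) Q(t,s)\<close> over \<open>t\<close> equals \<open>- A\<^sup>\<star> D(\<cdot>,s)\<close> tested against \<open>\<phi>\<close>.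

  Integrating \<open>T\<^sub>u f = f + \<integral>\<^sub>0\<^sup>u T\<^sub>s L f ds\<close> against \<open>Q(t,u)\<close> gives
  \<open>f(t,x) = f(x) \<theta>(t) + \<integral>\<^sub>0\<^sup>\<infinity> T\<^sub>s L f(x) D(t,s) ds\<close>. Applying \<open>A\<^sup>\<star>\<close> and inserting the key identity
  turns the last term into \<open>- L f(t,x)\<close>; here \<open>L\<close> passes through the mixtures since it is closed. The
  equations for time derivatives are the same equations tested against \<open>\<phi>'\<close>, and those for \<open>g\<close>
  are the ones for the averages of the test function \<open>\<psi>\<close> that \<open>g\<close> is paired with.\<close>

text \<open>The obstacle is the behaviour at \<open>u = 0\<close>: the inversion integral bounds
  \<open>Q t u\<close> only for \<open>u\<close> away from 0 (\<open>Q_bound\<close>), and near 0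
  only positivity and total mass are available. Therefore \<open>A_star\<close> is never moved onto
  \<open>Q\<close>. It is applied to \<open>D\<close>, which lies between 0 and 1, vanishes for
  \<open>t < 0\<close> and decays like \<open>exp (- rate * s)\<close>, by a Chernoff bound with the
  Laplace transform at \<open>z = 1\<close>. These facts dominate the exchanges of integrals over
  \<open>t\<close>, \<open>s\<close> and \<open>\<nu>\<close>.

  The key identity results from computing one right derivative in \<open>s\<close> twice, that of
  the expectation of \<open>g(X(s))\<close>, where \<open>g(x)\<close> is the integral of
  \<open>\<phi>\<close> from \<open>x\<close> to infinity: once through \<open>D\<close>, once
  through the Markov property of \<open>X\<close> and the generator at \<open>g\<close>.

  The Laplace transform is found without a differential equation: the generator yields only its
  derivative at \<open>u = 0\<close>, and multiplicativity in \<open>u\<close> does the rest.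

  The averages are replaced by \<open>avg\<close>, which is defined by the semigroup and
  \<open>Q\<close> alone; the two may differ at \<open>t = 0\<close>, which no integral over
  \<open>t\<close> notices.\<close>

section \<open>Differentiation under the integral sign\<close>

text \<open>The mean value inequality on the ball turns the bound on the derivatives into a bound on
  the increments, so the normalised remainder \<open>R\<close> is dominated by \<open>2 * m\<close>
  and dominated convergence applies along sequences. The parameter space is a normed space because
  the lemma serves both real parameters and points of Euclidean space.\<close>

lemma has_derivative_integral_dominated:
  fixes f :: "'w::real_normed_vector \<Rightarrow> 's \<Rightarrow> 'b::{banach, second_countable_topology}"
  assumes r: "0 < r"
    and meas: "\<And>w. w \<in> ball x r \<Longrightarrow> f w \<in> borel_measurable N"
    and meas_D: "\<And>h. (\<lambda>s. D x s h) \<in> borel_measurable N"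
    and int: "integrable N (f x)"
    and der: "\<And>w s. w \<in> ball x r \<Longrightarrow> s \<in> space N \<Longrightarrow> ((\<lambda>w. f w s) has_derivative D w s) (at w)"
    and bound: "\<And>w s. w \<in> ball x r \<Longrightarrow> s \<in> space N \<Longrightarrow> onorm (D w s) \<le> m s"
    and m: "integrable N m"
  shows "((\<lambda>w. \<integral>s. f w s \<partial>N) has_derivative (\<lambda>h. \<integral>s. D x s h \<partial>N)) (at x)"
    and "integrable N (\<lambda>s. D x s h)"
    and "w \<in> ball x r \<Longrightarrow> integrable N (f w)"
proof -
  have x: "x \<in> ball x r" using r by simp
  have blD: "bounded_linear (D x s)" if "s \<in> space N" for s
    using der[OF x that] by (rule has_derivative_bounded_linear)
  have Dn: "norm (D x s h) \<le> m s * norm h" if "s \<in> space N" for s h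
    using onorm[OF blD[OF that], of h] mult_right_mono[OF bound[OF x that], of "norm h"] by simp
  have intD: "integrable N (\<lambda>s. D x s h)" for h
    by (rule Bochner_Integration.integrable_bound[of _ "\<lambda>s. m s * norm h"])
      (use Dn m meas_D in \<open>auto intro!: AE_I2 order_trans[OF Dn]\<close>)
  then show "integrable N (\<lambda>s. D x s h)" .
  have fn: "norm (f w s - f x s) \<le> m s * norm (w - x)" if "w \<in> ball x r" "s \<in> space N" for w s
  proof (rule differentiable_bound[where S="ball x r" and f'="\<lambda>w. D w s"])
    show "((\<lambda>w. f w s) has_derivative D v s) (at v within ball x r)" if "v \<in> ball x r" for v
      using der[OF that \<open>s \<in> space N\<close>] has_derivative_at_withinI by blast
  qed (use bound that r in auto)
  have intdf: "integrable N (\<lambda>s. f w s - f x s)" if "w \<in> ball x r" for w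
    by (rule Bochner_Integration.integrable_bound[of _ "\<lambda>s. m s * norm (w - x)"])
      (use fn m meas that x in \<open>auto intro!: AE_I2 order_trans[OF fn]\<close>)
  have intf: "integrable N (f w)" if "w \<in> ball x r" for w
    using Bochner_Integration.integrable_add[OF intdf[OF that] int] by simp
  then show "w \<in> ball x r \<Longrightarrow> integrable N (f w)" .
  define R where "R w s = norm (f w s - f x s - D x s (w - x)) / norm (w - x)" for w s
  have R_le: "norm (R w s) \<le> 2 * m s" if "w \<in> ball x r" "s \<in> space N" for w s
  proof (cases "w = x")
    case True
    have "0 \<le> m s" using Dn[OF that(2)] bound[OF that] onorm_pos_le[OF has_derivative_bounded_linear[OF der[OF that]]]
      by linarith
    then show ?thesis by (simp add: R_def True)
  next
    case False
    have "norm (f w s - f x s - D x s (w - x)) \<le> m s * norm (w - x) + m s * norm (w - x)"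
      by (rule order_trans[OF norm_triangle_ineq4 add_mono[OF fn Dn]]) (use that in auto)
    then show ?thesis using False by (simp add: R_def divide_le_eq algebra_simps)
  qed
  have R_meas: "R w \<in> borel_measurable N" if "w \<in> ball x r" for w
    using meas[OF that] meas[OF x] meas_D unfolding R_def by measurable
  have R_lim: "((\<lambda>w. \<integral>s. R w s \<partial>N) \<longlongrightarrow> 0) (at x)"
    unfolding tendsto_at_iff_sequentially
  proof (intro allI impI)
    fix X assume X: "\<forall>i. X i \<in> UNIV - {x}" "X \<longlonglongrightarrow> x"
    have "eventually (\<lambda>n. X n \<in> ball x r) sequentially"
      using X(2) r by (intro topological_tendstoD) auto
    then obtain k where k: "\<And>n. n \<ge> k \<Longrightarrow> X n \<in> ball x r"
      unfolding eventually_sequentially by auto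
    have "(\<lambda>n. \<integral>s. R (X (n + k)) s \<partial>N) \<longlonglongrightarrow> (\<integral>s. 0 \<partial>N)"
    proof (rule integral_dominated_convergence[where w="\<lambda>s. 2 * m s"])
      show "AE s in N. (\<lambda>n. R (X (n + k)) s) \<longlonglongrightarrow> 0"
      proof (rule AE_I2)
        fix s assume s: "s \<in> space N"
        have "((\<lambda>w. R w s) \<longlongrightarrow> 0) (at x)"
          using der[OF x s] unfolding has_derivative_iff_norm R_def by simp
        then have "((\<lambda>w. R w s) \<circ> X) \<longlonglongrightarrow> 0"
          using X unfolding tendsto_at_iff_sequentially by blast
        then show "(\<lambda>n. R (X (n + k)) s) \<longlonglongrightarrow> 0"
          unfolding comp_def by (rule LIMSEQ_ignore_initial_segment)
      qed
    qed (use k R_meas R_le m in auto)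
    then have "(\<lambda>n. \<integral>s. R (X n) s \<partial>N) \<longlonglongrightarrow> 0"
      by (simp add: LIMSEQ_offset[where k=k])
    then show "((\<lambda>w. \<integral>s. R w s \<partial>N) \<circ> X) \<longlonglongrightarrow> 0" by (simp add: comp_def)
  qed
  have "bounded_linear (\<lambda>h. \<integral>s. D x s h \<partial>N)"
  proof (rule bounded_linear_intro[where K="\<integral>s. m s \<partial>N"])
    fix h h' :: 'w and c :: real
    have "(\<integral>s. D x s (h + h') \<partial>N) = (\<integral>s. D x s h + D x s h' \<partial>N)"
      by (rule Bochner_Integration.integral_cong) (auto dest!: blD simp: linear_simps)
    then show "(\<integral>s. D x s (h + h') \<partial>N) = (\<integral>s. D x s h \<partial>N) + (\<integral>s. D x s h' \<partial>N)"
      using intD by simp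
    have "(\<integral>s. D x s (c *\<^sub>R h) \<partial>N) = (\<integral>s. c *\<^sub>R D x s h \<partial>N)"
      by (rule Bochner_Integration.integral_cong) (auto dest!: blD simp: linear_simps)
    then show "(\<integral>s. D x s (c *\<^sub>R h) \<partial>N) = c *\<^sub>R (\<integral>s. D x s h \<partial>N)" by simp
    have "norm (\<integral>s. D x s h \<partial>N) \<le> (\<integral>s. norm (D x s h) \<partial>N)"
      by (rule integral_norm_bound)
    also have "\<dots> \<le> (\<integral>s. m s * norm h \<partial>N)"
      by (rule integral_mono) (use intD m Dn in auto)
    also have "\<dots> = norm h * (\<integral>s. m s \<partial>N)" using m by simp
    finally show "norm (\<integral>s. D x s h \<partial>N) \<le> norm h * (\<integral>s. m s \<partial>N)" .
  qed
  moreover have "((\<lambda>w. norm ((\<integral>s. f w s \<partial>N) - (\<integral>s. f x s \<partial>N) - (\<integral>s. D x s (w - x) \<partial>N)) / norm (w - x)) \<longlongrightarrow> 0) (at x)"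
  proof (rule Lim_null_comparison[OF _ R_lim])
    have "eventually (\<lambda>w. w \<in> ball x r) (at x)"
      by (rule eventually_at_in_open') (use r in auto)
    then show "\<forall>\<^sub>F w in at x. norm (norm ((\<integral>s. f w s \<partial>N) - (\<integral>s. f x s \<partial>N) - (\<integral>s. D x s (w - x) \<partial>N)) / norm (w - x)) \<le> (\<integral>s. R w s \<partial>N)"
    proof eventually_elim
      case (elim w)
      have "(\<integral>s. f w s \<partial>N) - (\<integral>s. f x s \<partial>N) - (\<integral>s. D x s (w - x) \<partial>N) = (\<integral>s. f w s - f x s - D x s (w - x) \<partial>N)"
        using intf[OF elim] int intD by simp
      moreover have "norm (\<integral>s. f w s - f x s - D x s (w - x) \<partial>N) \<le> (\<integral>s. norm (f w s - f x s - D x s (w - x)) \<partial>N)"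
        by (rule integral_norm_bound)
      ultimately show ?case
        by (simp add: R_def divide_right_mono)
    qed
  qed
  ultimately show "((\<lambda>w. \<integral>s. f w s \<partial>N) has_derivative (\<lambda>h. \<integral>s. D x s h \<partial>N)) (at x)"
    unfolding has_derivative_iff_norm by simp
qed

lemma has_vector_derivative_integral_dominated:
  fixes f :: "real \<Rightarrow> 's \<Rightarrow> 'b::{banach, second_countable_topology}"
  assumes r: "0 < r"
    and meas: "\<And>w. w \<in> ball x r \<Longrightarrow> f w \<in> borel_measurable N"
    and meas_D: "D x \<in> borel_measurable N"
    and int: "integrable N (f x)"
    and der: "\<And>w s. w \<in> ball x r \<Longrightarrow> s \<in> space N \<Longrightarrow> ((\<lambda>w. f w s) has_vector_derivative D w s) (at w)"
    and bound: "\<And>w s. w \<in> ball x r \<Longrightarrow> s \<in> space N \<Longrightarrow> norm (D w s) \<le> m s"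
    and m: "integrable N m"
  shows "((\<lambda>w. \<integral>s. f w s \<partial>N) has_vector_derivative (\<integral>s. D x s \<partial>N)) (at x)"
    and "integrable N (D x)"
proof -
  note * = has_derivative_integral_dominated[where f=f and D="\<lambda>w s h. h *\<^sub>R D w s" and N=N and m=m, OF r meas]
  have o: "onorm (\<lambda>h. h *\<^sub>R y) \<le> norm y" for y :: 'b
    by (rule onorm_bound) auto
  have "((\<lambda>w. \<integral>s. f w s \<partial>N) has_derivative (\<lambda>h. \<integral>s. h *\<^sub>R D x s \<partial>N)) (at x)"
    by (rule *(1)) (use assms in \<open>auto simp: has_vector_derivative_def intro: order_trans[OF o]\<close>)
  then show "((\<lambda>w. \<integral>s. f w s \<partial>N) has_vector_derivative (\<integral>s. D x s \<partial>N)) (at x)"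
    by (simp add: has_vector_derivative_def)
  have "integrable N (\<lambda>s. 1 *\<^sub>R D x s)"
    by (rule *(2)) (use assms in \<open>auto simp: has_vector_derivative_def intro: order_trans[OF o]\<close>)
  then show "integrable N (D x)" by simp
qed

text \<open>Rounding time up to a dyadic grid leaves countably many time values, for which
  measurability is clear; right continuity recovers the process as the grid is refined. This makes
  evaluation at a random time measurable.\<close>

lemma borel_measurable_right_continuous:
  fixes Y :: "real \<Rightarrow> 'w \<Rightarrow> 'a::euclidean_space"
  assumes Y: "\<And>t. 0 \<le> t \<Longrightarrow> Y t \<in> borel_measurable G"
    and rc: "\<And>t \<omega>. 0 \<le> t \<Longrightarrow> \<omega> \<in> space G \<Longrightarrow> continuous (at_right t) (\<lambda>t. Y t \<omega>)"
  shows "(\<lambda>(\<omega>, t). Y (max 0 t) \<omega>) \<in> borel_measurable (G \<Otimes>\<^sub>M borel)"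
proof -
  \<comment> \<open>The added 1 puts \<open>q n t\<close> strictly above \<open>max 0 t\<close>, so
    that the limit is taken along \<open>at_right\<close>.\<close>
  define q where "q n t = (real_of_int (\<lfloor>2 ^ n * max 0 t\<rfloor>) + 1) / 2 ^ n" for n :: nat and t :: real
  have qb: "max 0 t < q n t" "q n t \<le> max 0 t + 1 / 2 ^ n" for n t
  proof -
    have "2 ^ n * max 0 t < real_of_int \<lfloor>2 ^ n * max 0 t\<rfloor> + 1" by linarith
    then show "max 0 t < q n t" unfolding q_def by (subst pos_less_divide_eq) (simp_all add: mult.commute)
    have "real_of_int \<lfloor>2 ^ n * max 0 t\<rfloor> + 1 \<le> 2 ^ n * max 0 t + 1" by linarith
    then have "q n t \<le> (2 ^ n * max 0 t + 1) / 2 ^ n" unfolding q_def by (intro divide_right_mono) auto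
    then show "q n t \<le> max 0 t + 1 / 2 ^ n" by (simp add: add_divide_distrib)
  qed
  have "(\<lambda>z. Y (q n (snd z)) (fst z)) \<in> borel_measurable (G \<Otimes>\<^sub>M borel)" for n
  proof -
    \<comment> \<open>\<open>measurable_compose_countable\<close> asks for measurability at every
      integer index, including negative ones; hence \<open>max 0 k\<close>, which changes nothing at
      the nonnegative values of the floor.\<close>
    have "(\<lambda>z. (\<lambda>k z. Y ((real_of_int (max 0 k) + 1) / 2 ^ n) (fst z)) (\<lfloor>2 ^ n * max 0 (snd z :: real)\<rfloor>) z)
        \<in> borel_measurable (G \<Otimes>\<^sub>M borel)"
    proof (rule measurable_compose_countable[where f="\<lambda>k z. Y ((real_of_int (max 0 k) + 1) / 2 ^ n) (fst z)"])
      fix k :: int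
      have "Y ((real_of_int (max 0 k) + 1) / 2 ^ n) \<in> borel_measurable G"
        by (rule Y) auto
      then show "(\<lambda>z. Y ((real_of_int (max 0 k) + 1) / 2 ^ n) (fst z)) \<in> borel_measurable (G \<Otimes>\<^sub>M borel)"
        by measurable
    qed measurable
    also have "(\<lambda>z. (\<lambda>k z. Y ((real_of_int (max 0 k) + 1) / 2 ^ n) (fst z)) (\<lfloor>2 ^ n * max 0 (snd z :: real)\<rfloor>) z)
        = (\<lambda>z. Y (q n (snd z)) (fst z))"
      unfolding q_def by (intro ext) (simp add: max_def)
    finally show ?thesis .
  qed
  moreover have "(\<lambda>n. Y (q n (snd z)) (fst z)) \<longlonglongrightarrow> (case z of (\<omega>, t) \<Rightarrow> Y (max 0 t) \<omega>)"
    if z: "z \<in> space (G \<Otimes>\<^sub>M borel)" for z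
  proof -
    obtain \<omega> t where [simp]: "z = (\<omega>, t)" by (cases z)
    have \<omega>: "\<omega> \<in> space G" using z by (simp add: space_pair_measure)
    have lim: "(\<lambda>n. q n t) \<longlonglongrightarrow> max 0 t"
    proof (rule tendsto_sandwich)
      show "(\<lambda>n. max 0 t) \<longlonglongrightarrow> max 0 t" by simp
      show "(\<lambda>n. max 0 t + 1 / 2 ^ n) \<longlonglongrightarrow> max 0 t"
        using tendsto_add[OF tendsto_const LIMSEQ_power_zero[of "1/2::real"], of "max 0 t"]
        by (simp add: power_one_over)
    qed (use qb in \<open>auto intro!: always_eventually less_imp_le\<close>)
    have "((\<lambda>t. Y t \<omega>) \<longlongrightarrow> Y (max 0 t) \<omega>) (at_right (max 0 t))"
      using rc[OF _ \<omega>, of "max 0 t"] by (simp add: continuous_within)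
    moreover have "filterlim (\<lambda>n. q n t) (at_right (max 0 t)) sequentially"
      unfolding filterlim_at using lim less_imp_neq[OF qb(1)[where t=t]] less_imp_le[OF qb(1)[where t=t]]
      by (metis (mono_tags, lifting) always_eventually greaterThan_iff qb(1))
    ultimately show ?thesis
      using filterlim_compose by fastforce
  qed
  ultimately show ?thesis
    by (rule borel_measurable_LIMSEQ_metric)
qed


section \<open>Test functions\<close>

lemma smooth_on_iff:
  "smooth_on U f \<longleftrightarrow> (\<forall>bs. set bs \<subseteq> Basis \<longrightarrow>
     continuous_on U (dpart bs f) \<and> (\<forall>x\<in>U. dpart bs f differentiable at x))"
proof (intro iffI allI impI)
  fix bs :: "'a list"
  assume "smooth_on U f" and bs: "set bs \<subseteq> Basis"
  then have "C_k_on (Suc (length bs)) U f" by (simp add: smooth_on_def)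
  then show "continuous_on U (dpart bs f) \<and> (\<forall>x\<in>U. dpart bs f differentiable at x)"
    using bs unfolding C_k_on_def by (drule_tac x=bs in spec) simp
next
  assume "\<forall>bs. set bs \<subseteq> Basis \<longrightarrow> continuous_on U (dpart bs f) \<and> (\<forall>x\<in>U. dpart bs f differentiable at x)"
  then show "smooth_on U f" unfolding smooth_on_def C_k_on_def
    by (intro allI impI) (drule_tac x=bs in spec, simp)
qed

lemma smooth_on_dpart:
  assumes "smooth_on U f" "set bs \<subseteq> Basis"
  shows "smooth_on U (dpart bs f)"
proof -
  have "dpart cs (dpart bs f) = dpart (bs @ cs) f" for cs
    by (induction bs arbitrary: f) simp_all
  then show ?thesis using assms unfolding smooth_on_iff by simp
qed

lemma smooth_on_imp_continuous_on: "smooth_on U f \<Longrightarrow> continuous_on U f"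
  unfolding smooth_on_iff by (drule spec[of _ "[]"]) simp

lemma smooth_on_imp_differentiable: "smooth_on U f \<Longrightarrow> x \<in> U \<Longrightarrow> f differentiable at x"
  unfolding smooth_on_iff by (drule spec[of _ "[]"]) simp

lemma dpart_cong_open:
  assumes "open U" "\<And>x. x \<in> U \<Longrightarrow> f x = g x" "x \<in> U"
  shows "dpart bs f x = dpart bs g x"
  using assms(2,3)
proof (induction bs arbitrary: f g x)
  case (Cons b bs)
  have "frechet_derivative f (at x) = frechet_derivative g (at x)" if "x \<in> U" for x
  proof -
    \<comment> \<open>\<open>frechet_derivative\<close> is a choice among the derivatives, so
      agreement of the derivative relations gives equality even at points without a
      derivative.\<close>
    have "(f has_derivative D) (at x) \<longleftrightarrow> (g has_derivative D) (at x)" for D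
      by (auto intro: has_derivative_transform_within_open[OF _ assms(1) that] simp: Cons.prems(1))
    then show ?thesis unfolding frechet_derivative_def by simp
  qed
  then show ?case
    using Cons.IH[of "\<lambda>x. frechet_derivative f (at x) b" "\<lambda>x. frechet_derivative g (at x) b" x] Cons.prems(2)
    by simp
qed simp

lemma dpart_zero: "dpart bs (\<lambda>_. 0) = (\<lambda>_. 0)"
  by (induction bs) (simp_all add: frechet_derivative_const)

lemma supp_dpart_subset: "supp (dpart bs \<phi>) \<subseteq> supp \<phi>"
proof -
  have "dpart bs \<phi> x = 0" if "x \<notin> supp \<phi>" for x
  proof -
    have "\<phi> y = 0" if "y \<in> - supp \<phi>" for y
      using that closure_subset[of "{x. \<phi> x \<noteq> 0}"] unfolding supp_def by blast
    moreover have "open (- supp \<phi>)" by (simp add: supp_def open_Compl)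
    ultimately have "dpart bs \<phi> x = dpart bs (\<lambda>_. 0) x"
      using that by (intro dpart_cong_open[where U="- supp \<phi>"]) blast+
    then show ?thesis by (simp only: dpart_zero)
  qed
  then have "{x. dpart bs \<phi> x \<noteq> 0} \<subseteq> supp \<phi>" by auto
  then show ?thesis unfolding supp_def by (simp add: closure_minimal)
qed

lemma test_fun_dpart:
  assumes "\<phi> \<in> test_fun" "set bs \<subseteq> Basis"
  shows "dpart bs \<phi> \<in> test_fun"
proof -
  have "compact (supp \<phi> \<inter> supp (dpart bs \<phi>))"
    using assms(1) unfolding test_fun_def by (intro compact_Int_closed) (auto simp: supp_def)
  moreover have "supp \<phi> \<inter> supp (dpart bs \<phi>) = supp (dpart bs \<phi>)"
    using supp_dpart_subset by blast
  ultimately show ?thesis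
    using assms smooth_on_dpart[OF _ assms(2), of UNIV \<phi>] by (simp add: test_fun_def)
qed

lemma test_fun_continuous: "\<phi> \<in> test_fun \<Longrightarrow> continuous_on UNIV \<phi>"
  by (simp add: test_fun_def smooth_on_imp_continuous_on)

lemma test_fun_zero_outside:
  assumes "\<phi> \<in> test_fun"
  obtains R where "0 < R" "\<And>x. R < norm x \<Longrightarrow> \<phi> x = 0"
proof -
  have "bounded (supp \<phi>)" using assms by (simp add: test_fun_def compact_imp_bounded)
  then obtain R where R: "0 < R" "\<forall>x\<in>supp \<phi>. norm x \<le> R" unfolding bounded_pos by blast
  have "x \<notin> supp \<phi> \<Longrightarrow> \<phi> x = 0" for x
    using closure_subset[of "{x. \<phi> x \<noteq> 0}"] unfolding supp_def by blast
  then have "\<phi> x = 0" if "R < norm x" for x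
    using R(2) that by (meson not_le)
  then show thesis using R(1) that by blast
qed

lemma test_fun_bounded:
  assumes "\<phi> \<in> test_fun"
  shows "bounded (range \<phi>)"
proof -
  have "compact (\<phi> ` supp \<phi>)"
    using assms test_fun_continuous[OF assms] continuous_on_subset
    by (intro compact_continuous_image) (auto simp: test_fun_def)
  then have "bounded (insert 0 (\<phi> ` supp \<phi>))" by (simp add: compact_imp_bounded)
  moreover have "range \<phi> \<subseteq> insert 0 (\<phi> ` supp \<phi>)"
    using closure_subset unfolding supp_def by fastforce
  ultimately show ?thesis by (rule bounded_subset)
qed

lemma test_fun_C_inf:
  assumes "\<phi> \<in> test_fun"
  shows "\<phi> \<in> C_inf"
proof -
  obtain R where R: "\<And>x. R < norm x \<Longrightarrow> \<phi> x = 0" using test_fun_zero_outside[OF assms] by blast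
  have "eventually (\<lambda>x. \<phi> x = 0) at_infinity"
    unfolding eventually_at_infinity by (rule exI[of _ "R + 1"]) (use R in auto)
  then show ?thesis
    using test_fun_continuous[OF assms] tendsto_eventually by (auto simp: C_inf_def)
qed

lemma test_fun_C2:
  assumes "\<phi> \<in> test_fun"
  shows "\<phi> \<in> C2_fun" "\<phi> \<in> C2_bounded"
proof -
  show "\<phi> \<in> C2_fun" using assms by (simp add: test_fun_def smooth_on_def C2_fun_def)
  then show "\<phi> \<in> C2_bounded"
    using test_fun_bounded[OF test_fun_dpart[OF assms]] by (auto simp: C2_bounded_def)
qed

lemma test_fun_has_deriv:
  fixes \<phi> :: "real \<Rightarrow> real"
  assumes "\<phi> \<in> test_fun"
  shows "(\<phi> has_real_derivative deriv \<phi> t) (at t)"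
proof -
  have "\<phi> differentiable at t"
    using assms smooth_on_imp_differentiable by (auto simp: test_fun_def)
  then show ?thesis
    using DERIV_deriv_iff_real_differentiable by blast
qed

lemma deriv_eq_dpart:
  fixes \<phi> :: "real \<Rightarrow> real"
  assumes "\<phi> \<in> test_fun"
  shows "deriv \<phi> = dpart [1] \<phi>"
proof
  fix t
  have "frechet_derivative \<phi> (at t) = (\<lambda>h. deriv \<phi> t * h)"
    using test_fun_has_deriv[OF assms, of t]
    by (intro frechet_derivative_at[symmetric]) (simp add: has_field_derivative_def)
  then show "deriv \<phi> t = dpart [1] \<phi> t" by simp
qed

lemma test_fun_deriv:
  fixes \<phi> :: "real \<Rightarrow> real"
  assumes "\<phi> \<in> test_fun"
  shows "deriv \<phi> \<in> test_fun"
  using test_fun_dpart[OF assms, of "[1]"] by (simp add: deriv_eq_dpart[OF assms])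

lemma deriv_translate:
  fixes \<phi> :: "real \<Rightarrow> real"
  assumes "\<phi> \<in> test_fun"
  shows "deriv (\<lambda>t. \<phi> (t + y)) = (\<lambda>t. deriv \<phi> (t + y))"
proof
  fix t
  have "((\<lambda>t. \<phi> (t + y)) has_real_derivative deriv \<phi> (t + y)) (at t)"
    using test_fun_has_deriv[OF assms, of "t + y"] by (simp add: DERIV_shift)
  then show "deriv (\<lambda>t. \<phi> (t + y)) t = deriv \<phi> (t + y)" by (rule DERIV_imp_deriv)
qed

text \<open>The majorant \<open>min 1 y\<close> is the function whose integrability characterises
  Levy measures of subordinators: the Lipschitz bound serves small \<open>y\<close>, boundedness
  large \<open>y\<close>. One constant \<open>K\<close> covers values and increments.\<close>

lemma test_fun_increment_bound:
  fixes \<phi> :: "real \<Rightarrow> real"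
  assumes "\<phi> \<in> test_fun"
  obtains R K where "0 < R" "0 < K" "\<And>t. R < \<bar>t\<bar> \<Longrightarrow> \<phi> t = 0" "\<And>t. \<bar>\<phi> t\<bar> \<le> K"
    "\<And>t y. 0 < y \<Longrightarrow> \<bar>\<phi> (t + y) - \<phi> t\<bar> \<le> K * min 1 y"
proof -
  obtain R where R: "0 < R" "\<And>t. R < \<bar>t\<bar> \<Longrightarrow> \<phi> t = 0"
    using test_fun_zero_outside[OF assms] by (metis real_norm_def)
  obtain K1 where K1: "0 < K1" "\<And>t. \<bar>\<phi> t\<bar> \<le> K1"
    using test_fun_bounded[OF assms] unfolding bounded_pos by auto
  obtain K2 where K2: "0 < K2" "\<And>t. \<bar>deriv \<phi> t\<bar> \<le> K2"
    using test_fun_bounded[OF test_fun_deriv[OF assms]] unfolding bounded_pos by auto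
  have "\<bar>\<phi> (t + y) - \<phi> t\<bar> \<le> K2 * y" if "0 < y" for t y
  proof -
    have "norm (\<phi> (t + y) - \<phi> t) \<le> K2 * norm (t + y - t)"
      by (rule field_differentiable_bound[where S=UNIV and f'="deriv \<phi>"])
        (use test_fun_has_deriv[OF assms] K2 in auto)
    then show ?thesis using that by simp
  qed
  moreover have "\<bar>\<phi> (t + y) - \<phi> t\<bar> \<le> 2 * K1" for t y
    using K1(2)[of t] K1(2)[of "t + y"] by linarith
  ultimately have *: "\<bar>\<phi> (t + y) - \<phi> t\<bar> \<le> (2 * K1 + K2) * min 1 y" if "0 < y" for t y
  proof (cases "1 \<le> y")
    case True
    then show ?thesis using \<open>\<And>y t. \<bar>\<phi> (t + y) - \<phi> t\<bar> \<le> 2 * K1\<close>[of t y] K2(1) by simp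
  next
    case False
    then have "\<bar>\<phi> (t + y) - \<phi> t\<bar> \<le> K2 * y + 2 * K1 * y"
      using \<open>\<And>y t. 0 < y \<Longrightarrow> \<bar>\<phi> (t + y) - \<phi> t\<bar> \<le> K2 * y\<close>[OF that, of t] K1(1) that
      by (auto intro: add_increasing2)
    then show ?thesis using False by (simp add: algebra_simps)
  qed
  show thesis
    by (rule that[of R "2 * K1 + K2"]) (use R K1 K2(1) * in \<open>auto intro: order_trans[OF K1(2)]\<close>)
qed

text \<open>The generator formula for \<open>X\<close> is only available for functions vanishing at both ends of the line.
  As \<open>X\<close> is nonnegative, multiplication by the following cutoff, which is constant on
  \<open>{0..}\<close>, does not affect what the generator says about \<open>X\<close>.\<close>

definition cutoff :: "real \<Rightarrow> real" where
  "cutoff x = (max 0 (1 - (max 0 (- x))\<^sup>2))\<^sup>2"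

definition cutoff' :: "real \<Rightarrow> real" where
  "cutoff' x = 4 * max 0 (1 - (max 0 (- x))\<^sup>2) * max 0 (- x)"

text \<open>Both squares in \<open>cutoff\<close> are there because squared positive parts are of
  class C^1 even at the kink, where the quotient is at most \<open>\<bar>h\<bar>\<close>; the
  derivative of \<open>cutoff\<close> then follows by the chain rule.\<close>

lemma pos_part_sq_deriv:
  fixes x :: real
  shows "((\<lambda>x. (max 0 x)\<^sup>2) has_real_derivative 2 * max 0 x) (at x)"
proof (cases x "0::real" rule: linorder_cases)
  case less
  have "((\<lambda>_. 0) has_real_derivative 0) (at x)" by simp
  then have "((\<lambda>x. (max 0 x)\<^sup>2) has_real_derivative 0) (at x)"
    by (rule has_field_derivative_transform_within_open[where S="{..<0}"]) (use less in auto)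
  then show ?thesis using less by simp
next
  case greater
  have "((\<lambda>x. x\<^sup>2) has_real_derivative 2 * x) (at x)" by (auto intro!: derivative_eq_intros)
  then have "((\<lambda>x. (max 0 x)\<^sup>2) has_real_derivative 2 * x) (at x)"
    by (rule has_field_derivative_transform_within_open[where S="{0<..}"]) (use greater in auto)
  then show ?thesis using greater by simp
next
  case equal
  have "((\<lambda>h. (max 0 h)\<^sup>2 / h) \<longlongrightarrow> 0) (at (0::real))"
  proof (rule Lim_null_comparison)
    have "norm ((max 0 h)\<^sup>2 / h) \<le> \<bar>h\<bar>" for h :: real
      by (cases "h \<le> 0") (auto simp: max_def power2_eq_square)
    then show "\<forall>\<^sub>F h in at 0. norm ((max 0 h)\<^sup>2 / h) \<le> \<bar>h :: real\<bar>" by simp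
    show "((\<lambda>h. \<bar>h :: real\<bar>) \<longlongrightarrow> 0) (at 0)"
      using tendsto_norm_zero[OF tendsto_ident_at[of "0::real" UNIV]] by simp
  qed
  then show ?thesis using equal by (simp add: DERIV_def)
qed

lemma cutoff_deriv: "(cutoff has_real_derivative cutoff' x) (at x)"
proof -
  have 1: "((\<lambda>x. 1 - (max 0 (- x))\<^sup>2) has_real_derivative 0 - 2 * max 0 (- x) * (- 1)) (at x)"
    by (rule DERIV_diff[OF DERIV_const DERIV_chain2[OF pos_part_sq_deriv]])
      (auto intro!: derivative_eq_intros)
  show ?thesis
    using DERIV_chain2[OF pos_part_sq_deriv 1] unfolding cutoff_def[abs_def] cutoff'_def by (simp add: algebra_simps)
qed

lemma cutoff_simps: "0 \<le> x \<Longrightarrow> cutoff x = 1" "0 \<le> x \<Longrightarrow> cutoff' x = 0" "x \<le> -1 \<Longrightarrow> cutoff x = 0" "x \<le> -1 \<Longrightarrow> cutoff' x = 0"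
proof -
  have "1 \<le> (max 0 (- x))\<^sup>2" if "x \<le> -1" using that by (intro one_le_power) auto
  then show "x \<le> -1 \<Longrightarrow> cutoff x = 0" "x \<le> -1 \<Longrightarrow> cutoff' x = 0" by (auto simp: cutoff_def cutoff'_def)
qed (auto simp: cutoff_def cutoff'_def)

lemma C_inf_realI:
  fixes f :: "real \<Rightarrow> real"
  assumes "continuous_on UNIV f" "(f \<longlongrightarrow> 0) at_top" "\<And>x. x \<le> -1 \<Longrightarrow> f x = 0"
  shows "f \<in> C_inf"
proof -
  have "(f \<longlongrightarrow> 0) at_bot"
    by (rule tendsto_eventually) (use assms(3) in \<open>auto simp: eventually_at_bot_linorder\<close>)
  then have "(f \<longlongrightarrow> 0) at_infinity"
    using assms(2) by (simp add: at_infinity_eq_at_top_bot filterlim_sup)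
  then show ?thesis using assms by (simp add: C_inf_def)
qed

lemma cutoff_mult_C1_inf:
  fixes f :: "real \<Rightarrow> real"
  assumes der: "\<And>x. (f has_real_derivative f' x) (at x)" and cont: "continuous_on UNIV f'"
    and lim: "(f \<longlongrightarrow> 0) at_top" "(f' \<longlongrightarrow> 0) at_top"
  shows "(\<lambda>x. cutoff x * f x) \<in> C1_inf"
    and "0 \<le> x \<Longrightarrow> deriv (\<lambda>x. cutoff x * f x) x = f' x"
proof -
  define g where "g x = cutoff x * f x" for x
  define g' where "g' x = cutoff' x * f x + cutoff x * f' x" for x
  have g: "(g has_real_derivative g' x) (at x)" for x
    unfolding g_def[abs_def] g'_def using DERIV_mult[OF cutoff_deriv der] by (simp add: algebra_simps)
  then have dg: "deriv g = g'" by (auto intro!: DERIV_imp_deriv)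
  have ev: "\<forall>\<^sub>F x in at_top. g x = f x" "\<forall>\<^sub>F x in at_top. g' x = f' x"
    by (auto simp: g_def g'_def cutoff_simps eventually_at_top_linorder intro!: exI[of _ 0])
  have "continuous_on UNIV f" using der DERIV_continuous_on by blast
  moreover have "continuous_on UNIV cutoff'" unfolding cutoff'_def by (intro continuous_intros)
  moreover have "continuous_on UNIV cutoff" unfolding cutoff_def by (intro continuous_intros)
  ultimately have c: "continuous_on UNIV g" "continuous_on UNIV g'"
    using cont unfolding g_def g'_def by (auto intro!: continuous_intros)
  have "g \<in> C_inf" "g' \<in> C_inf"
    using c ev lim by (auto intro!: C_inf_realI simp: tendsto_cong cutoff_simps) (auto simp: g_def g'_def cutoff_simps)
  then have "g \<in> C1_inf"
    using g by (auto simp: C1_inf_def dg field_differentiable_def)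
  then show "(\<lambda>x. cutoff x * f x) \<in> C1_inf" by (simp add: g_def[abs_def])
  show "deriv (\<lambda>x. cutoff x * f x) x = f' x" if "0 \<le> x"
    using dg that by (simp add: g_def[abs_def] g'_def cutoff_simps fun_eq_iff)
qed

section \<open>The Laplace exponent of the subordinator\<close>

text \<open>The derivative of \<open>exp (- w)\<close> has modulus at most 1 on the right
  half-plane, which is convex and contains the segment from 0 to \<open>w\<close>.\<close>

lemma norm_one_minus_exp_le:
  fixes w :: complex
  assumes "0 \<le> Re w"
  shows "norm (1 - exp (- w)) \<le> norm w"
proof -
  have "norm (exp (- w) - exp (- 0)) \<le> 1 * norm (w - 0)"
  proof (rule field_differentiable_bound[where S="{w. 0 \<le> Re w}" and f="\<lambda>w. exp (- w)" and f'="\<lambda>w. - exp (- w)"])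
    show "convex {w :: complex. 0 \<le> Re w}"
      using convex_halfspace_Re_ge[of 0] by (simp add: ge_iff_diff_ge_0 [symmetric])
  qed (use assms in \<open>auto intro!: derivative_eq_intros\<close>)
  then show ?thesis by (simp add: norm_minus_commute)
qed

locale stable_subordinator = prob_space M for M :: "'w measure" +
  fixes X :: "real \<Rightarrow> 'w \<Rightarrow> real" and \<nu> :: "real measure" and a \<epsilon> \<beta> :: real
  assumes a: "0 \<le> a"
    and nu: "levy_measure_subordinator \<nu>"
    and eps_beta: "0 < \<epsilon>" "0 < \<beta>" "\<beta> < 1" "stable_lower_bound \<nu> \<epsilon> \<beta>"
    and subord: "subordinator_with_generator M X \<nu> a"
begin

section \<open>Integration with respect to the Levy measure\<close>

lemma sets_nu [measurable_cong, simp]: "sets \<nu> = sets borel"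
  using nu by (simp add: levy_measure_subordinator_def)

lemma space_nu [simp]: "space \<nu> = UNIV"
  using sets_eq_imp_space_eq[OF sets_nu] by simp

lemma nu_pos: "AE y in \<nu>. 0 < y"
  using nu by (intro AE_I[where N="{..0}"]) (auto simp: levy_measure_subordinator_def)

lemma nu_min_integrable: "integrable \<nu> (\<lambda>y. min 1 y)"
proof (rule integrableI_bounded)
  have "(\<integral>\<^sup>+ y. ennreal (norm (min 1 y)) \<partial>\<nu>) = (\<integral>\<^sup>+ y. ennreal (min 1 y) \<partial>\<nu>)"
    using nu_pos by (intro nn_integral_cong_AE) (auto elim!: eventually_mono)
  then show "(\<integral>\<^sup>+ y. ennreal (norm (min 1 y)) \<partial>\<nu>) < \<infinity>"
    using nu by (simp add: levy_measure_subordinator_def)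
qed (simp add: measurable_cong_sets[OF sets_nu])

lemma nu_integrable:
  fixes f :: "real \<Rightarrow> 'b::{banach, second_countable_topology}"
  assumes "f \<in> borel_measurable borel" "\<And>y. 0 < y \<Longrightarrow> norm (f y) \<le> C * min 1 y"
  shows "integrable \<nu> f"
proof (rule Bochner_Integration.integrable_bound)
  show "integrable \<nu> (\<lambda>y. C * min 1 y)" using nu_min_integrable by simp
  show "AE y in \<nu>. norm (f y) \<le> norm (C * min 1 y)"
    using nu_pos
  proof eventually_elim
    case (elim y)
    then show ?case using assms(2)[OF elim] by simp
  qed
  show "f \<in> borel_measurable \<nu>" using assms(1) by (simp add: measurable_cong_sets[OF sets_nu])
qed

lemma emeasure_nu_atLeast: "0 < c \<Longrightarrow> emeasure \<nu> {c..} < \<infinity>"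
proof -
  assume c: "0 < c"
  have "integrable \<nu> (indicator {c..} :: real \<Rightarrow> real)"
  \<comment> \<open>Markov's inequality: for \<open>y \<ge> c\<close> the factor
    \<open>1 / c\<close> handles \<open>y < 1\<close>, the summand 1 handles
    \<open>y \<ge> 1\<close>.\<close>
  proof (rule nu_integrable[where C="1 + 1 / c"])
    show "norm (indicator {c..} y :: real) \<le> (1 + 1 / c) * min 1 y" if "0 < y" for y
    proof (cases "1 \<le> y")
      case False
      have "1 \<le> (1 + 1 / c) * y" if "c \<le> y"
        using that c \<open>0 < y\<close> by (simp add: field_simps add_increasing2)
      then show ?thesis using False \<open>0 < y\<close> c by (auto simp: indicator_def)
    qed (use c in \<open>auto simp: indicator_def\<close>)
  qed simp
  then show ?thesis
    by (subst (asm) integrable_indicator_iff) simp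
qed

text \<open>Fubini's theorem will be used with \<open>\<nu>\<close>, whose mass near 0 is infinite;
  the half-lines away from 0 have finite mass and exhaust \<open>{0<..}\<close>.\<close>

sublocale nu: sigma_finite_measure \<nu>
proof
  let ?A = "insert {..0} (range (\<lambda>n::nat. {1 / (real n + 1)..}))"
  have "\<exists>n::nat. 1 / (real n + 1) \<le> y" if "0 < y" for y :: real
    using that by (metis add.commute less_imp_le nat_approx_posE of_nat_Suc)
  then have "\<Union>?A = UNIV" by (auto simp: not_le) (meson not_le)
  moreover have "countable ?A" "?A \<subseteq> sets \<nu>" by auto
  moreover have "emeasure \<nu> {..0} \<noteq> \<infinity>"
    using nu by (simp add: levy_measure_subordinator_def)
  ultimately show "\<exists>A. countable A \<and> A \<subseteq> sets \<nu> \<and> \<Union> A = space \<nu> \<and> (\<forall>a\<in>A. emeasure \<nu> a \<noteq> \<infinity>)"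
    using emeasure_nu_atLeast by (intro exI[of _ ?A]) (auto simp: less_top)
qed

section \<open>Paths and increments of the subordinator\<close>

lemma X_measurable: "0 \<le> u \<Longrightarrow> X u \<in> borel_measurable M"
  using subord by (simp add: subordinator_with_generator_def levy_subordinator_def)

lemma X_mono: "\<omega> \<in> space M \<Longrightarrow> 0 \<le> u \<Longrightarrow> u \<le> v \<Longrightarrow> X u \<omega> \<le> X v \<omega>"
  using subord by (auto simp: subordinator_with_generator_def levy_subordinator_def mono_on_def)

lemma X_right_cont: "\<omega> \<in> space M \<Longrightarrow> 0 \<le> u \<Longrightarrow> continuous (at_right u) (\<lambda>v. X v \<omega>)"
  using subord by (simp add: subordinator_with_generator_def levy_subordinator_def)

lemma X_zero: "AE \<omega> in M. X 0 \<omega> = 0"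
  using subord by (simp add: subordinator_with_generator_def levy_subordinator_def)

lemma X_nonneg: "0 \<le> u \<Longrightarrow> AE \<omega> in M. 0 \<le> X u \<omega>"
  using X_zero AE_space
proof eventually_elim
  case (elim \<omega>)
  then show ?case using X_mono[of \<omega> 0 u] by simp
qed

lemma X_incr_distr: "0 \<le> s \<Longrightarrow> 0 \<le> u \<Longrightarrow> distr M borel (\<lambda>\<omega>. X (s + u) \<omega> - X s \<omega>) = distr M borel (X u)"
  using subord by (simp add: subordinator_with_generator_def levy_subordinator_def)

lemma X_incr_indep:
  assumes "0 \<le> s" "0 \<le> u"
  shows "indep_var borel (\<lambda>\<omega>. X s \<omega> - X 0 \<omega>) borel (\<lambda>\<omega>. X (s + u) \<omega> - X s \<omega>)"
proof -
  \<comment> \<open>The partition 0, \<open>s\<close>, \<open>s + u\<close>, continued constantly so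
    that \<open>r\<close> is monotone. The first increment is \<open>X s - X 0\<close>, because
    \<open>X 0\<close> vanishes only almost surely.\<close>
  define r where "r i = (if i = 0 then 0 else if i = 1 then s else s + u)" for i :: nat
  have "mono r" "0 \<le> r 0" using assms by (auto simp: r_def mono_def)
  then have "indep_vars (\<lambda>_. borel) (\<lambda>i \<omega>. X (r (Suc i)) \<omega> - X (r i) \<omega>) {..<2}"
    using subord by (simp add: subordinator_with_generator_def levy_subordinator_def)
  moreover have "{..<2::nat} = insert 0 {1}" by auto
  ultimately have "indep_vars (\<lambda>_. borel) (\<lambda>i \<omega>. X (r (Suc i)) \<omega> - X (r i) \<omega>) (insert 0 {1})"
    by (simp only:)
  from indep_vars_sum[OF _ _ this] show ?thesis by (simp add: r_def)
qed

text \<open>This is the Markov property of \<open>X\<close>. Both integrals on the right run over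
  the same space: \<open>\<omega>'\<close> supplies an independent copy of the increment, whose law
  is that of \<open>X u\<close> by stationarity.\<close>

lemma expectation_X_add:
  fixes f :: "real \<Rightarrow> 'b::{banach, second_countable_topology}"
  assumes s: "0 \<le> s" "0 \<le> u" and f [measurable]: "f \<in> borel_measurable borel" and bd: "\<And>x. norm (f x) \<le> C"
  shows "(LINT \<omega>|M. f (X (s + u) \<omega>)) = (LINT \<omega>|M. LINT \<omega>'|M. f (X s \<omega> + X u \<omega>'))"
proof -
  have [measurable]: "X s \<in> borel_measurable M" "X u \<in> borel_measurable M" "X (s + u) \<in> borel_measurable M" "X 0 \<in> borel_measurable M"
    using X_measurable s by auto
  let ?A = "\<lambda>\<omega>. X s \<omega> - X 0 \<omega>" and ?B = "\<lambda>\<omega>. X (s + u) \<omega> - X s \<omega>"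
  interpret A: prob_space "distr M borel ?A" by (rule prob_space_distr) measurable
  interpret B: prob_space "distr M borel ?B" by (rule prob_space_distr) measurable
  interpret AB: pair_prob_space "distr M borel ?A" "distr M borel ?B" ..
  have eq: "distr M borel ?A \<Otimes>\<^sub>M distr M borel ?B = distr M (borel \<Otimes>\<^sub>M borel) (\<lambda>\<omega>. (?A \<omega>, ?B \<omega>))"
    using X_incr_indep[OF s] unfolding indep_var_distribution_eq by simp
  have m: "(\<lambda>(x, y). f (x + y)) \<in> borel_measurable (borel \<Otimes>\<^sub>M borel)" by measurable
  have "(LINT \<omega>|M. f (X (s + u) \<omega>)) = (LINT \<omega>|M. f (?A \<omega> + ?B \<omega>))"
    using X_zero by (intro integral_cong_AE) (auto elim!: eventually_mono)
  also have "\<dots> = (LINT p|distr M (borel \<Otimes>\<^sub>M borel) (\<lambda>\<omega>. (?A \<omega>, ?B \<omega>)). (\<lambda>(x, y). f (x + y)) p)"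
    by (subst integral_distr) (use m in auto)
  also have "\<dots> = (LINT p|(distr M borel ?A \<Otimes>\<^sub>M distr M borel ?B). (\<lambda>(x, y). f (x + y)) p)"
    by (simp only: eq)
  also have "\<dots> = (LINT x|distr M borel ?A. LINT y|distr M borel ?B. f (x + y))"
  proof (rule AB.integral_fst'[symmetric, of "\<lambda>(x, y). f (x + y)", simplified])
    show "integrable (distr M borel ?A \<Otimes>\<^sub>M distr M borel ?B) (\<lambda>(x, y). f (x + y))"
      by (rule AB.integrable_const_bound[where B=C]) (use m bd in auto)
  qed
  also have "\<dots> = (LINT x|distr M borel ?A. LINT y|distr M borel (X u). f (x + y))"
    by (simp only: X_incr_distr[OF s])
  also have "\<dots> = (LINT x|distr M borel ?A. LINT \<omega>'|M. f (x + X u \<omega>'))"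
    by (subst integral_distr) auto
  also have "\<dots> = (LINT \<omega>|M. LINT \<omega>'|M. f (?A \<omega> + X u \<omega>'))"
    by (subst integral_distr) auto
  also have "\<dots> = (LINT \<omega>|M. LINT \<omega>'|M. f (X s \<omega> + X u \<omega>'))"
    using X_zero by (intro integral_cong_AE) (auto elim!: eventually_mono)
  finally show ?thesis .
qed

section \<open>The Laplace exponent on the closed right half-plane\<close>

definition Phi :: "complex \<Rightarrow> complex" where
  "Phi z = (LINT y|\<nu>. 1 - exp (- (of_real y * z))) + of_real a * z"

lemma Phi_integrand_bound:
  assumes "0 \<le> Re z" "0 < y"
  shows "norm (1 - exp (- (of_real y * z))) \<le> (2 + norm z) * min 1 y"
proof -
  have 1: "norm (1 - exp (- (of_real y * z))) \<le> y * norm z"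
    using norm_one_minus_exp_le[of "of_real y * z"] assms by (simp add: norm_mult)
  have "norm (exp (- (of_real y * z))) \<le> 1"
    unfolding norm_exp_eq_Re using assms by (simp add: mult_nonneg_nonneg)
  then have 2: "norm (1 - exp (- (of_real y * z))) \<le> 2"
    using norm_triangle_ineq4[of 1 "exp (- (of_real y * z))"] unfolding norm_one by linarith
  show ?thesis
  proof (cases "1 \<le> y")
    case True
    then show ?thesis using order_trans[OF 2, of "2 + norm z"] by simp
  next
    case False
    then have "min 1 y = y" by simp
    moreover have "y * norm z \<le> (2 + norm z) * y" using assms by (simp add: algebra_simps)
    ultimately show ?thesis using 1 by simp
  qed
qed

lemma Phi_integrable:
  assumes "0 \<le> Re z"
  shows "integrable \<nu> (\<lambda>y. 1 - exp (- (of_real y * z)))"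
  using Phi_integrand_bound[OF assms] by (intro nu_integrable) auto

lemma Phi_bound: 
  obtains C where "0 < C" "\<And>z. 0 \<le> Re z \<Longrightarrow> norm (Phi z) \<le> C * (2 + norm z)"
proof -
  define J where "J = (LINT y|\<nu>. min 1 y)"
  have "norm (Phi z) \<le> (1 + \<bar>J\<bar> + a) * (2 + norm z)" if z: "0 \<le> Re z" for z
  proof -
    have "norm (LINT y|\<nu>. 1 - exp (- (of_real y * z))) \<le> (LINT y|\<nu>. norm (1 - exp (- (of_real y * z))))"
      by (rule integral_norm_bound)
    also have "\<dots> \<le> (LINT y|\<nu>. (2 + norm z) * min 1 y)"
    proof (rule integral_mono_AE)
      show "AE y in \<nu>. norm (1 - exp (- (complex_of_real y * z))) \<le> (2 + norm z) * min 1 y"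
        using nu_pos by eventually_elim (rule Phi_integrand_bound[OF z])
    qed (use Phi_integrable[OF z] nu_min_integrable in auto)
    also have "\<dots> = (2 + norm z) * J" by (simp add: J_def)
    finally have "norm (Phi z) \<le> (2 + norm z) * J + a * norm z"
      unfolding Phi_def using norm_triangle_ineq[of "LINT y|\<nu>. 1 - exp (- (of_real y * z))" "of_real a * z"] a
      by (simp add: norm_mult)
    also have "\<dots> \<le> (2 + norm z) * (1 + \<bar>J\<bar>) + a * (2 + norm z)"
      using a by (intro add_mono mult_left_mono) auto
    also have "\<dots> = (1 + \<bar>J\<bar> + a) * (2 + norm z)" by (simp add: algebra_simps)
    finally show ?thesis .
  qed
  then show thesis using a by (intro that[of "1 + \<bar>J\<bar> + a"]) auto
qed

lemma Re_Phi: "0 \<le> Re z \<Longrightarrow> Re (Phi z) = (LINT y|\<nu>. 1 - exp (- (y * Re z)) * cos (y * Im z)) + a * Re z"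
  unfolding Phi_def using integral_Re[OF Phi_integrable, of z] by (simp add: Re_exp)

lemma Re_Phi_nonneg:
  assumes "0 \<le> Re z"
  shows "0 \<le> Re (Phi z)"
proof -
  have "0 \<le> (LINT y|\<nu>. 1 - exp (- (y * Re z)) * cos (y * Im z))"
  proof (rule integral_nonneg_AE)
    show "AE y in \<nu>. 0 \<le> 1 - exp (- (y * Re z)) * cos (y * Im z)"
      using nu_pos
    proof eventually_elim
      case (elim y)
      have "exp (- (y * Re z)) * cos (y * Im z) \<le> exp (- (y * Re z)) * 1"
        by (intro mult_left_mono) auto
      also have "\<dots> \<le> 1" using elim assms by simp
      finally show ?case by simp
    qed
  qed
  then show ?thesis using Re_Phi[OF assms] a assms by simp
qed

text \<open>The condition on \<open>x\<close> places the band inside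
  \<open>{0<..<\<epsilon>}\<close>. There the density is at least
  \<open>y powr (- 1 - \<beta>)\<close>, hence at least \<open>x powr (1 + \<beta>)\<close>; the
  length of the band is \<open>1 / (2 * x)\<close>. The power \<open>x powr \<beta>\<close> obtained
  here becomes the decay of the characteristic function.\<close>

lemma measure_nu_lower:
  assumes "1 / \<epsilon> \<le> x"
  shows "x powr \<beta> / 2 \<le> measure \<nu> {1 / (2 * x)<..<1 / x}"
    and "emeasure \<nu> {1 / (2 * x)<..<1 / x} < \<infinity>"
proof -
  have x: "0 < x" using assms eps_beta(1) by (meson divide_pos_pos less_le_trans zero_less_one)
  let ?B = "{1 / (2 * x)<..<1 / x}"
  have "1 / x \<le> \<epsilon>" using assms x eps_beta(1) by (simp add: field_simps)
  moreover have "0 < 1 / (2 * x)" using x by simp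
  ultimately have sub: "?B \<subseteq> {0<..<\<epsilon>}" by (auto intro: less_trans less_le_trans)
  have "emeasure \<nu> ?B \<le> emeasure \<nu> {1 / (2 * x)..}" by (rule emeasure_mono) auto
  then show fin: "emeasure \<nu> ?B < \<infinity>" using emeasure_nu_atLeast[of "1 / (2 * x)"] x by simp
  have "ennreal (x powr \<beta> / 2) = ennreal (x powr (1 + \<beta>)) * emeasure lborel ?B"
  proof -
    have "emeasure lborel ?B = ennreal (1 / x - 1 / (2 * x))" using x by (simp add: field_simps)
    also have "1 / x - 1 / (2 * x) = 1 / (2 * x)" using x by (simp add: field_simps)
    finally show ?thesis using x by (simp add: ennreal_mult[symmetric] powr_add field_simps)
  qed
  also have "\<dots> = (\<integral>\<^sup>+ y\<in>?B. ennreal (x powr (1 + \<beta>)) \<partial>lborel)"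
    by (simp add: nn_integral_cmult_indicator)
  also have "\<dots> \<le> (\<integral>\<^sup>+ y\<in>?B. ennreal (y powr (- 1 - \<beta>)) \<partial>lborel)"
  proof (rule nn_integral_mono)
    fix y :: real
    have "x powr (1 + \<beta>) \<le> y powr (- 1 - \<beta>)" if y: "y \<in> ?B"
    proof -
      have "0 < y" using y sub by auto
      have "x powr (1 + \<beta>) = (1 / x) powr (- 1 - \<beta>)"
        using x by (simp add: powr_divide powr_minus_divide[symmetric] add.commute)
      also have "\<dots> \<le> y powr (- 1 - \<beta>)"
        using y \<open>0 < y\<close> x eps_beta by (intro powr_mono2') auto
      finally show ?thesis .
    qed
    then show "ennreal (x powr (1 + \<beta>)) * indicator ?B y \<le> ennreal (y powr (- 1 - \<beta>)) * indicator ?B y"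
      by (auto simp: indicator_def intro: ennreal_leI)
  qed
  also have "\<dots> \<le> emeasure \<nu> ?B"
    using eps_beta(4) sub unfolding stable_lower_bound_def by auto
  also have "\<dots> = ennreal (measure \<nu> ?B)"
    using fin by (intro emeasure_eq_ennreal_measure) auto
  finally show "x powr \<beta> / 2 \<le> measure \<nu> ?B" by (simp add: ennreal_le_iff)
qed

lemma integral_nu_lower:
  assumes x: "1 / \<epsilon> \<le> x" and int: "integrable \<nu> f" and nn: "\<And>y. 0 < y \<Longrightarrow> 0 \<le> f y" and c: "0 \<le> c"
    and low: "\<And>y. 1 / (2 * x) < y \<Longrightarrow> y < 1 / x \<Longrightarrow> c \<le> f y"
  shows "c * (x powr \<beta> / 2) \<le> (LINT y|\<nu>. f y)"
proof -
  let ?B = "{1 / (2 * x)<..<1 / x}"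
  have "c * (x powr \<beta> / 2) \<le> c * measure \<nu> ?B"
    using c measure_nu_lower[OF x] by (intro mult_left_mono) auto
  also have "\<dots> = (LINT y|\<nu>. c * indicator ?B y)" by simp
  also have "\<dots> \<le> (LINT y|\<nu>. f y)"
  proof (rule integral_mono_AE)
    show "integrable \<nu> (\<lambda>y. c * indicator ?B y)"
      using measure_nu_lower(2)[OF x] by (intro integrable_mult_right) simp
    show "AE y in \<nu>. c * indicator ?B y \<le> f y"
      using nu_pos by eventually_elim (use nn low in \<open>auto simp: indicator_def\<close>)
  qed fact
  finally show ?thesis .
qed

lemma Re_Phi_one_pos: "0 < Re (Phi 1)"
proof -
  \<comment> \<open>The band for \<open>x = 1 / \<epsilon>\<close> runs from
    \<open>\<epsilon> / 2\<close> to \<open>\<epsilon>\<close>, and on it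
    \<open>1 - exp (- y)\<close> is at least its value at the left end.\<close>
  have "0 < (1 - exp (- (\<epsilon> / 2))) * ((1 / \<epsilon>) powr \<beta> / 2)"
    using eps_beta by auto
  also have "\<dots> \<le> (LINT y|\<nu>. 1 - exp (- (y * Re 1)) * cos (y * Im 1))"
  proof (rule integral_nu_lower)
    show "integrable \<nu> (\<lambda>y. 1 - exp (- (y * Re 1)) * cos (y * Im 1))"
      using integrable_Re[OF Phi_integrable[of 1]] by (simp add: Re_exp)
  qed (use eps_beta in auto)
  finally show ?thesis using Re_Phi[of 1] a by simp
qed

text \<open>On the imaginary axis the real part is the integral of
  \<open>1 - cos (y * \<xi>)\<close>. On the band for \<open>x = \<bar>\<xi>\<bar>\<close> the
  product \<open>y * \<bar>\<xi>\<bar>\<close> lies between 1/2 and 1, where the cosine is at most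
  \<open>cos (1 / 2)\<close>.\<close>

lemma Re_Phi_imaginary_lower:
  assumes "1 / \<epsilon> \<le> \<bar>\<xi>\<bar>"
  shows "(1 - cos (1 / 2)) / 2 * \<bar>\<xi>\<bar> powr \<beta> \<le> Re (Phi (- (\<i> * of_real \<xi>)))"
proof -
  have "0 < \<bar>\<xi>\<bar>" using assms eps_beta(1) by (meson divide_pos_pos less_le_trans zero_less_one)
  have "(1 - cos (1 / 2)) * (\<bar>\<xi>\<bar> powr \<beta> / 2) \<le> (LINT y|\<nu>. 1 - cos (y * \<xi>))"
  proof (rule integral_nu_lower[OF assms])
    show "integrable \<nu> (\<lambda>y. 1 - cos (y * \<xi>))"
      using integrable_Re[OF Phi_integrable[of "- (\<i> * of_real \<xi>)"]] by (simp add: Re_exp)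
    fix y assume y: "1 / (2 * \<bar>\<xi>\<bar>) < y" "y < 1 / \<bar>\<xi>\<bar>"
    have "1 / 2 \<le> y * \<bar>\<xi>\<bar>" "y * \<bar>\<xi>\<bar> \<le> 1" using y \<open>0 < \<bar>\<xi>\<bar>\<close> by (auto simp: field_simps)
    then have "cos (y * \<bar>\<xi>\<bar>) \<le> cos (1 / 2)"
      using pi_gt3 by (intro cos_monotone_0_pi_le) auto
    moreover have "cos (y * \<bar>\<xi>\<bar>) = cos (y * \<xi>)" by (auto simp: abs_if)
    ultimately show "1 - cos (1 / 2) \<le> 1 - cos (y * \<xi>)" by simp
  qed auto
  then show ?thesis using Re_Phi[of "- (\<i> * of_real \<xi>)"] by simp
qed

end

section \<open>From the generator to the Laplace transform of X(u)\<close>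

lemma exp_decay_tendsto_zero:
  fixes b :: "real \<Rightarrow> real"
  assumes "0 < \<sigma>" "\<And>x. \<bar>b x\<bar> \<le> B"
  shows "((\<lambda>x. exp (- (x * \<sigma>)) * b x) \<longlongrightarrow> 0) at_top"
proof (rule Lim_null_comparison)
  show "\<forall>\<^sub>F x in at_top. norm (exp (- (x * \<sigma>)) * b x) \<le> exp (- (x * \<sigma>)) * B"
    using assms(2) by (auto simp: abs_mult intro!: always_eventually mult_left_mono)
  show "((\<lambda>x. exp (- (x * \<sigma>)) * B) \<longlongrightarrow> 0) at_top"
    using assms(1) by real_asymp
qed

context stable_subordinator
begin

text \<open>\<open>g\<close> may behave arbitrarily at minus infinity: from a start
  \<open>x \<ge> 0\<close> neither \<open>X\<close> nor the jumps weighted by \<open>\<nu>\<close>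
  see the difference between \<open>g\<close> and its cut-off version. The uniformity in
  \<open>x \<ge> 0\<close> matters later, when \<open>x\<close> is replaced by the random point
  \<open>X s \<omega>\<close>.\<close>

lemma generator_half_line:
  fixes g :: "real \<Rightarrow> real"
  assumes der: "\<And>x. (g has_real_derivative g' x) (at x)" and cont: "continuous_on UNIV g'"
    and lim: "(g \<longlongrightarrow> 0) at_top" "(g' \<longlongrightarrow> 0) at_top"
  shows "uniform_limit {0..} (\<lambda>t x. ((LINT \<omega>|M. g (x + X t \<omega>)) - g x) / t)
           (\<lambda>x. (LINT y|\<nu>. g (x + y) - g x) + a * g' x) (at_right 0)"
proof -
  define c where "c x = cutoff x * g x" for x
  have c: "c \<in> C1_inf" "\<And>x. 0 \<le> x \<Longrightarrow> deriv c x = g' x"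
    unfolding c_def[abs_def] using cutoff_mult_C1_inf[OF assms] by auto
  have cg: "c x = g x" if "0 \<le> x" for x using that by (simp add: c_def cutoff_simps)
  have cm [measurable]: "c \<in> borel_measurable borel"
    using c(1) by (auto simp: C1_inf_def C_inf_def intro: borel_measurable_continuous_onI)
  have gm [measurable]: "g \<in> borel_measurable borel"
    using der by (intro borel_measurable_continuous_onI) (blast intro: DERIV_continuous_on)
  have "uniform_limit UNIV (\<lambda>t x. (kernel_op (\<lambda>u x. distr M borel (\<lambda>\<omega>. x + X u \<omega>)) t c x - c x) / t)
          (gen_A \<nu> a c) (at_right 0)"
    using subord c(1) unfolding subordinator_with_generator_def has_generator_value_def by blast
  then have U: "uniform_limit {0..} (\<lambda>t x. (kernel_op (\<lambda>u x. distr M borel (\<lambda>\<omega>. x + X u \<omega>)) t c x - c x) / t)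
          (gen_A \<nu> a c) (at_right 0)"
    by (rule uniform_limit_on_subset) simp
  have E: "\<forall>\<^sub>F t in at_right 0. \<forall>x\<in>{0..}.
      (kernel_op (\<lambda>u x. distr M borel (\<lambda>\<omega>. x + X u \<omega>)) t c x - c x) / t = ((LINT \<omega>|M. g (x + X t \<omega>)) - g x) / t"
  proof (rule eventually_mono[OF eventually_at_right_less], intro ballI)
    fix t x :: real assume "0 < t" "x \<in> {0..}"
    have [measurable]: "X t \<in> borel_measurable M" using X_measurable \<open>0 < t\<close> by simp
    have "kernel_op (\<lambda>u x. distr M borel (\<lambda>\<omega>. x + X u \<omega>)) t c x = (LINT \<omega>|M. c (x + X t \<omega>))"
      unfolding kernel_op_def by (rule integral_distr) measurable
    also have "\<dots> = (LINT \<omega>|M. g (x + X t \<omega>))"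
    proof (rule integral_cong_AE)
      show "AE \<omega> in M. c (x + X t \<omega>) = g (x + X t \<omega>)"
        using X_nonneg[of t] \<open>0 < t\<close> \<open>x \<in> {0..}\<close> by (auto elim!: eventually_mono simp: cg)
    qed measurable
    finally show "(kernel_op (\<lambda>u x. distr M borel (\<lambda>\<omega>. x + X u \<omega>)) t c x - c x) / t
        = ((LINT \<omega>|M. g (x + X t \<omega>)) - g x) / t"
      using \<open>x \<in> {0..}\<close> by (simp add: cg)
  qed
  have G: "gen_A \<nu> a c x = (LINT y|\<nu>. g (x + y) - g x) + a * g' x" if "x \<in> {0..}" for x
  proof -
    have "(LINT y|\<nu>. c (x + y) - c x) = (LINT y|\<nu>. g (x + y) - g x)"
    proof (rule integral_cong_AE)
      show "AE y in \<nu>. c (x + y) - c x = g (x + y) - g x"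
        using nu_pos that by (auto elim!: eventually_mono simp: cg)
    qed measurable
    then show ?thesis using c(2) that by (simp add: gen_A_def)
  qed
  show ?thesis
    by (rule iffD1[OF uniform_limit_cong U]) (fact E, fact G)
qed

text \<open>The generator formula at \<open>x = 0\<close>, for the function
  \<open>exp (- x z)\<close>. It concerns real functions, so the real part \<open>g1\<close> and the
  imaginary part \<open>g2\<close> are treated separately; \<open>Re z > 0\<close> makes both vanish
  at infinity together with their derivatives.\<close>

lemma laplace_generator_limit:
  assumes z: "0 < Re z"
  shows "((\<lambda>t. ((LINT \<omega>|M. exp (- (of_real (X t \<omega>) * z))) - 1) / of_real t) \<longlongrightarrow> - Phi z) (at_right 0)"
proof -
  define \<sigma> \<tau> where "\<sigma> = Re z" and "\<tau> = Im z"
  have \<sigma>: "0 < \<sigma>" using z by (simp add: \<sigma>_def)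
  define e where "e x = exp (- (of_real x * z))" for x :: real
  have em [measurable]: "e \<in> borel_measurable borel" unfolding e_def by measurable
  define g1 g1' g2 g2' where "g1 x = exp (- (x * \<sigma>)) * cos (x * \<tau>)"
    and "g1' x = exp (- (x * \<sigma>)) * (- \<sigma> * cos (x * \<tau>) - \<tau> * sin (x * \<tau>))"
    and "g2 x = exp (- (x * \<sigma>)) * (- sin (x * \<tau>))"
    and "g2' x = exp (- (x * \<sigma>)) * (\<sigma> * sin (x * \<tau>) - \<tau> * cos (x * \<tau>))" for x :: real
  have Re_e: "Re (e x) = g1 x" and Im_e: "Im (e x) = g2 x" for x
    by (simp_all add: e_def g1_def g2_def Re_exp Im_exp \<sigma>_def \<tau>_def)
  have d1: "(g1 has_real_derivative g1' x) (at x)" and d2: "(g2 has_real_derivative g2' x) (at x)" for x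
    unfolding g1_def[abs_def] g2_def[abs_def] g1'_def g2'_def
    by (auto intro!: derivative_eq_intros simp: algebra_simps)
  have c: "continuous_on UNIV g1'" "continuous_on UNIV g2'"
    unfolding g1'_def g2'_def by (intro continuous_intros)+
  have b: "\<bar>p * cos x + q * sin x\<bar> \<le> \<bar>p\<bar> + \<bar>q\<bar>" for p q x :: real
  proof -
    have "\<bar>p * cos x\<bar> \<le> \<bar>p\<bar>" "\<bar>q * sin x\<bar> \<le> \<bar>q\<bar>"
      by (auto simp: abs_mult intro: mult_left_le abs_cos_le_one abs_sin_le_one)
    then show ?thesis by linarith
  qed
  have "((\<lambda>x. exp (- (x * \<sigma>)) * cos (x * \<tau>)) \<longlongrightarrow> 0) at_top"
    by (rule exp_decay_tendsto_zero[OF \<sigma>]) (rule abs_cos_le_one)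
  moreover have "((\<lambda>x. exp (- (x * \<sigma>)) * (- sin (x * \<tau>))) \<longlongrightarrow> 0) at_top"
    by (rule exp_decay_tendsto_zero[OF \<sigma>, where B=1]) simp
  moreover have "((\<lambda>x. exp (- (x * \<sigma>)) * (- \<sigma> * cos (x * \<tau>) - \<tau> * sin (x * \<tau>))) \<longlongrightarrow> 0) at_top"
    by (rule exp_decay_tendsto_zero[OF \<sigma>, where B="\<bar>- \<sigma>\<bar> + \<bar>- \<tau>\<bar>"]) (use b[of "- \<sigma>" _ "- \<tau>"] in simp)
  moreover have "((\<lambda>x. exp (- (x * \<sigma>)) * (\<sigma> * sin (x * \<tau>) - \<tau> * cos (x * \<tau>))) \<longlongrightarrow> 0) at_top"
  proof (rule exp_decay_tendsto_zero[OF \<sigma>, where B="\<bar>- \<tau>\<bar> + \<bar>\<sigma>\<bar>"])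
    show "\<bar>\<sigma> * sin (x * \<tau>) - \<tau> * cos (x * \<tau>)\<bar> \<le> \<bar>- \<tau>\<bar> + \<bar>\<sigma>\<bar>" for x
      using b[of "- \<tau>" "x * \<tau>" \<sigma>] by (simp add: algebra_simps)
  qed
  ultimately have l: "(g1 \<longlongrightarrow> 0) at_top" "(g1' \<longlongrightarrow> 0) at_top" "(g2 \<longlongrightarrow> 0) at_top" "(g2' \<longlongrightarrow> 0) at_top"
    by (simp_all only: g1_def[abs_def] g2_def[abs_def] g1'_def[abs_def] g2'_def[abs_def])
  have lim: "((\<lambda>t. ((LINT \<omega>|M. g1 (X t \<omega>)) - g1 0) / t) \<longlongrightarrow> (LINT y|\<nu>. g1 y - g1 0) + a * g1' 0) (at_right 0)"
    "((\<lambda>t. ((LINT \<omega>|M. g2 (X t \<omega>)) - g2 0) / t) \<longlongrightarrow> (LINT y|\<nu>. g2 y - g2 0) + a * g2' 0) (at_right 0)"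
    using tendsto_uniform_limitI[OF generator_half_line[OF d1 c(1) l(1,2)], of 0]
      tendsto_uniform_limitI[OF generator_half_line[OF d2 c(2) l(3,4)], of 0] by simp_all
  have int_e: "integrable M (\<lambda>\<omega>. e (X t \<omega>))" if "0 \<le> t" for t
  proof (rule integrable_const_bound[where B=1])
    show "AE \<omega> in M. norm (e (X t \<omega>)) \<le> 1"
      using X_nonneg[OF that] \<sigma> by (auto elim!: eventually_mono simp: e_def norm_exp_eq_Re \<sigma>_def)
    show "(\<lambda>\<omega>. e (X t \<omega>)) \<in> borel_measurable M" using X_measurable[OF that] by measurable
  qed
  have ReIm: "Re (LINT \<omega>|M. e (X t \<omega>)) = (LINT \<omega>|M. g1 (X t \<omega>))" "Im (LINT \<omega>|M. e (X t \<omega>)) = (LINT \<omega>|M. g2 (X t \<omega>))"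
    if "0 \<le> t" for t
    using integral_Re[OF int_e[OF that]] integral_Im[OF int_e[OF that]] by (simp_all add: Re_e Im_e)
  have int_Phi: "integrable \<nu> (\<lambda>y. 1 - e y)" unfolding e_def using z by (intro Phi_integrable) simp
  have "Phi z = (LINT y|\<nu>. 1 - e y) + of_real a * z" by (simp add: Phi_def e_def)
  moreover have "Re (LINT y|\<nu>. 1 - e y) = - (LINT y|\<nu>. g1 y - 1)" "Im (LINT y|\<nu>. 1 - e y) = - (LINT y|\<nu>. g2 y)"
    using integral_Re[OF int_Phi] integral_Im[OF int_Phi]
    by (simp_all add: Re_e Im_e integral_minus[symmetric] del: integral_minus)
  ultimately have Phi: "Re (- Phi z) = (LINT y|\<nu>. g1 y - g1 0) + a * g1' 0" "Im (- Phi z) = (LINT y|\<nu>. g2 y - g2 0) + a * g2' 0"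
    by (simp_all add: g1_def g2_def g1'_def g2'_def \<sigma>_def \<tau>_def)
  have "((\<lambda>t. ((LINT \<omega>|M. e (X t \<omega>)) - 1) / of_real t) \<longlongrightarrow> - Phi z) (at_right 0)"
    unfolding tendsto_complex_iff
  proof
    have "\<forall>\<^sub>F t in at_right 0. ((LINT \<omega>|M. g1 (X t \<omega>)) - g1 0) / t = Re (((LINT \<omega>|M. e (X t \<omega>)) - 1) / of_real t)"
      by (rule eventually_mono[OF eventually_at_right_less]) (simp add: Re_divide_of_real ReIm g1_def)
    from Lim_transform_eventually[OF lim(1) this]
    show "((\<lambda>t. Re (((LINT \<omega>|M. e (X t \<omega>)) - 1) / of_real t)) \<longlongrightarrow> Re (- Phi z)) (at_right 0)"
      by (simp only: Phi)
    have "\<forall>\<^sub>F t in at_right 0. ((LINT \<omega>|M. g2 (X t \<omega>)) - g2 0) / t = Im (((LINT \<omega>|M. e (X t \<omega>)) - 1) / of_real t)"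
      by (rule eventually_mono[OF eventually_at_right_less]) (simp add: Im_divide_of_real ReIm g2_def)
    from Lim_transform_eventually[OF lim(2) this]
    show "((\<lambda>t. Im (((LINT \<omega>|M. e (X t \<omega>)) - 1) / of_real t)) \<longlongrightarrow> Im (- Phi z)) (at_right 0)"
      by (simp only: Phi)
  qed
  then show ?thesis by (simp add: e_def)
qed

lemma laplace_norm_le_1:
  assumes "0 \<le> Re z" "0 \<le> u"
  shows "norm (LINT \<omega>|M. exp (- (of_real (X u \<omega>) * z))) \<le> 1"
    and "integrable M (\<lambda>\<omega>. exp (- (of_real (X u \<omega>) * z)))"
proof -
  have [measurable]: "X u \<in> borel_measurable M" using X_measurable assms by simp
  have b: "AE \<omega> in M. norm (exp (- (of_real (X u \<omega>) * z))) \<le> 1"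
    using X_nonneg[OF assms(2)] assms by (auto elim!: eventually_mono simp: norm_exp_eq_Re)
  then show i: "integrable M (\<lambda>\<omega>. exp (- (of_real (X u \<omega>) * z)))"
    by (rule integrable_const_bound) measurable
  have "norm (LINT \<omega>|M. exp (- (of_real (X u \<omega>) * z))) \<le> (LINT \<omega>|M. norm (exp (- (of_real (X u \<omega>) * z))))"
    by (rule integral_norm_bound)
  also have "\<dots> \<le> (LINT \<omega>|M. 1)"
    by (rule integral_mono_AE[OF integrable_norm[OF i] _ b]) simp
  also have "\<dots> = 1" by (simp add: prob_space)
  finally show "norm (LINT \<omega>|M. exp (- (of_real (X u \<omega>) * z))) \<le> 1" .
qed

lemma laplace_add:
  assumes z: "0 \<le> Re z" and s: "0 \<le> s" "0 \<le> u"
  shows "(LINT \<omega>|M. exp (- (of_real (X (s + u) \<omega>) * z)))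
    = (LINT \<omega>|M. exp (- (of_real (X s \<omega>) * z))) * (LINT \<omega>|M. exp (- (of_real (X u \<omega>) * z)))"
proof -
  \<comment> \<open>\<open>expectation_X_add\<close> wants a function bounded on the whole line;
    truncation by \<open>max 0\<close> achieves this without affecting the nonnegative values of
    \<open>X\<close>.\<close>
  define e where "e x = exp (- (of_real (max 0 x) * z))" for x :: real
  have [measurable]: "e \<in> borel_measurable borel" unfolding e_def by measurable
  have [measurable]: "X s \<in> borel_measurable M" "X u \<in> borel_measurable M" "X (s + u) \<in> borel_measurable M"
    using X_measurable s by auto
  have eq: "(LINT \<omega>|M. exp (- (of_real (X v \<omega>) * z))) = (LINT \<omega>|M. e (X v \<omega>))" if "0 \<le> v" for v
    using X_nonneg[OF that] X_measurable[OF that] 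
    by (intro integral_cong_AE) (auto elim!: eventually_mono simp: e_def)
  have "(LINT \<omega>|M. e (X (s + u) \<omega>)) = (LINT \<omega>|M. LINT \<omega>'|M. e (X s \<omega> + X u \<omega>'))"
  proof (rule expectation_X_add[OF s])
    show "norm (e x) \<le> 1" for x using z by (simp add: e_def norm_exp_eq_Re)
  qed measurable
  also have "\<dots> = (LINT \<omega>|M. e (X s \<omega>) * (LINT \<omega>'|M. e (X u \<omega>')))"
  proof (rule integral_cong_AE)
    show "AE \<omega> in M. (LINT \<omega>'|M. e (X s \<omega> + X u \<omega>')) = e (X s \<omega>) * (LINT \<omega>'|M. e (X u \<omega>'))"
      using X_nonneg[OF s(1)]
    proof eventually_elim
      case (elim \<omega>)
      have "(LINT \<omega>'|M. e (X s \<omega> + X u \<omega>')) = (LINT \<omega>'|M. e (X s \<omega>) * e (X u \<omega>'))"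
        using X_nonneg[OF s(2)] elim
        by (intro integral_cong_AE) (auto elim!: eventually_mono simp: e_def exp_add[symmetric] algebra_simps)
      then show ?case by simp
    qed
  qed measurable
  also have "\<dots> = (LINT \<omega>|M. e (X s \<omega>)) * (LINT \<omega>'|M. e (X u \<omega>'))" by simp
  finally show ?thesis using s by (simp add: eq)
qed

lemma laplace_zero: "(LINT \<omega>|M. exp (- (of_real (X 0 \<omega>) * z))) = (1 :: complex)"
proof -
  have "(LINT \<omega>|M. exp (- (of_real (X 0 \<omega>) * z))) = (LINT \<omega>|M. 1)"
    using X_zero X_measurable[of 0] by (intro integral_cong_AE) (auto elim!: eventually_mono)
  then show ?thesis by (simp add: prob_space)
qed

text \<open>Both sides are n-th powers of their values at \<open>h = u / n\<close>. By
  \<open>laplace_generator_limit\<close> these values differ by o(h), and for numbers in the closed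
  unit disc the distance of n-th powers is at most n times the distance of the bases; hence the
  sides differ by at most n o(u / n), which tends to 0.\<close>

lemma laplace_pos:
  assumes z: "0 < Re z" and u: "0 \<le> u"
  shows "(LINT \<omega>|M. exp (- (of_real (X u \<omega>) * z))) = exp (- (of_real u * Phi z))"
proof (cases "u = 0")
  case True
  then show ?thesis by (simp add: laplace_zero)
next
  case False
  then have u: "0 < u" using u by simp
  define m where "m t = (LINT \<omega>|M. exp (- (of_real (X t \<omega>) * z)))" for t
  define w where "w t = exp (- (of_real t * Phi z))" for t :: real
  have m0: "m 0 = 1" by (simp add: m_def laplace_zero)
  have mpow: "m (real n * h) = m h ^ n" if "0 \<le> h" for n h
  proof (induction n)
    case (Suc n)
    have "m (real n * h + h) = m (real n * h) * m h"
      unfolding m_def using z that by (intro laplace_add) auto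
    then show ?case using Suc by (simp add: algebra_simps)
  qed (simp add: m0)
  define h where "h n = u / real (Suc n)" for n
  have h: "0 < h n" for n using u by (simp add: h_def)
  have hlim: "filterlim h (at_right 0) sequentially"
  proof -
    have "h \<longlonglongrightarrow> 0" unfolding h_def[abs_def] by real_asymp
    then show ?thesis using h by (simp add: filterlim_at less_imp_neq[THEN not_sym])
  qed
  have 1: "(\<lambda>n. (m (h n) - 1) / of_real (h n)) \<longlonglongrightarrow> - Phi z"
    using filterlim_compose[OF laplace_generator_limit[OF z] hlim] by (simp add: m_def)
  have "((\<lambda>t. w t) has_vector_derivative - Phi z) (at 0)"
    unfolding w_def
    by (rule has_vector_derivative_real_field[where f="\<lambda>t. exp (- (t * Phi z))"]) (auto intro!: derivative_eq_intros)
  then have "((\<lambda>t. (w t - w 0 - t *\<^sub>R (- Phi z)) /\<^sub>R \<bar>t\<bar>) \<longlongrightarrow> 0) (at 0)"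
    by (simp add: has_vector_derivative_def has_derivative_at_within has_derivative_def divide_inverse_commute)
  then have "((\<lambda>t. (w t - w 0 - t *\<^sub>R (- Phi z)) /\<^sub>R \<bar>t\<bar>) \<longlongrightarrow> 0) (at_right 0)"
    by (rule tendsto_mono[OF at_le, rotated]) simp
  then have "(\<lambda>n. (w (h n) - w 0 - h n *\<^sub>R (- Phi z)) /\<^sub>R \<bar>h n\<bar>) \<longlonglongrightarrow> 0"
    using hlim by (rule filterlim_compose)
  moreover have "(w (h n) - w 0 - h n *\<^sub>R (- Phi z)) /\<^sub>R \<bar>h n\<bar> = (w (h n) - 1) / of_real (h n) + Phi z" for n
    using h[of n] by (simp add: w_def scaleR_conv_of_real field_simps)
  ultimately have 2: "(\<lambda>n. (w (h n) - 1) / of_real (h n) + Phi z) \<longlonglongrightarrow> 0" by simp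
  have 3: "(\<lambda>n. (m (h n) - w (h n)) / of_real (h n)) \<longlonglongrightarrow> 0"
    using tendsto_diff[OF tendsto_add[OF 1 tendsto_const[of "Phi z"]] 2]
    by (simp add: diff_divide_distrib)
  have le: "norm (m u - w u) \<le> u * norm ((m (h n) - w (h n)) / of_real (h n))" for n
  proof -
    have u_eq: "u = real (Suc n) * h n" by (simp add: h_def)
    have "w u = w (h n) ^ Suc n"
      unfolding w_def exp_of_nat_mult[symmetric] by (subst u_eq) (simp add: algebra_simps)
    moreover have "m u = m (h n) ^ Suc n"
      by (subst u_eq) (rule mpow, use h[of n] in simp)
    moreover have "norm (w (h n)) \<le> 1"
      using Re_Phi_nonneg[of z] z h[of n] by (simp add: w_def norm_exp_eq_Re)
    moreover have "norm (m (h n)) \<le> 1"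
      unfolding m_def using z h[of n] by (intro laplace_norm_le_1) auto
    ultimately have "norm (m u - w u) \<le> real (Suc n) * norm (m (h n) - w (h n))"
      using norm_power_diff by metis
    also have "\<dots> = u * norm ((m (h n) - w (h n)) / of_real (h n))"
      unfolding norm_divide norm_of_real using u by (simp add: h_def)
    finally show ?thesis .
  qed
  have "norm (m u - w u) \<le> u * norm (0 :: complex)"
    by (rule tendsto_lowerbound[OF tendsto_mult_left[OF tendsto_norm[OF 3]]])
      (use le in \<open>auto intro!: always_eventually\<close>)
  then show ?thesis by (simp add: m_def w_def)
qed

text \<open>On the imaginary axis the exponential does not vanish at infinity, so the generator
  cannot be applied to it; both sides are continuous up to the boundary, which is approached from
  the interior.\<close>

lemma laplace:
  assumes z: "0 \<le> Re z" and u: "0 \<le> u"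
  shows "(LINT \<omega>|M. exp (- (of_real (X u \<omega>) * z))) = exp (- (of_real u * Phi z))"
proof -
  define w where "w n = z + of_real (1 / real (Suc n))" for n
  have w: "0 < Re (w n)" for n using z by (simp add: w_def add_nonneg_pos)
  have wlim: "w \<longlonglongrightarrow> z"
  proof -
    have "(\<lambda>n. 1 / real (Suc n)) \<longlonglongrightarrow> 0" by real_asymp
    then have "(\<lambda>n. z + complex_of_real (1 / real (Suc n))) \<longlonglongrightarrow> z + of_real 0"
      by (intro tendsto_intros)
    then show ?thesis by (simp add: w_def[abs_def])
  qed
  have [measurable]: "X u \<in> borel_measurable M" using X_measurable u by simp
  have 1: "(\<lambda>n. LINT \<omega>|M. exp (- (of_real (X u \<omega>) * w n))) \<longlonglongrightarrow> (LINT \<omega>|M. exp (- (of_real (X u \<omega>) * z)))"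
  proof (rule integral_dominated_convergence[where w="\<lambda>_. 1"])
    show "AE \<omega> in M. (\<lambda>n. exp (- (of_real (X u \<omega>) * w n))) \<longlonglongrightarrow> exp (- (of_real (X u \<omega>) * z))"
      using wlim by (auto intro!: tendsto_intros)
    show "AE \<omega> in M. norm (exp (- (of_real (X u \<omega>) * w n))) \<le> 1" for n
      using X_nonneg[OF u] w[of n] by (auto elim!: eventually_mono simp: norm_exp_eq_Re)
  qed auto
  have 2: "(\<lambda>n. LINT y|\<nu>. 1 - exp (- (of_real y * w n))) \<longlonglongrightarrow> (LINT y|\<nu>. 1 - exp (- (of_real y * z)))"
  \<comment> \<open>The bound \<open>2 + norm (w n)\<close> of \<open>Phi_integrand_bound\<close> is
    at most \<open>3 + norm z\<close>, since \<open>w n\<close> differs from \<open>z\<close> by at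
    most 1.\<close>
  proof (rule integral_dominated_convergence[where w="\<lambda>y. (3 + norm z) * min 1 y"])
    show "AE y in \<nu>. (\<lambda>n. 1 - exp (- (of_real y * w n))) \<longlonglongrightarrow> 1 - exp (- (of_real y * z))"
      using wlim by (auto intro!: tendsto_intros)
    show "AE y in \<nu>. norm (1 - exp (- (of_real y * w n))) \<le> (3 + norm z) * min 1 y" for n
      using nu_pos
    proof eventually_elim
      case (elim y)
      have "norm (w n) \<le> norm z + norm (of_real (1 / real (Suc n)) :: complex)"
        unfolding w_def by (rule norm_triangle_ineq)
      also have "\<dots> \<le> norm z + 1" unfolding norm_of_real by (simp add: divide_le_eq)
      finally have "(2 + norm (w n)) * min 1 y \<le> (3 + norm z) * min 1 y"
        using elim by (intro mult_right_mono) auto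
      then show ?case
        using order_trans[OF Phi_integrand_bound[OF less_imp_le[OF w[of n]] elim]] by blast
    qed
  qed (use nu_min_integrable in \<open>auto simp: measurable_cong_sets[OF sets_nu]\<close>)
  have "(\<lambda>n. exp (- (of_real u * Phi (w n)))) \<longlonglongrightarrow> exp (- (of_real u * Phi z))"
    unfolding Phi_def by (intro tendsto_intros 2 wlim)
  moreover have "(LINT \<omega>|M. exp (- (of_real (X u \<omega>) * w n))) = exp (- (of_real u * Phi (w n)))" for n
    by (rule laplace_pos[OF w u])
  ultimately show ?thesis using 1 LIMSEQ_unique by simp
qed

end

section \<open>The density of the hitting time\<close>

lemma integrable_inverse_1_plus_sq: "integrable lborel (\<lambda>x::real. inverse (1 + x\<^sup>2))"
  using integrable_inverse_1_plus_square by (simp add: set_integrable_def einterval_def)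

text \<open>The Fourier transform of the indicator function of the interval from \<open>- 1\<close> to \<open>t\<close>. The left end
  point carries no mass of the nonnegative \<open>X(u)\<close>, as the inversion formula requires.\<close>

definition kern :: "real \<Rightarrow> real \<Rightarrow> complex" where
  "kern t \<xi> = (iexp (- (\<xi> * (- 1))) - iexp (- (\<xi> * t))) / (\<i> * \<xi>)"

lemma kern_measurable [measurable]: "(\<lambda>(t, \<xi>). kern t \<xi>) \<in> borel_measurable (borel \<Otimes>\<^sub>M borel)"
  unfolding kern_def by measurable

lemma norm_kern:
  assumes "- 1 \<le> t"
  shows "norm (kern t \<xi>) \<le> t + 1"
\<comment> \<open>At \<open>\<xi> = 0\<close> the quotient has the value 0 by the convention for
  division.\<close>
proof (cases "\<xi> = 0")
  case False
  then show ?thesis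
    using Levy_Inversion_aux2[of "- t" 1 \<xi>] assms by (simp add: kern_def add.commute)
qed (use assms in \<open>simp add: kern_def\<close>)

section \<open>Fourier inversion for the distribution function of X(u)\<close>

context stable_subordinator
begin

definition psi :: "real \<Rightarrow> complex" where
  "psi \<xi> = Phi (- (\<i> * of_real \<xi>))"

lemma psi_measurable [measurable]: "psi \<in> borel_measurable borel"
  unfolding psi_def Phi_def by measurable

lemma Re_psi_nonneg: "0 \<le> Re (psi \<xi>)"
  unfolding psi_def by (rule Re_Phi_nonneg) simp

lemma char_X:
  assumes "0 \<le> u"
  shows "char (distr M borel (X u)) \<xi> = exp (- (of_real u * psi \<xi>))"
proof -
  have [measurable]: "X u \<in> borel_measurable M" using X_measurable assms by simp
  have "char (distr M borel (X u)) \<xi> = (LINT \<omega>|M. iexp (\<xi> * X u \<omega>))"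
    unfolding char_def by (subst integral_distr) auto
  also have "\<dots> = (LINT \<omega>|M. exp (- (of_real (X u \<omega>) * (- (\<i> * of_real \<xi>)))))"
    by (simp add: algebra_simps)
  also have "\<dots> = exp (- (of_real u * psi \<xi>))"
    unfolding psi_def by (rule laplace) (use assms in auto)
  finally show ?thesis .
qed

text \<open>The weight \<open>2 + \<bar>\<xi>\<bar>\<close> is the growth of \<open>psi\<close> in
  \<open>psi_bound\<close>, so this one majorant serves the inversion integral and its derivative in
  \<open>u\<close>. The exponential of a positive power of \<open>\<bar>\<xi>\<bar>\<close> beats
  any polynomial, here the weight times \<open>1 + \<xi>\<^sup>2\<close>, which leaves a multiple of
  the Cauchy density.\<close>

lemma integrable_psi_decay:
  assumes "0 < u"
  shows "integrable lborel (\<lambda>\<xi>. (2 + \<bar>\<xi>\<bar>) * exp (- (u * Re (psi \<xi>))))"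
proof -
  define c where "c = u * ((1 - cos (1 / 2)) / 2)"
  have "cos (1 / 2 :: real) < cos 0" using pi_gt3 by (intro cos_monotone_0_pi) auto
  then have c: "0 < c" using assms by (simp add: c_def)
  have "((\<lambda>x. (2 + x) * (1 + x\<^sup>2) * exp (- (c * x powr \<beta>))) \<longlongrightarrow> 0) at_top"
    using c eps_beta(2) by real_asymp
  then have "\<forall>\<^sub>F x in at_top. (2 + x) * (1 + x\<^sup>2) * exp (- (c * x powr \<beta>)) < 1"
    by (rule order_tendstoD) simp
  then obtain x0 where x0: "\<And>x. x0 \<le> x \<Longrightarrow> (2 + x) * (1 + x\<^sup>2) * exp (- (c * x powr \<beta>)) < 1"
    by (auto simp: eventually_at_top_linorder)
  \<comment> \<open>Beyond \<open>R\<close> both the asymptotic estimate and the lower bound on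
    \<open>Re (psi \<xi>)\<close> are valid; inside, the exponential is at most 1 and the polynomial
    at most its value at \<open>R\<close>. \<open>K\<close> adds the two bounds.\<close>
  define R where "R = max (max x0 (1 / \<epsilon>)) 0"
  define K where "K = 1 + (2 + R) * (1 + R\<^sup>2)"
  have K: "0 \<le> (2 + R) * (1 + R\<^sup>2)" by (auto simp: R_def)
  show ?thesis
  proof (rule Bochner_Integration.integrable_bound)
    show "integrable lborel (\<lambda>x::real. K * inverse (1 + x\<^sup>2))"
      using integrable_inverse_1_plus_sq by simp
    have "(2 + \<bar>\<xi>\<bar>) * exp (- (u * Re (psi \<xi>))) \<le> K * inverse (1 + \<xi>\<^sup>2)" for \<xi>
    proof -
      have "(2 + \<bar>\<xi>\<bar>) * (1 + \<xi>\<^sup>2) * exp (- (u * Re (psi \<xi>))) \<le> K"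
      proof (cases "R \<le> \<bar>\<xi>\<bar>")
        case True
        then have "x0 \<le> \<bar>\<xi>\<bar>" "1 / \<epsilon> \<le> \<bar>\<xi>\<bar>" by (auto simp: R_def)
        have "c * \<bar>\<xi>\<bar> powr \<beta> \<le> u * Re (psi \<xi>)"
          using mult_left_mono[OF Re_Phi_imaginary_lower[OF \<open>1 / \<epsilon> \<le> \<bar>\<xi>\<bar>\<close>], of u] assms
          by (simp add: psi_def c_def mult.assoc)
        then have "(2 + \<bar>\<xi>\<bar>) * (1 + \<xi>\<^sup>2) * exp (- (u * Re (psi \<xi>)))
            \<le> (2 + \<bar>\<xi>\<bar>) * (1 + \<bar>\<xi>\<bar>\<^sup>2) * exp (- (c * \<bar>\<xi>\<bar> powr \<beta>))"
          by (intro mult_mono) auto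
        also have "\<dots> < 1" by (rule x0) fact
        finally show ?thesis using K by (simp add: K_def)
      next
        case False
        have "(2 + \<bar>\<xi>\<bar>) * (1 + \<bar>\<xi>\<bar>\<^sup>2) * exp (- (u * Re (psi \<xi>))) \<le> ((2 + R) * (1 + R\<^sup>2)) * 1"
          using False Re_psi_nonneg[of \<xi>] assms
          by (intro mult_mono add_left_mono power_mono) (auto simp: R_def)
        then show ?thesis by (simp add: K_def)
      qed
      then show ?thesis
        by (subst inverse_eq_divide, subst times_divide_eq_right, subst pos_le_divide_eq)
          (auto simp: algebra_simps add_pos_nonneg)
    qed
    then show "AE \<xi> in lborel. norm ((2 + \<bar>\<xi>\<bar>) * exp (- (u * Re (psi \<xi>)))) \<le> norm (K * inverse (1 + \<xi>\<^sup>2))"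
      unfolding real_norm_def by (intro AE_I2, subst abs_of_nonneg) (auto intro: order_trans[OF _ abs_ge_self])
  qed measurable
qed

definition Dfourier :: "real \<Rightarrow> real \<Rightarrow> complex" where
  "Dfourier t u = 1 / (2 * pi) * (LINT \<xi>|lborel. kern t \<xi> * exp (- (of_real u * psi \<xi>)))"

definition Qfourier :: "real \<Rightarrow> real \<Rightarrow> complex" where
  "Qfourier t u = 1 / (2 * pi) * (LINT \<xi>|lborel. kern t \<xi> * (psi \<xi> * exp (- (of_real u * psi \<xi>))))"

lemma fourier_measurable [measurable]:
  "(\<lambda>(t, u). Dfourier t u) \<in> borel_measurable (borel \<Otimes>\<^sub>M borel)"
  "(\<lambda>(t, u). Qfourier t u) \<in> borel_measurable (borel \<Otimes>\<^sub>M borel)"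
  unfolding Dfourier_def Qfourier_def by measurable

lemma Dfourier_integrand_bound:
  assumes "- 1 \<le> t" "t \<le> r" "v \<le> u"
  shows "norm (kern t \<xi> * exp (- (of_real u * psi \<xi>))) \<le> (r + 1) * ((2 + \<bar>\<xi>\<bar>) * exp (- (v * Re (psi \<xi>))))"
proof -
  have "exp (- (u * Re (psi \<xi>))) \<le> exp (- (v * Re (psi \<xi>)))"
    using assms(3) Re_psi_nonneg[of \<xi>] by (simp add: mult_right_mono)
  also have "\<dots> \<le> (2 + \<bar>\<xi>\<bar>) * exp (- (v * Re (psi \<xi>)))" by simp
  finally show ?thesis
    using norm_kern[OF assms(1), of \<xi>] assms
    unfolding norm_mult norm_exp_eq_Re by (intro mult_mono) auto
qed

lemma psi_bound:
  obtains C where "0 < C" "\<And>\<xi>. norm (psi \<xi>) \<le> C * (2 + \<bar>\<xi>\<bar>)"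
proof -
  obtain C where "0 < C" "\<And>z. 0 \<le> Re z \<Longrightarrow> norm (Phi z) \<le> C * (2 + norm z)"
    using Phi_bound by blast
  then show thesis
    by (intro that[of C]) (auto simp: psi_def norm_mult dest!: meta_spec[of _ "- (\<i> * complex_of_real _)"])
qed

lemma Qfourier_integrand_bound:
  obtains C where "0 < C"
    "\<And>t r u v \<xi>. - 1 \<le> t \<Longrightarrow> t \<le> r \<Longrightarrow> v \<le> u \<Longrightarrow>
       norm (kern t \<xi> * (psi \<xi> * exp (- (of_real u * psi \<xi>)))) \<le> C * (r + 1) * ((2 + \<bar>\<xi>\<bar>) * exp (- (v * Re (psi \<xi>))))"
proof -
  obtain C where C: "0 < C" "\<And>\<xi>. norm (psi \<xi>) \<le> C * (2 + \<bar>\<xi>\<bar>)" using psi_bound by blast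
  have "norm (kern t \<xi> * (psi \<xi> * exp (- (of_real u * psi \<xi>)))) \<le> C * (r + 1) * ((2 + \<bar>\<xi>\<bar>) * exp (- (v * Re (psi \<xi>))))"
    if "- 1 \<le> t" "t \<le> r" "v \<le> u" for t r u v \<xi>
  proof -
    have "exp (- (u * Re (psi \<xi>))) \<le> exp (- (v * Re (psi \<xi>)))"
      using that(3) Re_psi_nonneg[of \<xi>] by (simp add: mult_right_mono)
    then have "norm (kern t \<xi>) * (norm (psi \<xi>) * exp (- (u * Re (psi \<xi>))))
        \<le> (r + 1) * ((C * (2 + \<bar>\<xi>\<bar>)) * exp (- (v * Re (psi \<xi>))))"
      using norm_kern[OF that(1), of \<xi>] that C by (intro mult_mono) auto
    then show ?thesis by (simp add: norm_mult norm_exp_eq_Re algebra_simps)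
  qed
  then show thesis using C(1) that by blast
qed

abbreviation D :: "real \<Rightarrow> real \<Rightarrow> real" where
  "D t u \<equiv> prob {\<omega> \<in> space M. X u \<omega> \<le> t}"

lemma D_eq_cdf:
  assumes "0 \<le> u"
  shows "cdf (distr M borel (X u)) t = D t u"
  unfolding cdf_def using X_measurable[OF assms]
  by (subst measure_distr) (auto intro!: arg_cong[where f=prob])

lemma D_negative:
  assumes "0 \<le> u" "t < 0"
  shows "D t u = 0"
proof -
  have [measurable]: "X u \<in> borel_measurable M" using X_measurable assms by simp
  have "AE \<omega> in M. \<not> X u \<omega> \<le> t" using X_nonneg[OF assms(1)] assms(2) by (auto elim!: eventually_mono)
  then show ?thesis by (intro prob_eq_0[THEN iffD2]) (auto elim!: eventually_mono)
qed

text \<open>Levy's inversion formula requires end points without mass; \<open>- 1\<close> is one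
  because \<open>X u\<close> is almost surely nonnegative. It gives a limit over symmetric
  intervals, which is a plain integral here by absolute integrability.\<close>

lemma Dfourier_eq_no_atom:
  assumes u: "0 < u" and t: "- 1 \<le> t" and atom: "measure (distr M borel (X u)) {t} = 0"
  shows "Dfourier t u = of_real (D t u)"
proof -
  let ?N = "distr M borel (X u)"
  have [measurable]: "X u \<in> borel_measurable M" using X_measurable u by simp
  interpret N: real_distribution ?N by (rule real_distribution_distr) measurable
  have m1: "measure ?N {- 1} = 0" "measure ?N {..- 1} = 0"
  proof -
    have "measure ?N {..- 1} = D (- 1) u" using D_eq_cdf[of u "- 1"] u by (simp add: cdf_def)
    then show "measure ?N {..- 1} = 0" using D_negative[of u "- 1"] u by simp
    then show "measure ?N {- 1} = 0"
      using N.finite_measure_mono[of "{- 1}" "{..- 1}"] by (simp add: measure_le_0_iff)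
  qed
  let ?f = "\<lambda>\<xi>. kern t \<xi> * exp (- (of_real u * psi \<xi>))"
  have "(\<lambda>T::nat. 1 / (2 * pi) * (CLBINT \<xi>=-real T..real T. ?f \<xi>)) \<longlonglongrightarrow> measure ?N {- 1<..t}"
    using N.Levy_Inversion[OF t m1(1) atom] u by (simp only: kern_def char_X less_imp_le of_int_minus of_int_of_nat_eq)
  moreover have "(\<lambda>T::nat. 1 / (2 * pi) * (CLBINT \<xi>=-real T..real T. ?f \<xi>)) \<longlonglongrightarrow> Dfourier t u"
    unfolding Dfourier_def
  proof (intro tendsto_intros)
    have "(\<lambda>T::nat. LINT \<xi>|lborel. indicator {-real T<..<real T} \<xi> *\<^sub>R ?f \<xi>) \<longlonglongrightarrow> (LINT \<xi>|lborel. ?f \<xi>)"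
    proof (rule integral_dominated_convergence[where w="\<lambda>\<xi>. (t + 1) * ((2 + \<bar>\<xi>\<bar>) * exp (- (u * Re (psi \<xi>))))"])
      show "integrable lborel (\<lambda>\<xi>. (t + 1) * ((2 + \<bar>\<xi>\<bar>) * exp (- (u * Re (psi \<xi>)))))"
        using integrable_psi_decay[OF u] by simp
      show "AE \<xi> in lborel. (\<lambda>T::nat. indicator {-real T<..<real T} \<xi> *\<^sub>R ?f \<xi>) \<longlonglongrightarrow> ?f \<xi>"
      proof (intro AE_I2 tendsto_eventually)
        fix \<xi> :: real
        obtain n :: nat where "\<bar>\<xi>\<bar> < real n" using reals_Archimedean2 by blast
        then show "\<forall>\<^sub>F T in sequentially. indicator {-real T<..<real T} \<xi> *\<^sub>R ?f \<xi> = ?f \<xi>"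
          by (intro eventually_sequentiallyI[of n]) (auto simp: indicator_def)
      qed
      show "AE \<xi> in lborel. norm (indicator {-real T<..<real T} \<xi> *\<^sub>R ?f \<xi>) \<le> (t + 1) * ((2 + \<bar>\<xi>\<bar>) * exp (- (u * Re (psi \<xi>))))" for T :: nat
      proof (rule AE_I2)
        fix \<xi> :: real
        have "norm (indicator {-real T<..<real T} \<xi> *\<^sub>R ?f \<xi>) \<le> norm (?f \<xi>)"
          by (simp add: indicator_def)
        also have "\<dots> \<le> (t + 1) * ((2 + \<bar>\<xi>\<bar>) * exp (- (u * Re (psi \<xi>))))"
          by (rule Dfourier_integrand_bound) (use t in auto)
        finally show "norm (indicator {-real T<..<real T} \<xi> *\<^sub>R ?f \<xi>) \<le> (t + 1) * ((2 + \<bar>\<xi>\<bar>) * exp (- (u * Re (psi \<xi>))))" .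
      qed
    qed measurable
    then show "(\<lambda>T::nat. CLBINT \<xi>=-real T..real T. ?f \<xi>) \<longlonglongrightarrow> (LINT \<xi>|lborel. ?f \<xi>)"
      by (simp add: interval_lebesgue_integral_def set_lebesgue_integral_def)
  qed
  ultimately have "Dfourier t u = measure ?N {- 1<..t}"
    by (rule LIMSEQ_unique[symmetric])
  also have "{- 1<..t} = {..t} - {..- 1}" by auto
  also have "measure ?N ({..t} - {..- 1}) = measure ?N {..t} - measure ?N {..- 1}"
    by (rule N.finite_measure_Diff) (use t in auto)
  also have "\<dots> = D t u" using D_eq_cdf[of u t] m1 u by (simp add: cdf_def)
  finally show ?thesis .
qed

text \<open>A distribution has only countably many atoms, so points without mass decrease to any
  given \<open>t\<close>. Along them \<open>D\<close> converges by right continuity and the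
  inversion integral by dominated convergence.\<close>

lemma Dfourier_eq:
  assumes u: "0 < u" and t: "- 1 \<le> t"
  shows "Dfourier t u = of_real (D t u)"
proof -
  let ?N = "distr M borel (X u)"
  have [measurable]: "X u \<in> borel_measurable M" using X_measurable u by simp
  interpret N: real_distribution ?N by (rule real_distribution_distr) measurable
  have "\<exists>b. t < b \<and> b < t + 1 / real (Suc n) \<and> measure ?N {b} = 0" for n
  proof -
    have "uncountable {t<..<t + 1 / real (Suc n)}" by (simp add: uncountable_open_interval)
    then have "\<not> {t<..<t + 1 / real (Suc n)} \<subseteq> {x. measure ?N {x} > 0}"
      using N.countable_atoms countable_subset by blast
    then obtain b where "b \<in> {t<..<t + 1 / real (Suc n)}" "\<not> measure ?N {b} > 0" by blast
    then show ?thesis by (intro exI[of _ b]) (auto simp: zero_less_measure_iff)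
  qed
  then obtain b where b: "\<And>n. t < b n" "\<And>n. b n < t + 1 / real (Suc n)" "\<And>n. measure ?N {b n} = 0"
    by metis
  have blim: "b \<longlonglongrightarrow> t"
  proof (rule tendsto_sandwich)
    show "(\<lambda>_. t) \<longlonglongrightarrow> t" by simp
    show "(\<lambda>n. t + 1 / real (Suc n)) \<longlonglongrightarrow> t" by real_asymp
  qed (use b in \<open>auto intro!: always_eventually less_imp_le\<close>)
  have ble: "b n \<le> t + 1" for n
    using b(2)[of n] by (rule less_imp_le[THEN order_trans]) (simp add: divide_le_eq)
  have "(\<lambda>n. D (b n) u) \<longlonglongrightarrow> D t u"
  proof -
    have "filterlim b (at_right t) sequentially"
      using blim b(1) by (auto simp: filterlim_at intro!: always_eventually dest: less_imp_neq)
    moreover have "(cdf ?N \<longlongrightarrow> cdf ?N t) (at_right t)"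
      using N.cdf_is_right_cont by (simp add: continuous_within)
    ultimately have "(\<lambda>n. cdf ?N (b n)) \<longlonglongrightarrow> cdf ?N t" by (rule filterlim_compose[rotated])
    then show ?thesis using u by (simp add: D_eq_cdf)
  qed
  then have 1: "(\<lambda>n. Dfourier (b n) u) \<longlonglongrightarrow> of_real (D t u)"
    using Dfourier_eq_no_atom[OF u _ b(3)] b(1) t by (simp add: less_imp_le order_trans[of "- 1" t] tendsto_of_real)
  have 2: "(\<lambda>n. Dfourier (b n) u) \<longlonglongrightarrow> Dfourier t u"
    unfolding Dfourier_def
  proof (intro tendsto_intros)
    show "(\<lambda>n. LINT \<xi>|lborel. kern (b n) \<xi> * exp (- (of_real u * psi \<xi>))) \<longlonglongrightarrow> (LINT \<xi>|lborel. kern t \<xi> * exp (- (of_real u * psi \<xi>)))"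
    proof (rule integral_dominated_convergence[where w="\<lambda>\<xi>. (t + 1 + 1) * ((2 + \<bar>\<xi>\<bar>) * exp (- (u * Re (psi \<xi>))))"])
      show "AE \<xi> in lborel. (\<lambda>n. kern (b n) \<xi> * exp (- (of_real u * psi \<xi>))) \<longlonglongrightarrow> kern t \<xi> * exp (- (of_real u * psi \<xi>))"
      proof (rule AE_I2)
        fix \<xi> :: real
        show "(\<lambda>n. kern (b n) \<xi> * exp (- (of_real u * psi \<xi>))) \<longlonglongrightarrow> kern t \<xi> * exp (- (of_real u * psi \<xi>))"
          unfolding kern_def divide_inverse by (intro tendsto_intros blim)
      qed
      show "AE \<xi> in lborel. norm (kern (b n) \<xi> * exp (- (of_real u * psi \<xi>)))
          \<le> (t + 1 + 1) * ((2 + \<bar>\<xi>\<bar>) * exp (- (u * Re (psi \<xi>))))" for n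
        using Dfourier_integrand_bound[of "b n" "t + 1" u u] ble[of n] b(1)[of n] t by (intro AE_I2) auto
      show "integrable lborel (\<lambda>\<xi>. (t + 1 + 1) * ((2 + \<bar>\<xi>\<bar>) * exp (- (u * Re (psi \<xi>)))))"
        using integrable_psi_decay[OF u] by simp
    qed measurable
  qed
  show ?thesis using LIMSEQ_unique[OF 2 1] .
qed

lemma Dfourier_deriv:
  assumes u: "0 < u" and t: "- 1 \<le> t"
  shows "(Dfourier t has_vector_derivative - Qfourier t u) (at u)"
proof -
  obtain C where C: "0 < C" "\<And>t r u v \<xi>. - 1 \<le> t \<Longrightarrow> t \<le> r \<Longrightarrow> v \<le> u \<Longrightarrow>
       norm (kern t \<xi> * (psi \<xi> * exp (- (of_real u * psi \<xi>)))) \<le> C * (r + 1) * ((2 + \<bar>\<xi>\<bar>) * exp (- (v * Re (psi \<xi>))))"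
    using Qfourier_integrand_bound by blast
  have "((\<lambda>w. LINT \<xi>|lborel. kern t \<xi> * exp (- (of_real w * psi \<xi>))) has_vector_derivative
      (LINT \<xi>|lborel. - (kern t \<xi> * (psi \<xi> * exp (- (of_real u * psi \<xi>)))))) (at u)"
  \<comment> \<open>On this ball \<open>w\<close> stays above \<open>u / 2\<close>, which leaves the
    integrable factor \<open>exp (- (u / 2 * Re (psi \<xi>)))\<close>.\<close>
  proof (rule has_vector_derivative_integral_dominated(1)[where r="u/2" and N=lborel
        and D="\<lambda>w \<xi>. - (kern t \<xi> * (psi \<xi> * exp (- (of_real w * psi \<xi>))))"
        and m="\<lambda>\<xi>. C * (t + 1) * ((2 + \<bar>\<xi>\<bar>) * exp (- (u / 2 * Re (psi \<xi>))))"])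
    show "integrable lborel (\<lambda>\<xi>. kern t \<xi> * exp (- (complex_of_real u * psi \<xi>)))"
    proof (rule Bochner_Integration.integrable_bound)
      show "integrable lborel (\<lambda>\<xi>. (t + 1) * ((2 + \<bar>\<xi>\<bar>) * exp (- (u * Re (psi \<xi>)))))"
        using integrable_psi_decay[OF u] by simp
      show "AE \<xi> in lborel. norm (kern t \<xi> * exp (- (complex_of_real u * psi \<xi>)))
          \<le> norm ((t + 1) * ((2 + \<bar>\<xi>\<bar>) * exp (- (u * Re (psi \<xi>)))))"
        unfolding real_norm_def
        by (intro AE_I2 order_trans[OF Dfourier_integrand_bound[OF t order_refl order_refl] abs_ge_self])
    qed measurable
    show "((\<lambda>w. kern t \<xi> * exp (- (complex_of_real w * psi \<xi>))) has_vector_derivative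
        - (kern t \<xi> * (psi \<xi> * exp (- (complex_of_real w * psi \<xi>))))) (at w)" for w \<xi>
      by (rule has_vector_derivative_real_field[where f="\<lambda>w. kern t \<xi> * exp (- (w * psi \<xi>))"])
        (auto intro!: derivative_eq_intros)
    show "norm (- (kern t \<xi> * (psi \<xi> * exp (- (complex_of_real w * psi \<xi>)))))
        \<le> C * (t + 1) * ((2 + \<bar>\<xi>\<bar>) * exp (- (u / 2 * Re (psi \<xi>))))" if "w \<in> ball u (u / 2)" for w \<xi>
      using C(2)[OF t order_refl, of "u / 2" w \<xi>] that unfolding norm_minus_cancel
      by (auto simp: dist_real_def abs_if split: if_splits)
    show "integrable lborel (\<lambda>\<xi>. C * (t + 1) * ((2 + \<bar>\<xi>\<bar>) * exp (- (u / 2 * Re (psi \<xi>)))))"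
      using integrable_psi_decay[of "u / 2"] u by (intro integrable_mult_right) auto
  qed (use u in auto)
  from has_vector_derivative_mult_right[OF this, of "1 / (2 * pi)"]
  show ?thesis by (simp add: Dfourier_def[abs_def] Qfourier_def)
qed

text \<open>The Fourier form of \<open>hitting_density\<close>. Unlike the derivative by which that
  is defined, it shows joint measurability in \<open>t\<close> and \<open>u\<close> at once.\<close>

definition Q :: "real \<Rightarrow> real \<Rightarrow> real" where
  "Q t u = (if 0 < u \<and> 0 \<le> t then Re (Qfourier t u) else 0)"

lemma Q_measurable [measurable]: "(\<lambda>(t, u). Q t u) \<in> borel_measurable (borel \<Otimes>\<^sub>M borel)"
  unfolding Q_def by measurable

lemma D_deriv:
  assumes u: "0 < u"
  shows "(D t has_real_derivative - Q t u) (at u)"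
proof (cases "0 \<le> t")
  case True
  have "((\<lambda>u. Re (Dfourier t u)) has_real_derivative Re (- Qfourier t u)) (at u)"
    using bounded_linear.has_vector_derivative[OF bounded_linear_Re Dfourier_deriv[OF u]] True
    by (simp add: has_real_derivative_iff_has_vector_derivative)
  then have "((\<lambda>u. Re (Dfourier t u)) has_real_derivative - Q t u) (at u)"
    using u True by (simp add: Q_def)
  then show ?thesis
    by (rule has_field_derivative_transform_within_open[where S="{0<..}"]) (use u True in \<open>auto simp: Dfourier_eq\<close>)
next
  case False
  have "((\<lambda>_. 0) has_real_derivative 0) (at u)" by simp
  then have "(D t has_real_derivative 0) (at u)"
    by (rule has_field_derivative_transform_within_open[where S="{0<..}"]) (use u False in \<open>auto simp: D_negative\<close>)
  then show ?thesis using False by (simp add: Q_def)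
qed

lemma hitting_density_eq: "hitting_density M X = Q"
proof (intro ext)
  fix t u
  show "hitting_density M X t u = Q t u"
    using DERIV_imp_deriv[OF D_deriv[of u t]] by (auto simp: hitting_density_def) (simp add: Q_def)
qed

lemma D_measurable [measurable]: "(\<lambda>(t, u). if 0 < u then D t u else 0) \<in> borel_measurable (borel \<Otimes>\<^sub>M borel)"
proof -
  have "(\<lambda>(t, u). if 0 < u then D t u else 0) = (\<lambda>(t, u). if 0 < u \<and> 0 \<le> t then Re (Dfourier t u) else 0)"
    by (auto simp: fun_eq_iff Dfourier_eq D_negative)
  then show ?thesis by simp
qed

text \<open>The constant is an integral of \<open>exp (- (v * Re (psi \<xi>)))\<close> against a
  weight, hence the restriction to \<open>u \<ge> v\<close>. The bound permits differentiation under
  integrals over \<open>t\<close> at a fixed positive \<open>u\<close>.\<close>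

lemma Q_bound:
  assumes "0 < v"
  obtains C where "0 < C" "\<And>t u. 0 \<le> t \<Longrightarrow> v \<le> u \<Longrightarrow> \<bar>Q t u\<bar> \<le> C * (t + 1)"
proof -
  obtain C where C: "0 < C" "\<And>t r u v \<xi>. - 1 \<le> t \<Longrightarrow> t \<le> r \<Longrightarrow> v \<le> u \<Longrightarrow>
       norm (kern t \<xi> * (psi \<xi> * exp (- (of_real u * psi \<xi>)))) \<le> C * (r + 1) * ((2 + \<bar>\<xi>\<bar>) * exp (- (v * Re (psi \<xi>))))"
    using Qfourier_integrand_bound by blast
  define J where "J = (LINT \<xi>|lborel. (2 + \<bar>\<xi>\<bar>) * exp (- (v * Re (psi \<xi>))))"
  have "0 \<le> J" unfolding J_def by (rule integral_nonneg_AE) simp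
  have "\<bar>Q t u\<bar> \<le> (C * J + 1) * (t + 1)" if "0 \<le> t" "v \<le> u" for t u
  proof -
    let ?g = "\<lambda>\<xi>. kern t \<xi> * (psi \<xi> * exp (- (of_real u * psi \<xi>)))"
    have b: "norm (?g \<xi>) \<le> C * (t + 1) * ((2 + \<bar>\<xi>\<bar>) * exp (- (v * Re (psi \<xi>))))" for \<xi>
      using C(2)[of t t v u \<xi>] that by simp
    have i: "integrable lborel (\<lambda>\<xi>. C * (t + 1) * ((2 + \<bar>\<xi>\<bar>) * exp (- (v * Re (psi \<xi>)))))"
      using integrable_psi_decay[OF assms] by (intro integrable_mult_right) auto
    have "integrable lborel ?g"
      by (rule Bochner_Integration.integrable_bound[OF i])
        (use b in \<open>auto intro!: AE_I2 order_trans[OF b abs_ge_self]\<close>)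
    then have "norm (LINT \<xi>|lborel. ?g \<xi>) \<le> C * (t + 1) * J"
      using order_trans[OF integral_norm_bound[of lborel ?g] integral_mono[OF integrable_norm i]] b
      by (simp add: J_def)
    moreover have "norm (1 / (2 * complex_of_real pi)) \<le> 1"
      using pi_gt3 by (simp add: norm_divide norm_mult)
    ultimately have "norm (Qfourier t u) \<le> 1 * (C * (t + 1) * J)"
      unfolding Qfourier_def norm_mult using \<open>0 \<le> J\<close> C(1) that
      by (intro mult_mono) (auto simp: norm_mult norm_divide)
    moreover have "\<bar>Q t u\<bar> \<le> norm (Qfourier t u)" by (simp add: Q_def abs_Re_le_cmod)
    moreover have "C * (t + 1) * J \<le> (C * J + 1) * (t + 1)" using that by (simp add: algebra_simps)
    ultimately show ?thesis by linarith
  qed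
  moreover have "0 < C * J + 1" using C(1) \<open>0 \<le> J\<close> by (simp add: add_nonneg_pos)
  ultimately show thesis using that by blast
qed

section \<open>Decay of D in u, and its limit at u = 0\<close>

definition rate :: real where "rate = Re (Phi 1)"

lemma rate_pos: "0 < rate" using Re_Phi_one_pos by (simp add: rate_def)

text \<open>A Chernoff bound: the indicator of \<open>X u \<le> t\<close> is at most
  \<open>exp (t - X u)\<close>, whose expectation is given by the Laplace transform at 1.\<close>

lemma D_decay:
  assumes "0 \<le> u"
  shows "D t u \<le> exp t * exp (- (rate * u))"
proof -
  have [measurable]: "X u \<in> borel_measurable M" using X_measurable assms by simp
  have i: "integrable M (\<lambda>\<omega>. exp (- (of_real (X u \<omega>) * 1)) :: complex)"
    by (rule laplace_norm_le_1) (use assms in auto)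
  then have i': "integrable M (\<lambda>\<omega>. exp (- X u \<omega>))"
    using integrable_Re[OF i] by (simp add: Re_exp)
  have "(LINT \<omega>|M. exp (- X u \<omega>)) = Re (LINT \<omega>|M. exp (- (of_real (X u \<omega>) * 1)))"
    using integral_Re[OF i] by (simp add: Re_exp)
  also have "\<dots> \<le> norm (exp (- (of_real u * Phi 1)))"
    using laplace[of 1 u] assms complex_Re_le_cmod[of "exp (- (of_real u * Phi 1))"] by (simp del: norm_exp_eq_Re)
  also have "\<dots> = exp (- (rate * u))" by (simp add: rate_def norm_exp_eq_Re mult.commute)
  finally have e: "(LINT \<omega>|M. exp (- X u \<omega>)) \<le> exp (- (rate * u))" .
  have "D t u = (LINT \<omega>|M. indicator {\<omega> \<in> space M. X u \<omega> \<le> t} \<omega>)" by simp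
  also have "\<dots> \<le> (LINT \<omega>|M. exp t * exp (- X u \<omega>))"
  proof (rule integral_mono)
    show "integrable M (indicator {\<omega> \<in> space M. X u \<omega> \<le> t} :: _ \<Rightarrow> real)"
      by (rule integrable_real_indicator) (auto simp: less_top[symmetric])
    show "integrable M (\<lambda>\<omega>. exp t * exp (- X u \<omega>))" using i' by (rule integrable_mult_right)
  qed (auto simp: indicator_def exp_add[symmetric])
  also have "\<dots> \<le> exp t * exp (- (rate * u))" using e by simp
  finally show ?thesis .
qed

lemma D_antimono: "0 \<le> u \<Longrightarrow> u \<le> v \<Longrightarrow> D t v \<le> D t u"
  using X_measurable[of u] X_mono by (intro finite_measure_mono) (auto intro: order_trans)

lemma Q_nonneg: "0 \<le> Q t u"
proof (cases "0 < u")
  case True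
  have "(D t has_real_derivative - Q t u) (at u)" by (rule D_deriv[OF True])
  then have "- Q t u \<le> 0"
  proof -
    have "((\<lambda>h. (D t (u + h) - D t u) / h) \<longlongrightarrow> - Q t u) (at_right 0)"
      using D_deriv[OF True, of t] unfolding DERIV_def by (rule tendsto_mono[OF at_le, rotated]) simp
    moreover have "\<forall>\<^sub>F h in at_right 0. (D t (u + h) - D t u) / h \<le> 0"
      by (rule eventually_mono[OF eventually_at_right_less])
        (use D_antimono[of u "u + _" t] True in \<open>auto simp: divide_le_0_iff\<close>)
    ultimately show ?thesis by (rule tendsto_upperbound) simp
  qed
  then show ?thesis by simp
qed (simp add: Q_def)

text \<open>Paths start at 0 and are right continuous, so for \<open>t > 0\<close> they stay below
  \<open>t\<close> for a short time. This will show that \<open>Q t\<close> loses no mass at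
  \<open>u = 0\<close>.\<close>

lemma D_tendsto_1:
  assumes t: "0 < t"
  shows "(\<lambda>n. D t (1 / real (Suc n))) \<longlonglongrightarrow> 1"
proof -
  have [measurable]: "X u \<in> borel_measurable M" if "0 \<le> u" for u using X_measurable that by simp
  have m: "{\<omega> \<in> space M. X (1 / real (Suc n)) \<omega> \<le> t} \<in> sets M" for n
    using X_measurable[of "1 / real (Suc n)"] by measurable
  have h: "filterlim (\<lambda>n. 1 / real (Suc n)) (at_right 0) sequentially"
  proof -
    have "(\<lambda>n. 1 / real (Suc n)) \<longlonglongrightarrow> 0" by real_asymp
    then show ?thesis by (simp add: filterlim_at)
  qed
  have "(\<lambda>n. LINT \<omega>|M. indicator {\<omega> \<in> space M. X (1 / real (Suc n)) \<omega> \<le> t} \<omega>) \<longlonglongrightarrow> (LINT \<omega>|M. 1 :: real)"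
  proof (rule integral_dominated_convergence[where w="\<lambda>_. 1"])
    show "AE \<omega> in M. (\<lambda>n. indicator {\<omega> \<in> space M. X (1 / real (Suc n)) \<omega> \<le> t} \<omega>) \<longlonglongrightarrow> (1 :: real)"
      using X_zero AE_space
    proof eventually_elim
      case (elim \<omega>)
      have "((\<lambda>v. X v \<omega>) \<longlongrightarrow> 0) (at_right 0)"
        using X_right_cont[OF elim(2), of 0] elim(1) by (simp add: continuous_within)
      then have "(\<lambda>n. X (1 / real (Suc n)) \<omega>) \<longlonglongrightarrow> 0" using h by (rule filterlim_compose)
      then have "\<forall>\<^sub>F n in sequentially. X (1 / real (Suc n)) \<omega> < t" using t by (rule order_tendstoD)
      then show ?case
        using elim(2) by (intro tendsto_eventually) (auto elim!: eventually_mono)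
    qed
  qed (use m in \<open>auto simp: indicator_def\<close>)
  then show ?thesis using m by (simp add: prob_space)
qed

end

section \<open>Compactly supported functions and integrals over half-lines\<close>

lemma integrable_compact_support:
  fixes f :: "real \<Rightarrow> real"
  assumes [measurable]: "f \<in> borel_measurable borel" and "\<And>t. R < \<bar>t\<bar> \<Longrightarrow> f t = 0" "\<And>t. \<bar>f t\<bar> \<le> K"
  shows "integrable lborel f"
proof (rule Bochner_Integration.integrable_bound)
  show "integrable lborel (\<lambda>t. K * indicator {-R..R} t)"
    by (intro integrable_mult_right integrable_real_indicator) (auto simp: emeasure_lborel_Icc_eq)
  show "AE t in lborel. norm (f t) \<le> norm (K * indicator {-R..R} t)"
  proof (rule AE_I2)
    show "norm (f t) \<le> norm (K * indicator {-R..R} t)" for t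
      using assms(2)[of t] assms(3)[of t] by (cases "R < \<bar>t\<bar>") (auto simp: indicator_def abs_le_iff not_less)
  qed
qed measurable

text \<open>The law of \<open>Z(t)\<close> is known through the events \<open>s \<le> Z(t)\<close>,
  so closed right half-lines serve as the generating system.\<close>

lemma sets_borel_eq_atLeast: "sets borel = sigma_sets UNIV (range (\<lambda>x::real. {x..}))"
proof -
  have "borel = sigma UNIV (range (\<lambda>x::real. {x..}))"
  proof (rule borel_eq_sigmaI1[OF borel_Iio])
    fix A :: "real set" assume "A \<in> range lessThan"
    then obtain x where "A = {..<x}" by auto
    then have A: "A = UNIV - {x..}" by auto
    have "{x..} \<in> sets (sigma UNIV (range (\<lambda>x::real. {x..})))" by auto
    from sets.compl_sets[OF this] show "A \<in> sets (sigma UNIV (range (\<lambda>x::real. {x..})))"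
      by (simp add: A space_measure_of_conv)
  qed auto
  then have "sets borel = sets (sigma UNIV (range (\<lambda>x::real. {x..})))" by simp
  then show ?thesis by simp
qed

lemma test_fun_integrable:
  fixes \<phi> :: "real \<Rightarrow> real"
  assumes "\<phi> \<in> test_fun"
  shows "integrable lborel \<phi>"
proof -
  obtain R C where "\<And>t. R < \<bar>t\<bar> \<Longrightarrow> \<phi> t = 0" "\<And>t. \<bar>\<phi> t\<bar> \<le> C"
    using test_fun_increment_bound[OF assms] by metis
  moreover have "\<phi> \<in> borel_measurable borel"
    using test_fun_continuous[OF assms] by (rule borel_measurable_continuous_onI)
  ultimately show ?thesis by (rule integrable_compact_support[rotated])
qed

text \<open>The antiderivative of \<open>- \<phi>\<close> that vanishes at plus infinity. With
  \<open>x\<close> inside \<open>\<phi>\<close> and a fixed domain it can be differentiated under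
  the integral and commutes visibly with translations.\<close>

definition tail_int :: "(real \<Rightarrow> real) \<Rightarrow> real \<Rightarrow> real" where
  "tail_int \<phi> x = (LINT t|lborel. indicator {0..} t * \<phi> (x + t))"

lemma tail_int_translate: "tail_int (\<lambda>t. \<phi> (t + y)) x = tail_int \<phi> (x + y)"
  by (simp add: tail_int_def ac_simps)

lemma tail_int_alt:
  "tail_int \<phi> x = (LINT t|lborel. indicator {x..} t * \<phi> t)"
  unfolding tail_int_def
  by (subst lborel_integral_real_affine[where c=1 and t=x]) (auto simp: indicator_def intro!: Bochner_Integration.integral_cong)

lemma tail_int_deriv:
  assumes \<phi>: "\<phi> \<in> test_fun"
  shows "(tail_int \<phi> has_real_derivative - \<phi> x) (at x)" and "tail_int (deriv \<phi>) x = - \<phi> x"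
proof -
  obtain R K where RK: "0 < R" "0 < K" "\<And>t. R < \<bar>t\<bar> \<Longrightarrow> \<phi> t = 0" "\<And>t. \<bar>\<phi> t\<bar> \<le> K"
    using test_fun_increment_bound[OF \<phi>] by metis
  obtain R' K' where RK': "0 < R'" "0 < K'" "\<And>t. R' < \<bar>t\<bar> \<Longrightarrow> deriv \<phi> t = 0" "\<And>t. \<bar>deriv \<phi> t\<bar> \<le> K'"
    using test_fun_increment_bound[OF test_fun_deriv[OF \<phi>]] by metis
  have [measurable]: "\<phi> \<in> borel_measurable borel" "deriv \<phi> \<in> borel_measurable borel"
    using test_fun_continuous[OF \<phi>] test_fun_continuous[OF test_fun_deriv[OF \<phi>]]
    by (auto intro: borel_measurable_continuous_onI)
  have 1: "(tail_int \<phi> has_vector_derivative tail_int (deriv \<phi>) x) (at x)"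
    unfolding tail_int_def[abs_def]
  proof (rule has_vector_derivative_integral_dominated(1)[where r=1 and N=lborel
        and D="\<lambda>w t. indicator {0..} t * deriv \<phi> (w + t)"
        and m="\<lambda>t. K' * indicator {- (R' + \<bar>x\<bar> + 1)..R' + \<bar>x\<bar> + 1} t"])
    show "integrable lborel (\<lambda>t. indicator {0..} t * \<phi> (x + t))"
      by (rule integrable_compact_support[where R="R + \<bar>x\<bar>" and K=K])
        (use RK in \<open>auto simp: indicator_def less_imp_le\<close>)
    show "integrable lborel (\<lambda>t. K' * indicator {- (R' + \<bar>x\<bar> + 1)..R' + \<bar>x\<bar> + 1} t)"
      by (intro integrable_mult_right integrable_real_indicator) (auto simp: emeasure_lborel_Icc_eq)
    fix w t :: real assume w: "w \<in> ball x 1"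
    have "((\<lambda>w. indicator {0..} t * \<phi> (w + t)) has_real_derivative indicator {0..} t * deriv \<phi> (w + t)) (at w)"
      using test_fun_has_deriv[OF \<phi>, of "w + t"] by (intro DERIV_cmult) (simp add: DERIV_shift)
    then show "((\<lambda>w. indicator {0..} t * \<phi> (w + t)) has_vector_derivative indicator {0..} t * deriv \<phi> (w + t)) (at w)"
      by (simp add: has_real_derivative_iff_has_vector_derivative)
    have "\<bar>w\<bar> < \<bar>x\<bar> + 1" using w by (auto simp: dist_real_def)
    then have "\<bar>deriv \<phi> (w + t)\<bar> \<le> K' * indicator {- (R' + \<bar>x\<bar> + 1)..R' + \<bar>x\<bar> + 1} t"
      using RK'(3)[of "w + t"] RK'(4)[of "w + t"] by (auto simp: indicator_def not_le)
    then show "norm (indicator {0..} t * deriv \<phi> (w + t)) \<le> K' * indicator {- (R' + \<bar>x\<bar> + 1)..R' + \<bar>x\<bar> + 1} t"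
      using RK'(2) by (auto simp: indicator_def)
  qed auto
  \<comment> \<open>Beyond \<open>B\<close> the shifted derivative vanishes, and so does
    \<open>\<phi>\<close> at \<open>x + B\<close>: the half-line may be replaced by
    \<open>{0..B}\<close>.\<close>
  define B where "B = max R R' + \<bar>x\<bar> + 1"
  have "tail_int (deriv \<phi>) x = (LINT t|lborel. deriv \<phi> (x + t) * indicator {0..B} t)"
    unfolding tail_int_def
    by (rule Bochner_Integration.integral_cong) (use RK'(3)[of "x + _"] in \<open>auto simp: indicator_def B_def\<close>)
  also have "\<dots> = \<phi> (x + B) - \<phi> (x + 0)"
  proof (rule integral_FTC_Icc_real)
    show "((\<lambda>t. \<phi> (x + t)) has_real_derivative deriv \<phi> (x + t)) (at t)" for t
      using test_fun_has_deriv[OF \<phi>, of "t + x"] by (simp add: DERIV_shift add.commute)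
    show "isCont (\<lambda>t. deriv \<phi> (x + t)) t" for t
    proof (rule isCont_o2[where f="\<lambda>t. x + t" and g="deriv \<phi>"])
      show "isCont (deriv \<phi>) (x + t)"
        using test_fun_continuous[OF test_fun_deriv[OF \<phi>]] by (simp add: continuous_on_eq_continuous_at)
    qed simp
  qed (use RK in \<open>auto simp: B_def\<close>)
  also have "\<dots> = - \<phi> x" using RK(3)[of "x + B"] by (simp add: B_def)
  finally show 2: "tail_int (deriv \<phi>) x = - \<phi> x" .
  show "(tail_int \<phi> has_real_derivative - \<phi> x) (at x)"
    using 1 2 by (simp add: has_real_derivative_iff_has_vector_derivative)
qed

lemma hitting_time_nonneg: "0 \<le> hitting_time X t \<omega>"
  unfolding hitting_time_def by (auto intro!: cInf_greatest)

lemma hitting_time_le: "0 \<le> u \<Longrightarrow> t < X u \<omega> \<Longrightarrow> hitting_time X t \<omega> \<le> u"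
  unfolding hitting_time_def by (auto intro!: cInf_lower bdd_belowI[of _ 0])

section \<open>The law of Z(t)\<close>

context stable_subordinator
begin

lemma D_tendsto_0: "(D t \<longlongrightarrow> 0) at_top"
proof (rule Lim_null_comparison)
  show "\<forall>\<^sub>F u in at_top. norm (D t u) \<le> exp t * exp (- (rate * u))"
    using D_decay[of _ t] by (auto intro!: eventually_at_top_linorderI[of 0])
  show "((\<lambda>u. exp t * exp (- (rate * u))) \<longlongrightarrow> 0) at_top"
    using rate_pos by real_asymp
qed

lemma nn_integral_Q_tail:
  assumes "0 < s"
  shows "(\<integral>\<^sup>+ u. ennreal (Q t u) * indicator {s..} u \<partial>lborel) = ennreal (D t s)"
proof -
  have "(\<integral>\<^sup>+ u. ennreal (Q t u) * indicator {s..} u \<partial>lborel) = ennreal (0 - (- D t s))"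
  proof (rule nn_integral_FTC_atLeast)
    show "Q t \<in> borel_measurable borel" by measurable
    show "((\<lambda>u. - D t u) has_real_derivative Q t u) (at u)" if "s \<le> u" for u
      using DERIV_minus[OF D_deriv[of u t]] that assms by simp
    show "((\<lambda>u. - D t u) \<longlongrightarrow> 0) at_top" using tendsto_minus[OF D_tendsto_0] by simp
  qed (rule Q_nonneg)
  then show ?thesis by simp
qed

text \<open>The fundamental theorem is applied away from \<open>u = 0\<close> only, on half-lines
  exhausting \<open>{0<..}\<close>; their masses \<open>D t (1 / real (Suc n))\<close> tend to
  1.\<close>

lemma nn_integral_Q:
  assumes "0 < t"
  shows "(\<integral>\<^sup>+ u. ennreal (Q t u) \<partial>lborel) = 1"
proof -
  let ?N = "density lborel (\<lambda>u. ennreal (Q t u))"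
  define A where "A n = {1 / real (Suc n)..}" for n
  have eA: "emeasure ?N (A n) = ennreal (D t (1 / real (Suc n)))" for n
    unfolding A_def by (subst emeasure_density) (auto simp: nn_integral_Q_tail)
  have "incseq A" unfolding A_def by (auto simp: incseq_def field_simps intro: order_trans)
  then have "(\<lambda>n. emeasure ?N (A n)) \<longlonglongrightarrow> emeasure ?N (\<Union>n. A n)"
    by (intro Lim_emeasure_incseq[OF _ \<open>incseq A\<close>]) (auto simp: A_def)
  moreover have "(\<lambda>n. emeasure ?N (A n)) \<longlonglongrightarrow> ennreal 1"
    unfolding eA by (intro tendsto_ennrealI D_tendsto_1 assms)
  ultimately have "emeasure ?N (\<Union>n. A n) = 1" using LIMSEQ_unique by fastforce
  also have "(\<Union>n. A n) = {0<..}"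
  proof -
    have "\<exists>n. 1 / real (Suc n) \<le> y" if "0 < y" for y :: real
      using that by (metis less_imp_le nat_approx_posE)
    moreover have "0 < y" if "1 / real (Suc n) \<le> y" for y :: real and n
      using that by (rule less_le_trans[rotated]) simp
    ultimately show ?thesis by (auto simp: A_def)
  qed
  also have "emeasure ?N {0<..} = (\<integral>\<^sup>+ u. ennreal (Q t u) * indicator {0<..} u \<partial>lborel)"
    by (subst emeasure_density) auto
  also have "\<dots> = (\<integral>\<^sup>+ u. ennreal (Q t u) \<partial>lborel)"
    by (intro nn_integral_cong) (auto simp: indicator_def Q_def)
  finally show ?thesis .
qed

lemma integrable_Q: "0 < t \<Longrightarrow> integrable lborel (Q t)"
  using nn_integral_Q[of t] Q_nonneg by (intro integrableI_nonneg) auto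

lemma integral_Q: "0 < t \<Longrightarrow> (LINT u|lborel. Q t u) = 1"
  using nn_integral_Q[of t] Q_nonneg by (simp add: integral_eq_nn_integral)

lemma hitting_time_ge:
  assumes "\<omega> \<in> space M" "\<exists>u\<ge>0. t < X u \<omega>" "0 \<le> s" "X s \<omega> \<le> t"
  shows "s \<le> hitting_time X t \<omega>"
proof -
  have "s \<le> u" if "0 \<le> u" "t < X u \<omega>" for u
    using X_mono[OF assms(1) that(1), of s] that assms by (meson le_cases leD order_trans)
  then show ?thesis
    using assms(2) unfolding hitting_time_def by (auto intro!: cInf_greatest)
qed

text \<open>A path bounded by \<open>t\<close> lies in every event
  \<open>X (real n) \<le> t\<close>, and these have probabilities tending to 0. Thus
  \<open>hitting_time\<close> takes its default value on a null event only.\<close>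

lemma X_unbounded: "AE \<omega> in M. \<exists>u\<ge>0. t < X u \<omega>"
proof -
  let ?N = "{\<omega> \<in> space M. \<forall>n::nat. X (real n) \<omega> \<le> t}"
  have m: "?N \<in> sets M" using X_measurable by measurable
  have "prob ?N \<le> D t (real n)" for n :: nat
    using X_measurable[of "real n"] by (intro finite_measure_mono) auto
  moreover have "(\<lambda>n. D t (real n)) \<longlonglongrightarrow> 0"
    by (rule filterlim_compose[OF D_tendsto_0 filterlim_real_sequentially])
  ultimately have "prob ?N \<le> 0"
    by (intro tendsto_lowerbound[where f="\<lambda>n. D t (real n)" and F=sequentially]) auto
  then have "AE \<omega> in M. \<not> (\<forall>n::nat. X (real n) \<omega> \<le> t)"
    using m prob_eq_0[OF m] by (simp add: measure_le_0_iff)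
  then show ?thesis
  proof eventually_elim
    case (elim \<omega>)
    then obtain n :: nat where "t < X (real n) \<omega>" by (auto simp: not_le)
    then show ?case by (intro exI[of _ "real n"]) simp
  qed
qed

text \<open>Almost surely \<open>X s \<le> t\<close> implies \<open>s \<le> Z(t)\<close>, which in
  turn implies \<open>X r \<le> t\<close> for all \<open>r < s\<close>. The gap between
  \<open>r\<close> and \<open>s\<close> closes because \<open>D t\<close> is differentiable, hence
  continuous, at \<open>s\<close>.\<close>

lemma prob_hitting_time_ge:
  assumes [measurable]: "hitting_time X t \<in> borel_measurable M" and s: "0 < s"
  shows "prob {\<omega> \<in> space M. s \<le> hitting_time X t \<omega>} = D t s"
proof (rule antisym)
  have [measurable]: "X u \<in> borel_measurable M" if "0 \<le> u" for u using X_measurable that by simp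
  have Dm: "{\<omega> \<in> space M. X u \<omega> \<le> t} \<in> sets M" if "0 \<le> u" for u
    using X_measurable[OF that] by measurable
  show "D t s \<le> prob {\<omega> \<in> space M. s \<le> hitting_time X t \<omega>}"
  proof (rule finite_measure_mono_AE)
    show "AE \<omega> in M. \<omega> \<in> {\<omega> \<in> space M. X s \<omega> \<le> t} \<longrightarrow> \<omega> \<in> {\<omega> \<in> space M. s \<le> hitting_time X t \<omega>}"
      using X_unbounded[of t] AE_space
    proof eventually_elim
      case (elim \<omega>)
      then show ?case using hitting_time_ge[of \<omega> t s] s by simp
    qed
  qed measurable
  have le: "prob {\<omega> \<in> space M. s \<le> hitting_time X t \<omega>} \<le> D t r" if "0 < r" "r < s" for r
    using that Dm[of r] hitting_time_le[of r t X]
    by (intro finite_measure_mono) (auto simp: not_le[symmetric] dest: order_trans)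
  have "isCont (D t) s" using D_deriv[OF s] by (rule DERIV_isCont)
  then have "(D t \<longlongrightarrow> D t s) (at_left s)"
    by (meson continuous_within continuous_at_imp_continuous_at_within)
  moreover have "\<forall>\<^sub>F r in at_left s. prob {\<omega> \<in> space M. s \<le> hitting_time X t \<omega>} \<le> D t r"
    using eventually_at_left_field[of _ s] le s by (auto intro!: exI[of _ 0])
  ultimately show "prob {\<omega> \<in> space M. s \<le> hitting_time X t \<omega>} \<le> D t s"
    by (rule tendsto_lowerbound) simp
qed

lemma hitting_time_distributed:
  assumes Z [measurable]: "hitting_time X t \<in> borel_measurable M" and t: "0 < t"
  shows "distributed M lborel (hitting_time X t) (\<lambda>u. ennreal (Q t u))"
proof -
  let ?Z = "hitting_time X t"
  have "distr M lborel ?Z = density lborel (\<lambda>u. ennreal (Q t u))"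
  proof (rule measure_eqI_generator_eq[where \<Omega>=UNIV and E="range (\<lambda>x::real. {x..})" and A="\<lambda>n. {- real n..}"])
    show "Int_stable (range (\<lambda>x::real. {x..}))"
    proof (rule Int_stableI)
      fix A B assume "A \<in> range (\<lambda>x::real. {x..})" "B \<in> range (\<lambda>x::real. {x..})"
      then obtain x y where "A = {x..}" "B = {y..}" by auto
      then have "A \<inter> B = {max x y..}" by auto
      then show "A \<inter> B \<in> range (\<lambda>x::real. {x..})" by simp
    qed
    fix B assume "B \<in> range (\<lambda>x::real. {x..})"
    then obtain s where [simp]: "B = {s..}" by auto
    have d: "emeasure (distr M lborel ?Z) B = emeasure M {\<omega> \<in> space M. s \<le> ?Z \<omega>}"
      by (subst emeasure_distr) (auto intro!: arg_cong[where f="emeasure M"])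
    have q: "emeasure (density lborel (\<lambda>u. ennreal (Q t u))) B = (\<integral>\<^sup>+ u. ennreal (Q t u) * indicator {s..} u \<partial>lborel)"
      by (subst emeasure_density) auto
    show "emeasure (distr M lborel ?Z) B = emeasure (density lborel (\<lambda>u. ennreal (Q t u))) B"
    proof (cases "0 < s")
      case True
      then show ?thesis
        unfolding d q by (simp add: nn_integral_Q_tail emeasure_eq_measure prob_hitting_time_ge)
    next
      case False
      then have "{\<omega> \<in> space M. s \<le> ?Z \<omega>} = space M"
        using hitting_time_nonneg[of X t] False by (auto intro: order_trans[of s 0])
      moreover have "(\<integral>\<^sup>+ u. ennreal (Q t u) * indicator {s..} u \<partial>lborel) = (\<integral>\<^sup>+ u. ennreal (Q t u) \<partial>lborel)"
        using False by (intro nn_integral_cong) (auto simp: indicator_def Q_def)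
      ultimately show ?thesis unfolding d q using nn_integral_Q[OF t] by (simp add: emeasure_space_1)
    qed
  next
    show "sets (distr M lborel ?Z) = sigma_sets UNIV (range (\<lambda>x::real. {x..}))"
      "sets (density lborel (\<lambda>u. ennreal (Q t u))) = sigma_sets UNIV (range (\<lambda>x::real. {x..}))"
      using sets_borel_eq_atLeast by simp_all
    show "(\<Union>n. {- real n..}) = UNIV"
    proof -
      have "\<exists>n. - real n \<le> x" for x
        using reals_Archimedean2[of "- x"] by (metis less_imp_le minus_le_iff)
      then show ?thesis by auto
    qed
    show "emeasure (distr M lborel ?Z) {- real n..} \<noteq> \<infinity>" for n
      by (subst emeasure_distr) auto
  qed auto
  then show ?thesis by (simp add: distributed_def)
qed

section \<open>The key identity between Q and D\<close>

lemma regular_D: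
  assumes s: "0 < s" and [measurable]: "\<eta> \<in> borel_measurable borel"
    and supp: "\<And>t. R < \<bar>t\<bar> \<Longrightarrow> \<eta> t = 0" "\<And>t. \<bar>\<eta> t\<bar> \<le> K"
  shows "regular (\<lambda>t. D t s) \<eta> = (LINT \<omega>|M. tail_int \<eta> (X s \<omega>))"
proof -
  have [measurable]: "X s \<in> borel_measurable M" using X_measurable s by simp
  interpret P: pair_sigma_finite lborel M ..
  have int: "integrable lborel \<eta>" by (rule integrable_compact_support) (use supp in auto)
  have Dm [measurable]: "(\<lambda>t. D t s) \<in> borel_measurable borel"
    using measurable_compose[OF _ D_measurable, of "\<lambda>t. (t, s)" borel] s by simp
  have inner: "(LINT \<omega>|M. indicator {X s \<omega>..} t * c) = D t s * c" for t c :: real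
  proof -
    have "(LINT \<omega>|M. indicator {X s \<omega>..} t * c) = (LINT \<omega>|M. indicator {\<omega> \<in> space M. X s \<omega> \<le> t} \<omega> * c)"
      by (intro Bochner_Integration.integral_cong) (auto simp: indicator_def)
    then show ?thesis by simp
  qed
  have "integrable (lborel \<Otimes>\<^sub>M M) (\<lambda>(t, \<omega>). indicator {X s \<omega>..} t * \<eta> t)"
  proof (rule P.Fubini_integrable)
    \<comment> \<open>The indicator of a random half-line, rewritten as the truth value of an
      inequality between measurable functions.\<close>
    have m: "(\<lambda>(t, \<omega>). of_bool (X s \<omega> \<le> t) * \<eta> t) \<in> borel_measurable (lborel \<Otimes>\<^sub>M M)" by measurable
    then show "(\<lambda>(t, \<omega>). indicator {X s \<omega>..} t * \<eta> t) \<in> borel_measurable (lborel \<Otimes>\<^sub>M M)"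
      by (simp add: indicator_def)
    have "integrable lborel (\<lambda>t. D t s * \<bar>\<eta> t\<bar>)"
      by (rule Bochner_Integration.integrable_bound[OF int]) (auto simp: abs_mult mult_left_le_one_le)
    then show "integrable lborel (\<lambda>t. LINT \<omega>|M. norm (case (t, \<omega>) of (t, \<omega>) \<Rightarrow> indicator {X s \<omega>..} t * \<eta> t))"
      by (simp add: abs_mult inner inner[of _ 1, simplified])
    show "AE t in lborel. integrable M (\<lambda>\<omega>. case (t, \<omega>) of (t, \<omega>) \<Rightarrow> indicator {X s \<omega>..} t * \<eta> t)"
    proof (rule AE_I2)
      fix t
      have "(\<lambda>\<omega>. of_bool (X s \<omega> \<le> t) * \<eta> t) \<in> borel_measurable M" by measurable
      then have "integrable M (\<lambda>\<omega>. indicator {X s \<omega>..} t * \<eta> t)"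
        by (intro integrable_const_bound[where B="\<bar>\<eta> t\<bar>"]) (auto simp: indicator_def)
      then show "integrable M (\<lambda>\<omega>. case (t, \<omega>) of (t, \<omega>) \<Rightarrow> indicator {X s \<omega>..} t * \<eta> t)" by simp
    qed
  qed
  from P.Fubini_integral[OF this] show ?thesis
    by (simp add: regular_def tail_int_alt inner inner[of _ 1, simplified])
qed

text \<open>By \<open>regular_D\<close>, testing \<open>D\<close> at time \<open>w\<close> against
  \<open>\<phi>\<close> gives the expectation of \<open>g (X w)\<close>. Differentiating
  \<open>D\<close> under the integral in \<open>t\<close> yields the left-hand side
  (\<open>d1\<close>); the Markov property and the generator yield the expectation of
  \<open>G (X s)\<close>, where \<open>G\<close> is the generator applied to \<open>g\<close>
  (\<open>d2\<close>). Fubini's theorem turns the latter into \<open>A_star\<close>.\<close>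

lemma integral_test_Q:
  assumes \<phi>: "\<phi> \<in> test_fun" and s: "0 < s"
  shows "(LINT t|lborel. \<phi> t * Q t s) = - A_star \<nu> a (regular (\<lambda>t. D t s)) \<phi>"
proof -
  obtain R K where RK: "0 < R" "0 < K" "\<And>t. R < \<bar>t\<bar> \<Longrightarrow> \<phi> t = 0" "\<And>t. \<bar>\<phi> t\<bar> \<le> K"
    using test_fun_increment_bound[OF \<phi>] by metis
  obtain R' K' where RK': "0 < R'" "0 < K'" "\<And>t. R' < \<bar>t\<bar> \<Longrightarrow> deriv \<phi> t = 0" "\<And>t. \<bar>deriv \<phi> t\<bar> \<le> K'"
    using test_fun_increment_bound[OF test_fun_deriv[OF \<phi>]] by metis
  have [measurable]: "\<phi> \<in> borel_measurable borel" "deriv \<phi> \<in> borel_measurable borel"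
    using test_fun_continuous[OF \<phi>] test_fun_continuous[OF test_fun_deriv[OF \<phi>]]
    by (auto intro: borel_measurable_continuous_onI)
  have Xm [measurable]: "X u \<in> borel_measurable M" if "0 \<le> u" for u using X_measurable that by simp
  have [measurable]: "X s \<in> borel_measurable M" using s by simp
  have Dm: "(\<lambda>t. D t w) \<in> borel_measurable borel" if "0 < w" for w
    using measurable_compose[OF _ D_measurable, of "\<lambda>t. (t, w)" borel] that by simp
  define g where "g = tail_int \<phi>"
  have g': "(g has_real_derivative - \<phi> x) (at x)" for x unfolding g_def by (rule tail_int_deriv[OF \<phi>])
  have [measurable]: "g \<in> borel_measurable borel"
    by (intro borel_measurable_continuous_onI continuous_at_imp_continuous_on ballI DERIV_isCont[OF g'])
  have gb: "\<bar>g x\<bar> \<le> 2 * R * K" for x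
  proof -
    have "\<bar>g x\<bar> \<le> (LINT t|lborel. \<bar>indicator {x..} t * \<phi> t\<bar>)"
      unfolding g_def tail_int_alt using integral_norm_bound[of lborel "\<lambda>t. indicator {x..} t * \<phi> t"] by simp
    also have "\<dots> \<le> (LINT t|lborel. K * indicator {-R..R} t)"
    proof (rule integral_mono)
      show "integrable lborel (\<lambda>t. K * indicator {-R..R} t)"
        by (intro integrable_mult_right integrable_real_indicator) (auto simp: emeasure_lborel_Icc_eq)
      show "integrable lborel (\<lambda>t. \<bar>indicator {x..} t * \<phi> t\<bar>)"
        by (rule integrable_compact_support[where R=R and K=K]) (use RK in \<open>auto simp: indicator_def less_imp_le\<close>)
      show "\<bar>indicator {x..} t * \<phi> t\<bar> \<le> K * indicator {-R..R} t" for t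
        using RK(3)[of t] RK(4)[of t] RK(2) by (cases "R < \<bar>t\<bar>") (auto simp: indicator_def)
    qed
    also have "\<dots> = 2 * R * K" using RK(1) by simp
    finally show ?thesis .
  qed
  \<comment> \<open>Large jumps are covered by twice the supremum bound on \<open>g\<close>, small
    ones by its Lipschitz constant \<open>K\<close>.\<close>
  define B where "B = 4 * R * K + K"
  have g_incr: "\<bar>g (x + y) - g x\<bar> \<le> B * min 1 y" if "0 < y" for x y
  proof -
    have 1: "\<bar>g (x + y) - g x\<bar> \<le> K * y"
      using field_differentiable_bound[of UNIV g "\<lambda>x. - \<phi> x" K "x + y" x] g' RK that by auto
    have 2: "\<bar>g (x + y) - g x\<bar> \<le> 4 * R * K" using gb[of x] gb[of "x + y"] by linarith
    show ?thesis
    proof (cases "1 \<le> y")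
      case True then show ?thesis using 2 RK by (simp add: B_def)
    next
      case False
      have "K * y \<le> B * y" using that RK by (intro mult_right_mono) (auto simp: B_def)
      then show ?thesis using 1 False by simp
    qed
  qed
  define G where "G x = (LINT y|\<nu>. g (x + y) - g x) + a * (- \<phi> x)" for x
  have Gm [measurable]: "G \<in> borel_measurable borel" unfolding G_def by measurable
  have E: "regular (\<lambda>t. D t w) \<phi> = (LINT \<omega>|M. g (X w \<omega>))" if "0 < w" for w
    unfolding g_def by (rule regular_D[OF that _ RK(3,4)]) auto
  have d1: "((\<lambda>w. regular (\<lambda>t. D t w) \<phi>) has_vector_derivative (LINT t|lborel. - Q t s * \<phi> t)) (at s)"
    unfolding regular_def
  proof -
    \<comment> \<open>\<open>w\<close> ranges over the ball of radius \<open>s / 2\<close> around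
      \<open>s\<close>, so a bound on \<open>Q\<close> for \<open>u \<ge> s / 2\<close> is
      enough.\<close>
    obtain C where C: "0 < C" "\<And>t u. 0 \<le> t \<Longrightarrow> s / 2 \<le> u \<Longrightarrow> \<bar>Q t u\<bar> \<le> C * (t + 1)"
      using Q_bound[of "s / 2"] s by auto
    show "((\<lambda>w. LINT t|lborel. D t w * \<phi> t) has_vector_derivative (LINT t|lborel. - Q t s * \<phi> t)) (at s)"
    proof (rule has_vector_derivative_integral_dominated(1)[where r="s/2" and N=lborel
          and D="\<lambda>w t. - Q t w * \<phi> t" and m="\<lambda>t. C * (\<bar>t\<bar> + 1) * \<bar>\<phi> t\<bar>"])
      show "(\<lambda>t. D t w * \<phi> t) \<in> borel_measurable lborel" if "w \<in> ball s (s / 2)" for w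
        using Dm[of w] that by (auto simp: dist_real_def abs_if split: if_splits)
      show "integrable lborel (\<lambda>t. D t s * \<phi> t)"
        by (rule integrable_compact_support[where R=R and K=K])
          (use RK Dm[OF s] in \<open>auto simp: abs_mult intro!: mult_le_one mult_left_le_one_le order_trans[OF mult_left_le_one_le]\<close>)
      show "((\<lambda>w. D t w * \<phi> t) has_vector_derivative - Q t w * \<phi> t) (at w)" if "w \<in> ball s (s / 2)" for w t
        using DERIV_cmult_right[OF D_deriv[of w t], of "\<phi> t"] that
        by (auto simp: has_real_derivative_iff_has_vector_derivative dist_real_def abs_if split: if_splits)
      show "norm (- Q t w * \<phi> t) \<le> C * (\<bar>t\<bar> + 1) * \<bar>\<phi> t\<bar>" if "w \<in> ball s (s / 2)" for w t
      proof -
        have "\<bar>Q t w\<bar> \<le> C * (\<bar>t\<bar> + 1)"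
        proof (cases "0 \<le> t")
          case True
          then show ?thesis using C(2)[of t w] that by (auto simp: dist_real_def abs_if split: if_splits)
        qed (use C(1) in \<open>simp add: Q_def\<close>)
        then show ?thesis by (simp add: abs_mult mult_right_mono)
      qed
      show "integrable lborel (\<lambda>t. C * (\<bar>t\<bar> + 1) * \<bar>\<phi> t\<bar>)"
      proof (rule integrable_compact_support[where R=R and K="C * (R + 1) * K"])
        show "\<bar>C * (\<bar>t\<bar> + 1) * \<bar>\<phi> t\<bar>\<bar> \<le> C * (R + 1) * K" for t
          using RK(3)[of t] RK(4)[of t] RK(1,2) C(1)
          by (cases "R < \<bar>t\<bar>") (auto simp: abs_mult intro!: mult_mono)
      qed (use RK in auto)
    qed (use s in auto)
  qed
  \<comment> \<open>The generator is a limit from the right, so only the right difference quotients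
    are compared.\<close>
  then have d1': "((\<lambda>h. (regular (\<lambda>t. D t (s + h)) \<phi> - regular (\<lambda>t. D t s) \<phi>) / h) \<longlongrightarrow> (LINT t|lborel. - Q t s * \<phi> t)) (at_right 0)"
    unfolding has_real_derivative_iff_has_vector_derivative[symmetric] DERIV_def
    by (rule tendsto_mono[OF at_le, rotated]) simp
  have g0: "(g \<longlongrightarrow> 0) at_top" "((\<lambda>x. - \<phi> x) \<longlongrightarrow> 0) at_top"
  proof -
    have "g x = 0" if "R < x" for x
      unfolding g_def tail_int_alt using that RK(1,3)
      by (intro integral_eq_zero_AE AE_I2) (auto simp: indicator_def)
    then have "\<forall>\<^sub>F x in at_top. g x = 0" by (auto intro: eventually_mono[OF eventually_gt_at_top[of R]])
    then show "(g \<longlongrightarrow> 0) at_top" by (rule tendsto_eventually)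
    have "\<forall>\<^sub>F x in at_top. - \<phi> x = 0"
      by (rule eventually_mono[OF eventually_gt_at_top[of R]]) (use RK in auto)
    then show "((\<lambda>x. - \<phi> x) \<longlongrightarrow> 0) at_top" by (rule tendsto_eventually)
  qed
  have U: "uniform_limit {0..} (\<lambda>h x. ((LINT \<omega>|M. g (x + X h \<omega>)) - g x) / h) G (at_right 0)"
    unfolding G_def by (rule generator_half_line[OF g' _ g0])
      (intro continuous_intros continuous_on_subset[OF test_fun_continuous[OF \<phi>]], simp)
  have Gb: "\<bar>G x\<bar> \<le> B * (LINT y|\<nu>. min 1 y) + a * K" for x
  proof -
    have i: "integrable \<nu> (\<lambda>y. g (x + y) - g x)"
      by (rule nu_integrable[where C=B]) (use g_incr in auto)
    have "\<bar>LINT y|\<nu>. g (x + y) - g x\<bar> \<le> (LINT y|\<nu>. \<bar>g (x + y) - g x\<bar>)"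
      using integral_norm_bound[of \<nu> "\<lambda>y. g (x + y) - g x"] by simp
    also have "\<dots> \<le> (LINT y|\<nu>. B * min 1 y)"
    proof (rule integral_mono_AE)
      show "AE y in \<nu>. \<bar>g (x + y) - g x\<bar> \<le> B * min 1 y"
        using nu_pos by eventually_elim (rule g_incr)
    qed (use i nu_min_integrable in auto)
    also have "\<dots> = B * (LINT y|\<nu>. min 1 y)" by simp
    finally have "\<bar>LINT y|\<nu>. g (x + y) - g x\<bar> \<le> B * (LINT y|\<nu>. min 1 y)" .
    moreover have "\<bar>a * (- \<phi> x)\<bar> \<le> a * K" using RK(4)[of x] a by (simp add: abs_mult mult_left_mono)
    ultimately show ?thesis unfolding G_def by linarith
  qed
  have iG: "integrable M (\<lambda>\<omega>. G (X s \<omega>))"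
    by (rule integrable_const_bound) (use Gb in auto)
  have ig: "integrable M (\<lambda>\<omega>. g (X s \<omega>))"
    by (rule integrable_const_bound) (use gb in auto)
  \<comment> \<open>By the Markov property the quotient at \<open>s\<close> is the expectation, at
    the point \<open>X s\<close>, of the generator quotient of \<open>g\<close>. The generator limit
    is uniform over nonnegative points, so no domination is required.\<close>
  have d2: "((\<lambda>h. (regular (\<lambda>t. D t (s + h)) \<phi> - regular (\<lambda>t. D t s) \<phi>) / h) \<longlongrightarrow> (LINT \<omega>|M. G (X s \<omega>))) (at_right 0)"
  proof (rule tendstoI)
    fix e :: real assume e: "0 < e"
    have "\<forall>\<^sub>F h in at_right 0. \<forall>x\<in>{0..}. dist (((LINT \<omega>|M. g (x + X h \<omega>)) - g x) / h) (G x) < e / 2"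
      using U e by (auto dest!: uniform_limitD[where e="e/2"])
    then show "\<forall>\<^sub>F h in at_right 0. dist ((regular (\<lambda>t. D t (s + h)) \<phi> - regular (\<lambda>t. D t s) \<phi>) / h) (LINT \<omega>|M. G (X s \<omega>)) < e"
      using eventually_at_right_less[of 0]
    proof eventually_elim
      case (elim h)
      define P where "P x = (LINT \<omega>|M. g (x + X h \<omega>))" for x
      have [measurable]: "X h \<in> borel_measurable M" using elim by simp
      have [measurable]: "P \<in> borel_measurable borel" unfolding P_def by measurable
      have "\<bar>P x\<bar> \<le> 2 * R * K" for x
      proof -
        have "\<bar>P x\<bar> \<le> (LINT \<omega>|M. \<bar>g (x + X h \<omega>)\<bar>)"
          unfolding P_def using integral_norm_bound[of M "\<lambda>\<omega>. g (x + X h \<omega>)"] by simp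
        also have "\<dots> \<le> (LINT \<omega>|M. 2 * R * K)"
          using gb RK by (intro integral_mono integrable_const_bound[where B="2 * R * K"]) auto
        finally show ?thesis by (simp add: prob_space)
      qed
      then have iP: "integrable M (\<lambda>\<omega>. P (X s \<omega>))" by (intro integrable_const_bound) auto
      have "regular (\<lambda>t. D t (s + h)) \<phi> = (LINT \<omega>|M. P (X s \<omega>))"
        unfolding P_def using E[of "s + h"] expectation_X_add[of s h g "2 * R * K"] s elim gb by simp
      then have "(regular (\<lambda>t. D t (s + h)) \<phi> - regular (\<lambda>t. D t s) \<phi>) / h - (LINT \<omega>|M. G (X s \<omega>))
          = (LINT \<omega>|M. (P (X s \<omega>) - g (X s \<omega>)) / h - G (X s \<omega>))"
        using E[OF s] iP ig iG by simp
      also have "\<bar>\<dots>\<bar> \<le> (LINT \<omega>|M. \<bar>(P (X s \<omega>) - g (X s \<omega>)) / h - G (X s \<omega>)\<bar>)"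
        using integral_norm_bound[of M "\<lambda>\<omega>. (P (X s \<omega>) - g (X s \<omega>)) / h - G (X s \<omega>)"] by simp
      also have "\<dots> \<le> (LINT \<omega>|M. e / 2)"
      proof (rule integral_mono_AE)
        show "AE \<omega> in M. \<bar>(P (X s \<omega>) - g (X s \<omega>)) / h - G (X s \<omega>)\<bar> \<le> e / 2"
          using X_nonneg[of s] s elim by (auto elim!: eventually_mono simp: dist_real_def P_def intro: less_imp_le)
      qed (use iP ig iG in auto)
      also have "\<dots> < e" using e by (simp add: prob_space)
      finally show ?case by (simp add: dist_real_def)
    qed
  qed
  have "(LINT t|lborel. - Q t s * \<phi> t) = (LINT \<omega>|M. G (X s \<omega>))"
    by (rule tendsto_unique[OF _ d1' d2]) simp
  \<comment> \<open>The expectation is exchanged with \<open>\<nu>\<close>. Shifting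
    \<open>g\<close> by \<open>y\<close> shifts \<open>\<phi>\<close>, which gives the jump part;
    for the drift, \<open>- \<phi>\<close> is the tail integral of
    \<open>deriv \<phi>\<close>.\<close>
  moreover have "(LINT \<omega>|M. G (X s \<omega>)) = A_star \<nu> a (regular (\<lambda>t. D t s)) \<phi>"
  proof -
    interpret P: pair_sigma_finite M \<nu> ..
    have iF: "integrable (M \<Otimes>\<^sub>M \<nu>) (\<lambda>(\<omega>, y). g (X s \<omega> + y) - g (X s \<omega>))"
    proof (rule P.Fubini_integrable)
      show m: "(\<lambda>(\<omega>, y). g (X s \<omega> + y) - g (X s \<omega>)) \<in> borel_measurable (M \<Otimes>\<^sub>M \<nu>)" by measurable
      have ii: "integrable \<nu> (\<lambda>y. g (x + y) - g x)" for x
        by (rule nu_integrable[where C=B]) (use g_incr in auto)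
      then show "AE \<omega> in M. integrable \<nu> (\<lambda>y. case (\<omega>, y) of (\<omega>, y) \<Rightarrow> g (X s \<omega> + y) - g (X s \<omega>))" by simp
      show "integrable M (\<lambda>\<omega>. LINT y|\<nu>. norm (case (\<omega>, y) of (\<omega>, y) \<Rightarrow> g (X s \<omega> + y) - g (X s \<omega>)))"
      proof (rule integrable_const_bound[where B="B * (LINT y|\<nu>. min 1 y)"])
        show "AE \<omega> in M. norm (LINT y|\<nu>. norm (case (\<omega>, y) of (\<omega>, y) \<Rightarrow> g (X s \<omega> + y) - g (X s \<omega>))) \<le> B * (LINT y|\<nu>. min 1 y)"
        proof (rule AE_I2)
          fix \<omega>
          have "(LINT y|\<nu>. \<bar>g (X s \<omega> + y) - g (X s \<omega>)\<bar>) \<le> (LINT y|\<nu>. B * min 1 y)"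
          proof (rule integral_mono_AE)
            show "AE y in \<nu>. \<bar>g (X s \<omega> + y) - g (X s \<omega>)\<bar> \<le> B * min 1 y"
              using nu_pos by eventually_elim (rule g_incr)
          qed (use ii nu_min_integrable in auto)
          then show "norm (LINT y|\<nu>. norm (case (\<omega>, y) of (\<omega>, y) \<Rightarrow> g (X s \<omega> + y) - g (X s \<omega>))) \<le> B * (LINT y|\<nu>. min 1 y)"
            by (simp add: integral_nonneg_AE)
        qed
      qed measurable
    qed
    have 1: "(LINT \<omega>|M. LINT y|\<nu>. g (X s \<omega> + y) - g (X s \<omega>))
        = (LINT y|\<nu>. regular (\<lambda>t. D t s) (\<lambda>t. \<phi> (t + y)) - regular (\<lambda>t. D t s) \<phi>)"
    proof -
      have "(LINT \<omega>|M. g (X s \<omega> + y) - g (X s \<omega>)) = regular (\<lambda>t. D t s) (\<lambda>t. \<phi> (t + y)) - regular (\<lambda>t. D t s) \<phi>" for y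
      proof -
        have "regular (\<lambda>t. D t s) (\<lambda>t. \<phi> (t + y)) = (LINT \<omega>|M. g (X s \<omega> + y))"
          unfolding g_def tail_int_translate[symmetric]
          by (rule regular_D[OF s, where R="R + \<bar>y\<bar>" and K=K]) (use RK in auto)
        moreover have "integrable M (\<lambda>\<omega>. g (X s \<omega> + y))"
          by (rule integrable_const_bound) (use gb in auto)
        ultimately show ?thesis using E[OF s] ig by simp
      qed
      then show ?thesis using P.Fubini_integral[OF iF] by simp
    qed
    have 2: "(LINT \<omega>|M. - \<phi> (X s \<omega>)) = regular (\<lambda>t. D t s) (deriv \<phi>)"
      using regular_D[OF s _ RK'(3,4)] by (simp add: tail_int_deriv(2)[OF \<phi>])
    have i1: "integrable M (\<lambda>\<omega>. LINT y|\<nu>. g (X s \<omega> + y) - g (X s \<omega>))"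
      using P.integrable_fst'[OF iF] by simp
    have i2: "integrable M (\<lambda>\<omega>. - \<phi> (X s \<omega>))"
      by (rule integrable_const_bound[where B=K]) (use RK in auto)
    have "(LINT \<omega>|M. G (X s \<omega>)) = (LINT \<omega>|M. LINT y|\<nu>. g (X s \<omega> + y) - g (X s \<omega>)) + a * (LINT \<omega>|M. - \<phi> (X s \<omega>))"
      unfolding G_def using i1 i2 by (subst Bochner_Integration.integral_add) auto
    then show ?thesis unfolding A_star_def gderiv_def 1 2 by simp
  qed
  moreover have "(LINT t|lborel. - Q t s * \<phi> t) = - (LINT t|lborel. \<phi> t * Q t s)"
    by (simp add: mult.commute)
  ultimately show ?thesis by simp
qed

end

section \<open>Feller semigroups\<close>

lemma C_inf_measurable: "f \<in> C_inf \<Longrightarrow> f \<in> borel_measurable borel"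
  by (auto simp: C_inf_def intro: borel_measurable_continuous_onI)

lemma C_inf_bounded:
  assumes "f \<in> C_inf"
  obtains B where "0 < B" "\<And>x. \<bar>f x\<bar> \<le> B"
proof -
  have c: "continuous_on UNIV f" and l: "(f \<longlongrightarrow> 0) at_infinity" using assms by (auto simp: C_inf_def)
  have "\<forall>\<^sub>F x in at_infinity. \<bar>f x\<bar> < 1"
    using tendstoD[OF l, of 1] by simp
  then obtain b where b: "\<And>x. b \<le> norm x \<Longrightarrow> \<bar>f x\<bar> < 1" by (auto simp: eventually_at_infinity)
  have "compact (f ` cball 0 b)" by (intro compact_continuous_image continuous_on_subset[OF c]) auto
  then obtain B where B: "0 < B" "\<forall>y\<in>f ` cball 0 b. norm y \<le> B"
    using compact_imp_bounded bounded_pos by blast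
  have "\<bar>f x\<bar> \<le> B + 1" for x
  proof (cases "b \<le> norm x")
    case False
    then have "f x \<in> f ` cball 0 b" by simp
    then have "norm (f x) \<le> B" using B(2) by blast
    then show ?thesis by simp
  qed (use b[of x] B in simp)
  then show thesis using B(1) by (intro that[of "B + 1"]) auto
qed

lemma C_inf_diff: "f \<in> C_inf \<Longrightarrow> g \<in> C_inf \<Longrightarrow> (\<lambda>x. f x - g x) \<in> C_inf"
  by (auto simp: C_inf_def intro!: continuous_intros tendsto_eq_intros)

lemma C_inf_cmult: "f \<in> C_inf \<Longrightarrow> (\<lambda>x. c * f x) \<in> C_inf"
  by (auto simp: C_inf_def intro!: continuous_intros tendsto_eq_intros)

text \<open>Dominated convergence is a statement about sequences; this transfers it to limits at
  infinity.\<close>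

lemma tendsto_at_infinity_sequentiallyI:
  fixes f :: "'a::real_normed_vector \<Rightarrow> real"
  assumes "\<And>X :: nat \<Rightarrow> 'a. filterlim X at_infinity sequentially \<Longrightarrow> (\<lambda>n. f (X n)) \<longlonglongrightarrow> l"
  shows "(f \<longlongrightarrow> l) at_infinity"
proof (rule ccontr)
  assume "\<not> (f \<longlongrightarrow> l) at_infinity"
  then obtain e where e: "0 < e" "\<not> (\<forall>\<^sub>F x in at_infinity. dist (f x) l < e)"
    unfolding tendsto_iff by blast
  then have "\<forall>n::nat. \<exists>x. real n \<le> norm x \<and> \<not> dist (f x) l < e"
    unfolding eventually_at_infinity by blast
  then obtain X where X: "\<And>n::nat. real n \<le> norm (X n)" "\<And>n. \<not> dist (f (X n)) l < e" by metis
  have "filterlim X at_infinity sequentially"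
    by (rule filterlim_norm_at_top_imp_at_infinity[OF filterlim_at_top_mono[OF filterlim_real_sequentially]])
      (use X in auto)
  from tendstoD[OF assms[OF this] e(1)] X(2) show False by simp
qed

locale feller = 
  fixes K :: "real \<Rightarrow> 'a::euclidean_space \<Rightarrow> 'a measure"
  assumes feller: "feller_kernel K"
begin

lemma K_measurable: "0 \<le> t \<Longrightarrow> K t \<in> borel \<rightarrow>\<^sub>M prob_algebra borel"
  using feller by (simp add: feller_kernel_def)

lemma K_prob: "0 \<le> t \<Longrightarrow> prob_space (K t x)"
  and K_sets: "0 \<le> t \<Longrightarrow> sets (K t x) = sets borel"
  using measurable_space[OF K_measurable, of t x] by (auto simp: space_prob_algebra)

lemma K_space: "0 \<le> t \<Longrightarrow> space (K t x) = UNIV"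
  using sets_eq_imp_space_eq[OF K_sets] by simp

lemma kernel_op_integrable:
  fixes f :: "'a \<Rightarrow> real"
  assumes "0 \<le> t" "f \<in> borel_measurable borel" "\<And>z. \<bar>f z\<bar> \<le> B"
  shows "integrable (K t x) f"
proof -
  interpret prob_space "K t x" by (rule K_prob[OF assms(1)])
  show ?thesis
    by (rule integrable_const_bound[where B=B])
      (use assms in \<open>auto simp: measurable_cong_sets[OF K_sets]\<close>)
qed

lemma kernel_op_bound:
  assumes "0 \<le> t" "f \<in> borel_measurable borel" "\<And>z. \<bar>f z\<bar> \<le> B"
  shows "\<bar>kernel_op K t f x\<bar> \<le> B"
proof -
  interpret prob_space "K t x" by (rule K_prob[OF assms(1)])
  have "\<bar>kernel_op K t f x\<bar> \<le> (LINT z|K t x. \<bar>f z\<bar>)"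
    unfolding kernel_op_def using integral_norm_bound[of "K t x" f] by simp
  also have "\<dots> \<le> (LINT z|K t x. B)"
    using kernel_op_integrable[OF assms] assms(3) by (intro integral_mono) auto
  finally show ?thesis by (simp add: prob_space)
qed

lemma kernel_op_diff:
  assumes "0 \<le> t" "f \<in> borel_measurable borel" "\<And>z. \<bar>f z\<bar> \<le> B" "g \<in> borel_measurable borel" "\<And>z. \<bar>g z\<bar> \<le> C"
  shows "kernel_op K t (\<lambda>z. f z - g z) x = kernel_op K t f x - kernel_op K t g x"
  unfolding kernel_op_def using kernel_op_integrable[OF assms(1,2,3)] kernel_op_integrable[OF assms(1,4,5)] by simp

lemma kernel_op_cmult: "kernel_op K t (\<lambda>z. c * f z) x = c * kernel_op K t f x"
  unfolding kernel_op_def by simp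

lemma kernel_op_zero: "kernel_op K 0 f x = (f x :: real)" if "f \<in> borel_measurable borel"
  using feller that by (simp add: feller_kernel_def kernel_op_def integral_return)

lemma kernel_op_add:
  assumes st: "0 \<le> s" "0 \<le> t" and f: "f \<in> borel_measurable borel" "\<And>z. \<bar>f z\<bar> \<le> B"
  shows "kernel_op K (s + t) f x = kernel_op K s (kernel_op K t f) x"
proof -
  interpret prob_space "K s x" by (rule K_prob[OF st(1)])
  have "K (s + t) x = K s x \<bind> K t" using feller st by (simp add: feller_kernel_def)
  moreover have "(LINT z|(K s x \<bind> K t). f z) = (LINT y|K s x. LINT z|K t y. f z)"
  proof (rule integral_bind[where K=borel and B=B and B'=1])
    show "K t \<in> K s x \<rightarrow>\<^sub>M subprob_algebra borel"
      using measurable_prob_algebraD[OF K_measurable[OF st(2)]] by (simp add: measurable_cong_sets[OF K_sets[OF st(1)]])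
    show "AE y in K s x. emeasure (K t y) (space (K t y)) \<le> ennreal 1"
      using prob_space.emeasure_space_1[OF K_prob[OF st(2)]] by simp
  qed (use f in \<open>auto simp: not_empty finite_measure_axioms\<close>)
  ultimately show ?thesis by (simp add: kernel_op_def)
qed

lemma kernel_op_C_inf: "0 \<le> t \<Longrightarrow> f \<in> C_inf \<Longrightarrow> kernel_op K t f \<in> C_inf"
  using feller by (simp add: feller_kernel_def)

lemma kernel_op_commute:
  assumes "0 \<le> s" "0 \<le> t" "f \<in> C_inf"
  shows "kernel_op K s (kernel_op K t f) x = kernel_op K t (kernel_op K s f) x"
proof -
  obtain B where "\<And>z. \<bar>f z\<bar> \<le> B" using C_inf_bounded[OF assms(3)] by blast
  then show ?thesis
    using kernel_op_add[of s t f B x] kernel_op_add[of t s f B x] assms C_inf_measurable[OF assms(3)]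
    by (simp add: add.commute)
qed

text \<open>For \<open>u = v + h\<close> the difference is the contraction
  \<open>kernel_op K v\<close> applied to \<open>kernel_op K h f - f\<close>, so strong continuity
  at 0 holds with the same modulus at every time.\<close>

lemma kernel_op_uniform_continuous:
  assumes f: "f \<in> C_inf" and e: "0 < e"
  obtains d where "0 < d" "\<And>u v x. 0 \<le> u \<Longrightarrow> 0 \<le> v \<Longrightarrow> \<bar>u - v\<bar> < d \<Longrightarrow> \<bar>kernel_op K u f x - kernel_op K v f x\<bar> \<le> e"
proof -
  obtain B where B: "\<And>z. \<bar>f z\<bar> \<le> B" using C_inf_bounded[OF f] by blast
  have fm: "f \<in> borel_measurable borel" using C_inf_measurable[OF f] .
  have "uniform_limit UNIV (\<lambda>t x. kernel_op K t f x) f (at_right 0)"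
    using feller f by (simp add: feller_kernel_def)
  then have "\<forall>\<^sub>F t in at_right 0. \<forall>x\<in>UNIV. dist (kernel_op K t f x) (f x) < e"
    using e by (rule uniform_limitD)
  then obtain d where d: "0 < d" "\<And>h x. 0 < h \<Longrightarrow> h < d \<Longrightarrow> \<bar>kernel_op K h f x - f x\<bar> < e"
    by (auto simp: eventually_at_right_field dist_real_def)
  have 1: "\<bar>kernel_op K (v + h) f x - kernel_op K v f x\<bar> \<le> e" if "0 \<le> v" "0 \<le> h" "h < d" for v h x
  proof (cases "h = 0")
    case False
    have hm: "kernel_op K h f \<in> C_inf" using kernel_op_C_inf f that by simp
    have hb: "\<bar>kernel_op K h f z\<bar> \<le> B" for z by (rule kernel_op_bound) (use that fm B in auto)
    have "kernel_op K (v + h) f x - kernel_op K v f x = kernel_op K v (\<lambda>z. kernel_op K h f z - f z) x"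
      using kernel_op_diff[OF that(1) C_inf_measurable[OF hm] hb fm B] kernel_op_add[OF that(1,2) fm B] by simp
    also have "\<bar>\<dots>\<bar> \<le> e"
      by (rule kernel_op_bound) (use that d False C_inf_measurable[OF hm] fm in \<open>auto intro: less_imp_le\<close>)
    finally show ?thesis .
  qed (use e in simp)
  have "\<bar>kernel_op K u f x - kernel_op K v f x\<bar> \<le> e" if "0 \<le> u" "0 \<le> v" "\<bar>u - v\<bar> < d" for u v x
    using 1[of u "v - u" x] 1[of v "u - v" x] that by (cases "u \<le> v") (auto simp: abs_minus_commute)
  then show thesis using d(1) that by blast
qed

text \<open>The kernels are constrained at nonnegative times only; truncation by
  \<open>max 0\<close> makes the function continuous on the whole space, hence measurable for later
  uses of Fubini's theorem.\<close>

lemma kernel_op_jointly_continuous: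
  assumes f: "f \<in> C_inf"
  shows "continuous_on UNIV (\<lambda>(u, x). kernel_op K (max 0 u) f x)"
proof -
  have "isCont (\<lambda>(u, x). kernel_op K (max 0 u) f x) (u, x)" for u x
    unfolding isCont_def tendsto_iff
  proof (intro allI impI)
    fix e :: real assume e: "0 < e"
    obtain d where d: "0 < d" "\<And>u v x. 0 \<le> u \<Longrightarrow> 0 \<le> v \<Longrightarrow> \<bar>u - v\<bar> < d \<Longrightarrow> \<bar>kernel_op K u f x - kernel_op K v f x\<bar> \<le> e / 2"
      using kernel_op_uniform_continuous[OF f, of "e / 2"] e by auto
    have "continuous_on UNIV (kernel_op K (max 0 u) f)"
      using kernel_op_C_inf[OF _ f, of "max 0 u"] by (simp add: C_inf_def)
    then have c: "isCont (kernel_op K (max 0 u) f) x" by (simp add: continuous_on_eq_continuous_at)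
    have "((\<lambda>p. kernel_op K (max 0 u) f (snd p)) \<longlongrightarrow> kernel_op K (max 0 u) f x) (at (u, x))"
      using isCont_tendsto_compose[OF c, of snd "at (u, x)"] tendsto_snd[OF tendsto_ident_at[of "(u, x)" UNIV]] by simp
    then have 1: "\<forall>\<^sub>F p in at (u, x). dist (kernel_op K (max 0 u) f (snd p)) (kernel_op K (max 0 u) f x) < e / 2"
      using e by (intro tendstoD) auto
    have "(fst \<longlongrightarrow> u) (at (u, x))"
      using tendsto_fst[OF tendsto_ident_at[of "(u, x)" UNIV]] by simp
    then have 2: "\<forall>\<^sub>F p in at (u, x). dist (fst p) u < d" using d(1) by (rule tendstoD)
    show "\<forall>\<^sub>F p in at (u, x). dist (case p of (u, x) \<Rightarrow> kernel_op K (max 0 u) f x) (case (u, x) of (u, x) \<Rightarrow> kernel_op K (max 0 u) f x) < e"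
      using 1 2
    proof eventually_elim
      case (elim p)
      obtain v y where [simp]: "p = (v, y)" by (cases p)
      have "\<bar>max 0 v - max 0 u\<bar> < d" using elim(2) by (auto simp: dist_real_def max_def)
      then have "\<bar>kernel_op K (max 0 v) f y - kernel_op K (max 0 u) f y\<bar> \<le> e / 2"
        by (intro d) auto
      moreover have "\<bar>kernel_op K (max 0 u) f y - kernel_op K (max 0 u) f x\<bar> < e / 2"
        using elim(1) by (simp add: dist_real_def)
      ultimately have "\<bar>kernel_op K (max 0 v) f y - kernel_op K (max 0 u) f x\<bar> < e" by linarith
      then show ?case by (simp add: dist_real_def)
    qed
  qed
  then show ?thesis by (simp add: continuous_on_eq_continuous_at)
qed

lemma kernel_op_jointly_measurable:
  assumes f: "f \<in> C_inf"
  shows "(\<lambda>(u, x). kernel_op K (max 0 u) f x) \<in> borel_measurable (borel \<Otimes>\<^sub>M borel)"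
  unfolding borel_prod by (intro borel_measurable_continuous_onI kernel_op_jointly_continuous f)

lemma kernel_op_measurable_time:
  assumes f: "f \<in> C_inf"
  shows "(\<lambda>u. kernel_op K (max 0 u) f x) \<in> borel_measurable borel"
  using measurable_compose[OF _ kernel_op_jointly_measurable[OF f], of "\<lambda>u. (u, x)" borel] by simp

section \<open>The generator and Dynkin's formula\<close>

lemma has_generator_value_unique:
  assumes "has_generator_value K f g" "has_generator_value K f g'"
  shows "g = g'"
proof
  fix x
  have "((\<lambda>t. (kernel_op K t f x - f x) / t) \<longlongrightarrow> g x) (at_right 0)" "((\<lambda>t. (kernel_op K t f x - f x) / t) \<longlongrightarrow> g' x) (at_right 0)"
    using assms unfolding has_generator_value_def by (auto intro: tendsto_uniform_limitI)
  then show "g x = g' x" by (rule tendsto_unique[rotated]) simp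
qed

lemma gen_eq: "has_generator_value K f g \<Longrightarrow> gen K f = g"
  unfolding gen_def by (rule the_equality) (auto intro: has_generator_value_unique)

lemma gen_domI: "has_generator_value K f g \<Longrightarrow> f \<in> gen_dom K"
  by (auto simp: gen_dom_def)

lemma gen_dom_gen: "f \<in> gen_dom K \<Longrightarrow> has_generator_value K f (gen K f)"
  using gen_eq by (auto simp: gen_dom_def)

text \<open>The generator gives right derivatives, and uniformly: the quotient from \<open>v\<close>
  to \<open>v + h\<close> is a contraction applied to the generator quotient, so \<open>key\<close>
  holds with one \<open>d2\<close> for all \<open>v\<close>. A left quotient at \<open>u\<close> is
  a right quotient at \<open>u + h\<close> with \<open>h < 0\<close>, and strong continuity on
  \<open>g\<close> compares the two base points.\<close>

lemma kernel_op_deriv: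
  assumes fg: "has_generator_value K f g" and u: "0 < u"
  shows "((\<lambda>u. kernel_op K u f x) has_real_derivative kernel_op K u g x) (at u)"
proof -
  have f: "f \<in> C_inf" and g: "g \<in> C_inf"
    and U: "uniform_limit UNIV (\<lambda>t x. (kernel_op K t f x - f x) / t) g (at_right 0)"
    using fg by (auto simp: has_generator_value_def)
  obtain B where B: "\<And>z. \<bar>f z\<bar> \<le> B" using C_inf_bounded[OF f] by blast
  obtain B' where B': "\<And>z. \<bar>g z\<bar> \<le> B'" using C_inf_bounded[OF g] by blast
  have fm: "f \<in> borel_measurable borel" and gm: "g \<in> borel_measurable borel" using C_inf_measurable f g by auto
  show ?thesis
    unfolding DERIV_def tendsto_iff
  proof (intro allI impI)
    fix e :: real assume e: "0 < e"
    obtain d1 where d1: "0 < d1" "\<And>u v x. 0 \<le> u \<Longrightarrow> 0 \<le> v \<Longrightarrow> \<bar>u - v\<bar> < d1 \<Longrightarrow> \<bar>kernel_op K u g x - kernel_op K v g x\<bar> \<le> e / 3"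
      using kernel_op_uniform_continuous[OF g, of "e / 3"] e by auto
    have "\<forall>\<^sub>F t in at_right 0. \<forall>x\<in>UNIV. dist ((kernel_op K t f x - f x) / t) (g x) < e / 3"
      using U e by (intro uniform_limitD) auto
    then obtain d2 where d2: "0 < d2" "\<And>h x. 0 < h \<Longrightarrow> h < d2 \<Longrightarrow> \<bar>(kernel_op K h f x - f x) / h - g x\<bar> < e / 3"
      by (auto simp: eventually_at_right_field dist_real_def)
    have key: "\<bar>(kernel_op K (v + h) f x - kernel_op K v f x) / h - kernel_op K v g x\<bar> \<le> e / 3"
      if "0 \<le> v" "0 < h" "h < d2" for v h
    proof -
      have hm: "kernel_op K h f \<in> borel_measurable borel" 
        by (rule C_inf_measurable[OF kernel_op_C_inf[OF less_imp_le[OF that(2)] f]])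
      have hb: "\<bar>kernel_op K h f z\<bar> \<le> B" for z by (rule kernel_op_bound) (use that fm B in auto)
      have qm: "(\<lambda>z. (kernel_op K h f z - f z) / h) \<in> borel_measurable borel" using hm fm by measurable
      have qb: "\<bar>(kernel_op K h f z - f z) / h\<bar> \<le> B' + e" for z
        using d2(2)[OF that(2,3), of z] B'[of z] e by linarith
      have "(kernel_op K (v + h) f x - kernel_op K v f x) / h = kernel_op K v (\<lambda>z. (1 / h) * (kernel_op K h f z - f z)) x"
        unfolding kernel_op_cmult
        using kernel_op_diff[OF that(1) hm hb fm B] kernel_op_add[OF that(1) less_imp_le[OF that(2)] fm B] by simp
      then have "(kernel_op K (v + h) f x - kernel_op K v f x) / h - kernel_op K v g x
          = kernel_op K v (\<lambda>z. (kernel_op K h f z - f z) / h - g z) x"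
        using kernel_op_diff[OF that(1) qm qb gm B'] by simp
      also have "\<bar>\<dots>\<bar> \<le> e / 3"
        by (rule kernel_op_bound) (use that d2 qm gm in \<open>auto intro: less_imp_le\<close>)
      finally show ?thesis .
    qed
    have "\<forall>\<^sub>F h in at 0. h \<noteq> (0::real) \<and> \<bar>h\<bar> < d1 \<and> \<bar>h\<bar> < d2 \<and> \<bar>h\<bar> < u"
      unfolding eventually_at using d1(1) d2(1) u
      by (intro exI[of _ "min d1 (min d2 u)"]) (auto simp: dist_real_def)
    then show "\<forall>\<^sub>F h in at 0. dist ((kernel_op K (u + h) f x - kernel_op K u f x) / h) (kernel_op K u g x) < e"
    proof eventually_elim
      case (elim h)
      show ?case
      proof (cases "0 < h")
        case True
        then show ?thesis using key[of u h] elim u e by (auto simp: dist_real_def)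
      next
        case False
        then have "h < 0" using elim by simp
        have "\<bar>(kernel_op K u f x - kernel_op K (u + h) f x) / (- h) - kernel_op K (u + h) g x\<bar> \<le> e / 3"
          using key[of "u + h" "- h"] elim \<open>h < 0\<close> by simp
        moreover have "\<bar>kernel_op K (u + h) g x - kernel_op K u g x\<bar> \<le> e / 3"
          by (rule d1(2)) (use elim u \<open>h < 0\<close> in auto)
        moreover have "(kernel_op K u f x - kernel_op K (u + h) f x) / (- h) = (kernel_op K (u + h) f x - kernel_op K u f x) / h"
          by (metis minus_diff_eq minus_divide_divide)
        ultimately have "\<bar>(kernel_op K (u + h) f x - kernel_op K u f x) / h - kernel_op K u g x\<bar> < e"
          using e by linarith
        then show ?thesis by (simp add: dist_real_def)
      qed
    qed
  qed
qed

text \<open>Dynkin's formula. Differentiability is used in the interior of the interval only;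
  continuity covers the end points.\<close>

lemma kernel_op_FTC:
  assumes fg: "has_generator_value K f g" and u: "0 < u"
  shows "(LINT s|lborel. indicator {0..u} s * kernel_op K (max 0 s) g x) = kernel_op K u f x - f x"
    and "integrable lborel (\<lambda>s. indicator {0..u} s * kernel_op K (max 0 s) g x)"
proof -
  have f: "f \<in> C_inf" and g: "g \<in> C_inf" using fg by (auto simp: has_generator_value_def)
  obtain B where B: "\<And>z. \<bar>g z\<bar> \<le> B" using C_inf_bounded[OF g] by blast
  have [measurable]: "(\<lambda>s. kernel_op K (max 0 s) g x) \<in> borel_measurable borel" by (rule kernel_op_measurable_time[OF g])
  have b: "\<bar>kernel_op K (max 0 s) g x\<bar> \<le> B" for s
    by (rule kernel_op_bound) (use B C_inf_measurable[OF g] in auto)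
  have "integrable lborel (\<lambda>s. indicator {0..u} s * kernel_op K (max 0 s) g x)"
  proof (rule integrable_compact_support[where R=u and K=B])
    show "\<bar>indicator {0..u} t * kernel_op K (max 0 t) g x\<bar> \<le> B" for t
      using b[of t] by (auto simp: indicator_def intro: order_trans[OF abs_ge_zero])
  qed (auto simp: indicator_def)
  then show i: "integrable lborel (\<lambda>s. indicator {0..u} s * kernel_op K (max 0 s) g x)" .
  have "((\<lambda>s. kernel_op K (max 0 s) g x) has_integral kernel_op K (max 0 u) f x - kernel_op K (max 0 0) f x) {0..u}"
  proof (rule fundamental_theorem_of_calculus_interior)
    have "continuous_on UNIV ((\<lambda>(u, x). kernel_op K (max 0 u) f x) \<circ> (\<lambda>s. (s, x)))"
      by (intro continuous_on_compose continuous_intros continuous_on_subset[OF kernel_op_jointly_continuous[OF f]]) auto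
    then show "continuous_on {0..u} (\<lambda>s. kernel_op K (max 0 s) f x)"
      by (auto simp: comp_def intro: continuous_on_subset)
    fix s assume s: "s \<in> {0<..<u}"
    have "((\<lambda>s. kernel_op K s f x) has_real_derivative kernel_op K (max 0 s) g x) (at s)"
      using kernel_op_deriv[OF fg, of s] s by simp
    then have "((\<lambda>s. kernel_op K (max 0 s) f x) has_real_derivative kernel_op K (max 0 s) g x) (at s)"
      by (rule has_field_derivative_transform_within_open[where S="{0<..}"]) (use s in auto)
    then show "((\<lambda>s. kernel_op K (max 0 s) f x) has_vector_derivative kernel_op K (max 0 s) g x) (at s)"
      by (simp add: has_real_derivative_iff_has_vector_derivative)
  qed (use u in simp)
  then have "integral {0..u} (\<lambda>s. kernel_op K (max 0 s) g x) = kernel_op K u f x - f x"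
    using u C_inf_measurable[OF f] by (simp add: kernel_op_zero integral_unique)
  moreover have "set_integrable lborel {0..u} (\<lambda>s. kernel_op K (max 0 s) g x)"
    using i by (simp add: set_integrable_def)
  ultimately show "(LINT s|lborel. indicator {0..u} s * kernel_op K (max 0 s) g x) = kernel_op K u f x - f x"
    using set_borel_integral_eq_integral(2)[of "{0..u}" "\<lambda>s. kernel_op K (max 0 s) g x"]
    by (simp add: set_lebesgue_integral_def)
qed

section \<open>Mixtures of the semigroup over time\<close>

definition mixed :: "(real \<Rightarrow> real) \<Rightarrow> ('a \<Rightarrow> real) \<Rightarrow> 'a \<Rightarrow> real" where
  "mixed w f x = (LINT u|lborel. kernel_op K (max 0 u) f x * w u)"

lemma mixed_integrable:
  assumes f: "f \<in> C_inf" and w: "integrable lborel w"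
  shows "integrable lborel (\<lambda>u. kernel_op K (max 0 u) f x * w u)"
proof -
  obtain B where B: "0 < B" "\<And>z. \<bar>f z\<bar> \<le> B" using C_inf_bounded[OF f] by blast
  have [measurable]: "(\<lambda>u. kernel_op K (max 0 u) f x) \<in> borel_measurable borel" by (rule kernel_op_measurable_time[OF f])
  have [measurable]: "w \<in> borel_measurable borel" using borel_measurable_integrable[OF w] by simp
  have b: "\<bar>kernel_op K (max 0 u) f x\<bar> \<le> B" for u
    by (rule kernel_op_bound) (use B C_inf_measurable[OF f] in auto)
  show ?thesis
    by (rule Bochner_Integration.integrable_bound[OF integrable_mult_right[OF integrable_norm[OF w], of B]])
      (use b B in \<open>auto simp: abs_mult intro!: mult_right_mono\<close>)
qed

lemma mixed_bound:
  assumes f: "f \<in> C_inf" and w: "integrable lborel w" and B: "\<And>z. \<bar>f z\<bar> \<le> B"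
  shows "\<bar>mixed w f x\<bar> \<le> B * (LINT u|lborel. \<bar>w u\<bar>)"
proof -
  have b: "\<bar>kernel_op K (max 0 u) f x\<bar> \<le> B" for u
    by (rule kernel_op_bound) (use B C_inf_measurable[OF f] in auto)
  have "\<bar>mixed w f x\<bar> \<le> (LINT u|lborel. \<bar>kernel_op K (max 0 u) f x * w u\<bar>)"
    unfolding mixed_def using integral_norm_bound[of lborel "\<lambda>u. kernel_op K (max 0 u) f x * w u"] by simp
  also have "\<dots> \<le> (LINT u|lborel. B * \<bar>w u\<bar>)"
  proof (rule integral_mono)
    show "integrable lborel (\<lambda>u. \<bar>kernel_op K (max 0 u) f x * w u\<bar>)"
      using mixed_integrable[OF f w] by simp
    show "\<bar>kernel_op K (max 0 u) f x * w u\<bar> \<le> B * \<bar>w u\<bar>" for u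
      using b[of u] by (simp add: abs_mult mult_right_mono)
  qed (use w in simp)
  finally show ?thesis by simp
qed

lemma mixed_C_inf:
  assumes f: "f \<in> C_inf" and w: "integrable lborel w"
  shows "mixed w f \<in> C_inf"
proof -
  obtain B where B: "0 < B" "\<And>z. \<bar>f z\<bar> \<le> B" using C_inf_bounded[OF f] by blast
  have b: "\<bar>kernel_op K (max 0 u) f x\<bar> \<le> B" for u x
    by (rule kernel_op_bound) (use B C_inf_measurable[OF f] in auto)
  \<comment> \<open>One dominated convergence for both claims: \<open>X\<close> converges to a point
    for continuity, and leaves every bounded set for vanishing at infinity.\<close>
  have dct: "(\<lambda>n. mixed w f (X n)) \<longlonglongrightarrow> (LINT u|lborel. l u * w u)"
    if "\<And>u. (\<lambda>n. kernel_op K (max 0 u) f (X n)) \<longlonglongrightarrow> l u" "l \<in> borel_measurable borel" for X :: "nat \<Rightarrow> 'a" and l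
    unfolding mixed_def
  proof (rule integral_dominated_convergence[where w="\<lambda>u. B * \<bar>w u\<bar>"])
    show "AE u in lborel. (\<lambda>n. kernel_op K (max 0 u) f (X n) * w u) \<longlonglongrightarrow> l u * w u"
      by (intro AE_I2 tendsto_intros that)
    show "AE u in lborel. norm (kernel_op K (max 0 u) f (X n) * w u) \<le> B * \<bar>w u\<bar>" for n
      using b by (intro AE_I2) (auto simp: abs_mult intro!: mult_right_mono)
    show "integrable lborel (\<lambda>u. B * \<bar>w u\<bar>)" using w by simp
    show "(\<lambda>u. l u * w u) \<in> borel_measurable lborel" using that(2) borel_measurable_integrable[OF w] by simp
    show "(\<lambda>u. kernel_op K (max 0 u) f (X n) * w u) \<in> borel_measurable lborel" for n
      using mixed_integrable[OF f w] by (rule borel_measurable_integrable)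
  qed
  have "continuous_on UNIV (mixed w f)"
    unfolding continuous_on_sequentially
  proof (intro ballI allI impI)
    fix X :: "nat \<Rightarrow> 'a" and x assume "(\<forall>n. X n \<in> UNIV) \<and> X \<longlonglongrightarrow> x"
    then have X: "X \<longlonglongrightarrow> x" by simp
    have "(\<lambda>n. kernel_op K (max 0 u) f (X n)) \<longlonglongrightarrow> kernel_op K (max 0 u) f x" for u
    proof -
      have "isCont (kernel_op K (max 0 u) f) x"
        using kernel_op_C_inf[OF _ f, of "max 0 u"] by (simp add: C_inf_def continuous_on_eq_continuous_at)
      then show ?thesis using X by (rule isCont_tendsto_compose)
    qed
    from dct[OF this kernel_op_measurable_time[OF f]]
    show "(mixed w f \<circ> X) \<longlonglongrightarrow> mixed w f x" by (simp add: mixed_def comp_def)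
  qed
  moreover have "(mixed w f \<longlongrightarrow> 0) at_infinity"
  proof (rule tendsto_at_infinity_sequentiallyI)
    fix X :: "nat \<Rightarrow> 'a" assume X: "filterlim X at_infinity sequentially"
    have "(\<lambda>n. kernel_op K (max 0 u) f (X n)) \<longlonglongrightarrow> 0" for u
      using kernel_op_C_inf[OF _ f, of "max 0 u"] X by (auto simp: C_inf_def intro: filterlim_compose)
    from dct[of X "\<lambda>_. 0", OF this] show "(\<lambda>n. mixed w f (X n)) \<longlonglongrightarrow> 0" by simp
  qed
  ultimately show ?thesis by (simp add: C_inf_def)
qed

lemma kernel_op_mixed:
  assumes f: "f \<in> C_inf" and w: "integrable lborel w" and s: "0 \<le> s"
  shows "kernel_op K s (mixed w f) x = mixed w (kernel_op K s f) x"
proof -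
  interpret prob_space "K s x" by (rule K_prob[OF s])
  interpret P: pair_sigma_finite "K s x" lborel ..
  obtain B where B: "0 < B" "\<And>z. \<bar>f z\<bar> \<le> B" using C_inf_bounded[OF f] by blast
  have b: "\<bar>kernel_op K (max 0 u) f x\<bar> \<le> B" for u x
    by (rule kernel_op_bound) (use B C_inf_measurable[OF f] in auto)
  have [measurable]: "w \<in> borel_measurable borel" using borel_measurable_integrable[OF w] by simp
  have [measurable]: "(\<lambda>(u, x). kernel_op K (max 0 u) f x) \<in> borel_measurable (borel \<Otimes>\<^sub>M borel)"
    by (rule kernel_op_jointly_measurable[OF f])
  have [measurable_cong]: "sets (K s x) = sets borel" by (rule K_sets[OF s])
  have bw: "\<bar>kernel_op K (max 0 u) f z * w u\<bar> \<le> B * \<bar>w u\<bar>" for u z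
    using b by (auto simp: abs_mult intro!: mult_right_mono)
  have "integrable (K s x \<Otimes>\<^sub>M lborel) (\<lambda>(z, u). kernel_op K (max 0 u) f z * w u)"
  proof (rule P.Fubini_integrable)
    show m: "(\<lambda>(z, u). kernel_op K (max 0 u) f z * w u) \<in> borel_measurable (K s x \<Otimes>\<^sub>M lborel)" by measurable
    show "AE z in K s x. integrable lborel (\<lambda>u. case (z, u) of (z, u) \<Rightarrow> kernel_op K (max 0 u) f z * w u)"
      using mixed_integrable[OF f w] by simp
    show "integrable (K s x) (\<lambda>z. LINT u|lborel. norm (case (z, u) of (z, u) \<Rightarrow> kernel_op K (max 0 u) f z * w u))"
    proof (rule integrable_const_bound[where B="B * (LINT u|lborel. \<bar>w u\<bar>)"])
      have "(LINT u|lborel. \<bar>kernel_op K (max 0 u) f z * w u\<bar>) \<le> (LINT u|lborel. B * \<bar>w u\<bar>)" for z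
        using mixed_integrable[OF f w] w bw by (intro integral_mono) auto
      then show "AE z in K s x. norm (LINT u|lborel. norm (case (z, u) of (z, u) \<Rightarrow> kernel_op K (max 0 u) f z * w u)) \<le> B * (LINT u|lborel. \<bar>w u\<bar>)"
        by (intro AE_I2) (simp add: integral_nonneg_AE)
    qed measurable
  qed
  from P.Fubini_integral[OF this]
  have "kernel_op K s (mixed w f) x = (LINT u|lborel. LINT z|K s x. kernel_op K (max 0 u) f z * w u)"
    by (simp add: kernel_op_def[of K s] mixed_def)
  also have "\<dots> = (LINT u|lborel. kernel_op K s (kernel_op K (max 0 u) f) x * w u)"
    by (simp add: kernel_op_def[of K s])
  also have "\<dots> = mixed w (kernel_op K s f) x"
    unfolding mixed_def using kernel_op_commute[OF s _ f] by (intro Bochner_Integration.integral_cong) auto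
  finally show ?thesis .
qed

lemma mixed_diff:
  assumes "f \<in> C_inf" "g \<in> C_inf" "integrable lborel w"
  shows "mixed w (\<lambda>z. f z - g z) x = mixed w f x - mixed w g x"
proof -
  obtain B where B: "\<And>z. \<bar>f z\<bar> \<le> B" using C_inf_bounded[OF assms(1)] by blast
  obtain B' where B': "\<And>z. \<bar>g z\<bar> \<le> B'" using C_inf_bounded[OF assms(2)] by blast
  have "kernel_op K (max 0 u) (\<lambda>z. f z - g z) x = kernel_op K (max 0 u) f x - kernel_op K (max 0 u) g x" for u
    by (rule kernel_op_diff) (use assms C_inf_measurable B B' in auto)
  then show ?thesis
    using mixed_integrable[OF assms(1,3)] mixed_integrable[OF assms(2,3)]
    by (simp add: mixed_def left_diff_distrib)
qed

lemma mixed_cmult: "mixed w (\<lambda>z. c * f z) x = c * mixed w f x"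
  by (simp add: mixed_def kernel_op_cmult mult.assoc)

text \<open>The semigroup commutes with mixing, so the difference quotient of a mixture is the
  mixture of the difference quotients; mixing is bounded in the supremum norm by the integral of
  \<open>\<bar>w\<bar>\<close>, which preserves uniform convergence. It is applied with
  \<open>w = Q t\<close> and with weights obtained by testing \<open>Q\<close> in time.\<close>

lemma mixed_generator:
  assumes fg: "has_generator_value K f g" and w: "integrable lborel w"
  shows "has_generator_value K (mixed w f) (mixed w g)"
proof -
  have f: "f \<in> C_inf" and g: "g \<in> C_inf"
    and U: "uniform_limit UNIV (\<lambda>t x. (kernel_op K t f x - f x) / t) g (at_right 0)"
    using fg by (auto simp: has_generator_value_def)
  define J where "J = (LINT u|lborel. \<bar>w u\<bar>)"
  have J: "0 \<le> J" unfolding J_def by (rule integral_nonneg_AE) simp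
  have "uniform_limit UNIV (\<lambda>t x. (kernel_op K t (mixed w f) x - mixed w f x) / t) (mixed w g) (at_right 0)"
  proof (rule uniform_limitI)
    fix e :: real assume e: "0 < e"
    \<comment> \<open>The denominator \<open>J + 1\<close> stays positive when \<open>w\<close>
      vanishes almost everywhere.\<close>
    have "\<forall>\<^sub>F t in at_right 0. \<forall>x\<in>UNIV. dist ((kernel_op K t f x - f x) / t) (g x) < e / (J + 1)"
      using U e J by (intro uniform_limitD) auto
    then show "\<forall>\<^sub>F t in at_right 0. \<forall>x\<in>UNIV. dist ((kernel_op K t (mixed w f) x - mixed w f x) / t) (mixed w g x) < e"
      using eventually_at_right_less[of 0]
    proof eventually_elim
      case (elim t)
      have tf: "kernel_op K t f \<in> C_inf" using elim f kernel_op_C_inf by simp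
      have q: "(\<lambda>z. (1 / t) * (kernel_op K t f z - f z)) \<in> C_inf"
        by (intro C_inf_cmult C_inf_diff tf f)
      show ?case
      proof
        fix x
        have "(kernel_op K t (mixed w f) x - mixed w f x) / t = mixed w (\<lambda>z. (1 / t) * (kernel_op K t f z - f z)) x"
          unfolding mixed_cmult mixed_diff[OF tf f w, of x] using kernel_op_mixed[OF f w, of t x] elim by simp
        then have "(kernel_op K t (mixed w f) x - mixed w f x) / t - mixed w g x
            = mixed w (\<lambda>z. (1 / t) * (kernel_op K t f z - f z) - g z) x"
          using mixed_diff[OF q g w] by simp
        also have "\<bar>\<dots>\<bar> \<le> e / (J + 1) * J"
          unfolding J_def
        proof (rule mixed_bound[OF _ w])
          show "(\<lambda>z. (1 / t) * (kernel_op K t f z - f z) - g z) \<in> C_inf" by (intro C_inf_diff q g)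
          show "\<bar>(1 / t) * (kernel_op K t f z - f z) - g z\<bar> \<le> e / ((LINT u|lborel. \<bar>w u\<bar>) + 1)" for z
            using elim(1) unfolding J_def by (auto simp: dist_real_def intro: less_imp_le)
        qed
        also have "\<dots> < e" using e J by (simp add: field_simps)
        finally show "dist ((kernel_op K t (mixed w f) x - mixed w f x) / t) (mixed w g x) < e"
          by (simp add: dist_real_def)
      qed
    qed
  qed
  then show ?thesis by (simp add: has_generator_value_def mixed_C_inf f g w)
qed

end

section \<open>Evaluation at an independent random time\<close>

lemma path_events_measurable:
  assumes Y: "\<And>t. t \<in> I \<Longrightarrow> Y t \<in> borel_measurable M"
  shows "path_events M Y I \<subseteq> sets M"
  using assms by (auto simp: path_events_def intro: measurable_sets)

lemma path_events_Pow: "path_events M Y I \<subseteq> Pow (space M)"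
  by (auto simp: path_events_def)

context prob_space
begin

text \<open>Independence makes the joint law of the path of \<open>Y\<close> and of
  \<open>Zp t\<close> a product measure; Fubini's theorem then freezes the random time.\<close>

lemma expectation_independent_time:
  fixes Y :: "real \<Rightarrow> 'a \<Rightarrow> 'b::euclidean_space" and Zp :: "real \<Rightarrow> 'a \<Rightarrow> real" and g :: "'b \<Rightarrow> real"
  assumes Y: "\<And>t. 0 \<le> t \<Longrightarrow> Y t \<in> borel_measurable M"
    and rc: "\<And>t \<omega>. 0 \<le> t \<Longrightarrow> \<omega> \<in> space M \<Longrightarrow> continuous (at_right t) (\<lambda>t. Y t \<omega>)"
    and indep: "indep_processes M Y Zp" and t: "0 \<le> t" and Z0: "\<And>\<omega>. 0 \<le> Zp t \<omega>"
    and Z: "Zp t \<in> borel_measurable M"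
    and g [measurable]: "g \<in> borel_measurable borel" and gb: "\<And>z. \<bar>g z\<bar> \<le> B"
  shows "(\<lambda>\<omega>. Y (Zp t \<omega>) \<omega>) \<in> borel_measurable M"
    and "(\<lambda>z. LINT \<omega>|M. g (Y (max 0 z) \<omega>)) \<in> borel_measurable borel"
    and "(LINT \<omega>|M. g (Y (Zp t \<omega>) \<omega>)) = (LINT z|distr M borel (Zp t). LINT \<omega>|M. g (Y (max 0 z) \<omega>))"
proof -
  \<comment> \<open>The path is represented by \<open>\<omega>\<close> itself on the smaller
    sigma-algebra generated by \<open>Y\<close>, since only that one is independent of
    \<open>Zp\<close>. Joint measurability of \<open>Y\<close> in path and time is therefore needed
    with respect to \<open>G\<close>.\<close>
  define G where "G = sigma (space M) (path_events M Y {0..})"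
  have sG: "space G = space M" by (simp add: G_def space_measure_of_conv)
  have setsG: "sets G = sigma_sets (space M) (path_events M Y {0..})"
    unfolding G_def by (rule sets_measure_of[OF path_events_Pow])
  have id: "(\<lambda>\<omega>. \<omega>) \<in> measurable M G"
  proof (rule measurable_sigma_sets[OF setsG path_events_Pow])
    fix A assume "A \<in> path_events M Y {0..}"
    then have "A \<in> sets M" using path_events_measurable[of "{0..}" Y] Y by auto
    then show "(\<lambda>\<omega>. \<omega>) -` A \<inter> space M \<in> sets M" by (auto dest: sets.Int_space_eq2)
  qed auto
  have YG: "Y s \<in> borel_measurable G" if "0 \<le> s" for s
  proof (rule measurableI)
    fix A :: "'b set" assume "A \<in> sets borel"
    then have "Y s -` A \<inter> space M \<in> path_events M Y {0..}" using that by (auto simp: path_events_def)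
    then show "Y s -` A \<inter> space G \<in> sets G" unfolding setsG sG by (rule sigma_sets.Basic)
  qed simp
  have joint [measurable]: "(\<lambda>(\<omega>, s). Y (max 0 s) \<omega>) \<in> borel_measurable (G \<Otimes>\<^sub>M borel)"
    by (rule borel_measurable_right_continuous) (use YG rc sG in auto)
  have pairm: "(\<lambda>\<omega>. (\<omega>, Zp t \<omega>)) \<in> measurable M (G \<Otimes>\<^sub>M borel)"
    using id Z by (intro measurable_Pair) auto
  have "(\<lambda>\<omega>. (\<lambda>(\<omega>, s). Y (max 0 s) \<omega>) (\<omega>, Zp t \<omega>)) \<in> borel_measurable M"
    by (rule measurable_compose[OF pairm joint])
  then show YZ: "(\<lambda>\<omega>. Y (Zp t \<omega>) \<omega>) \<in> borel_measurable M" using Z0 by (simp add: max_absorb2)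
  have prod: "prob (A \<inter> (Zp t -` C \<inter> space M)) = prob A * prob (Zp t -` C \<inter> space M)"
    if "A \<in> sets G" "C \<in> sets borel" for A C
  proof -
    have "Zp t -` C \<inter> space M \<in> sigma_sets (space M) (path_events M Zp {0..})"
      using t that(2) by (intro sigma_sets.Basic) (auto simp: path_events_def)
    then show ?thesis
      using indep that(1) unfolding indep_processes_def indep_sets2_eq setsG by blast
  qed
  let ?A = "distr M G (\<lambda>\<omega>. \<omega>)" and ?B = "distr M borel (Zp t)"
  interpret A: prob_space ?A by (rule prob_space_distr[OF id])
  interpret B: prob_space ?B by (rule prob_space_distr[OF Z])
  interpret AB: pair_prob_space ?A ?B ..
  have eq: "?A \<Otimes>\<^sub>M ?B = distr M (G \<Otimes>\<^sub>M borel) (\<lambda>\<omega>. (\<omega>, Zp t \<omega>))"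
  proof (rule pair_measure_eqI)
    show "sets (?A \<Otimes>\<^sub>M ?B) = sets (distr M (G \<Otimes>\<^sub>M borel) (\<lambda>\<omega>. (\<omega>, Zp t \<omega>)))"
      by (simp cong: sets_pair_measure_cong)
    fix A C assume "A \<in> sets ?A" "C \<in> sets ?B"
    then have A: "A \<in> sets G" and C: "C \<in> sets borel" by auto
    have Asub: "A \<subseteq> space M" using sets.sets_into_space[OF A] sG by simp
    have "emeasure (distr M (G \<Otimes>\<^sub>M borel) (\<lambda>\<omega>. (\<omega>, Zp t \<omega>))) (A \<times> C) = emeasure M (A \<inter> (Zp t -` C \<inter> space M))"
      using A C Asub by (subst emeasure_distr[OF pairm]) (auto intro!: arg_cong[where f="emeasure M"])
    also have "\<dots> = ennreal (prob A) * ennreal (prob (Zp t -` C \<inter> space M))"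
      by (simp add: emeasure_eq_measure prod[OF A C] ennreal_mult)
    also have "ennreal (prob A) = emeasure ?A A"
      using Asub by (subst emeasure_distr[OF id A]) (simp add: emeasure_eq_measure Int_absorb2 vimage_def)
    also have "ennreal (prob (Zp t -` C \<inter> space M)) = emeasure ?B C"
      by (subst emeasure_distr[OF Z C]) (simp add: emeasure_eq_measure)
    finally show "emeasure ?A A * emeasure ?B C = emeasure (distr M (G \<Otimes>\<^sub>M borel) (\<lambda>\<omega>. (\<omega>, Zp t \<omega>))) (A \<times> C)" ..
  qed (rule A.sigma_finite_measure_axioms B.sigma_finite_measure_axioms)+
  have gj [measurable]: "(\<lambda>(\<omega>, s). g (Y (max 0 s) \<omega>)) \<in> borel_measurable (G \<Otimes>\<^sub>M borel)"
    using measurable_compose[OF joint g] by (simp add: case_prod_unfold)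
  have gs: "(\<lambda>\<omega>. g (Y (max 0 z) \<omega>)) \<in> borel_measurable G" for z
    using measurable_compose[OF YG[of "max 0 z"] g] by simp
  have inner: "(LINT \<omega>|?A. g (Y (max 0 z) \<omega>)) = (LINT \<omega>|M. g (Y (max 0 z) \<omega>))" for z
    by (rule integral_distr[OF id gs])
  have "(\<lambda>(z, \<omega>). g (Y (max 0 z) \<omega>)) \<in> borel_measurable (borel \<Otimes>\<^sub>M ?A)"
    using measurable_pair_swap[OF gj] by (simp add: case_prod_unfold cong: measurable_cong_sets)
  from A.borel_measurable_lebesgue_integral[OF this]
  show "(\<lambda>z. LINT \<omega>|M. g (Y (max 0 z) \<omega>)) \<in> borel_measurable borel"
    by (simp add: inner)
  have "(LINT \<omega>|M. g (Y (Zp t \<omega>) \<omega>)) = (LINT \<omega>|M. (\<lambda>(\<omega>, s). g (Y (max 0 s) \<omega>)) (\<omega>, Zp t \<omega>))"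
    using Z0 by (simp add: max_absorb2)
  also have "\<dots> = (LINT p|(?A \<Otimes>\<^sub>M ?B). (\<lambda>(\<omega>, s). g (Y (max 0 s) \<omega>)) p)"
    unfolding eq by (rule integral_distr[OF pairm gj, symmetric])
  also have "\<dots> = (LINT z|?B. LINT \<omega>|?A. g (Y (max 0 z) \<omega>))"
  proof (rule AB.integral_snd[symmetric])
    show "integrable (?A \<Otimes>\<^sub>M ?B) (\<lambda>(\<omega>, s). g (Y (max 0 s) \<omega>))"
      by (rule AB.integrable_const_bound[where B=B])
        (use gj gb in \<open>auto cong: measurable_cong_sets\<close>)
  qed
  finally show "(LINT \<omega>|M. g (Y (Zp t \<omega>) \<omega>)) = (LINT z|?B. LINT \<omega>|M. g (Y (max 0 z) \<omega>))"
    by (simp add: inner)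
qed

text \<open>The Markov property with \<open>s = 0\<close>: the conditional probability is almost
  surely the constant \<open>measure (K u x) B\<close>, and integrating it gives the unconditional
  one.\<close>

lemma feller_process_law:
  assumes fp: "feller_process M K x Y" and u: "0 \<le> u"
  shows "distr M borel (Y u) = K u x"
proof -
  interpret K: feller K using fp by unfold_locales (simp add: feller_process_def)
  have mp: "markov_process M K Y" using fp by (simp add: feller_process_def)
  have Y: "Y s \<in> borel_measurable M" if "0 \<le> s" for s using mp that by (simp add: markov_process_def)
  define F where "F = sigma (space M) (path_events M Y {0..0})"
  have setsF: "sets F = sigma_sets (space M) (path_events M Y {0..0})"
    unfolding F_def by (rule sets_measure_of[OF path_events_Pow])
  have "subalgebra M F"
    unfolding subalgebra_def setsF
  proof
    show "space F = space M" by (simp add: F_def space_measure_of_conv)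
    show "sigma_sets (space M) (path_events M Y {0..0}) \<subseteq> sets M"
      using path_events_measurable[of "{0..0}" Y] Y by (intro sets.sigma_sets_subset) auto
  qed
  then interpret F: finite_measure_subalgebra M F
    by unfold_locales
  interpret D: prob_space "distr M borel (Y u)" by (rule prob_space_distr[OF Y[OF u]])
  interpret Kx: prob_space "K u x" by (rule K.K_prob[OF u])
  show ?thesis
  proof (rule measure_eqI)
    show "sets (distr M borel (Y u)) = sets (K u x)" using K.K_sets[OF u] by simp
    fix B assume "B \<in> sets (distr M borel (Y u))"
    then have B: "B \<in> sets borel" by simp
    have m: "Y u -` B \<inter> space M \<in> sets M" using measurable_sets[OF Y[OF u] B] .
    have ae: "AE \<omega> in M. real_cond_exp M F (indicator (Y u -` B \<inter> space M)) \<omega> = measure (K u (Y 0 \<omega>)) B"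
    proof -
      have "AE \<omega> in M. real_cond_exp M (sigma (space M) (path_events M Y {0..0}))
          (indicator (Y (0 + u) -` B \<inter> space M)) \<omega> = measure (K u (Y 0 \<omega>)) B"
        by (rule mp[unfolded markov_process_def, THEN conjunct2, rule_format, OF order_refl u B])
      then show ?thesis by (simp add: F_def)
    qed
    have ii: "integrable M (indicator (Y u -` B \<inter> space M) :: 'a \<Rightarrow> real)"
      using m by (intro integrable_real_indicator) (auto simp: less_top[symmetric])
    have "measure (distr M borel (Y u)) B = (LINT \<omega>|M. indicator (Y u -` B \<inter> space M) \<omega>)"
      using m by (simp add: measure_distr[OF Y[OF u] B])
    also have "\<dots> = (LINT \<omega>|M. real_cond_exp M F (indicator (Y u -` B \<inter> space M)) \<omega>)"
      by (rule F.real_cond_exp_int(2)[OF ii, symmetric])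
    also have "\<dots> = (LINT \<omega>|M. measure (K u x) B)"
    proof (rule integral_cong_AE)
      have "AE \<omega> in M. Y 0 \<omega> = x" using fp by (simp add: feller_process_def)
      then show "AE \<omega> in M. real_cond_exp M F (indicator (Y u -` B \<inter> space M)) \<omega> = measure (K u x) B"
        using ae by eventually_elim simp
    qed auto
    also have "\<dots> = measure (K u x) B" by (simp add: prob_space)
    finally show "emeasure (distr M borel (Y u)) B = emeasure (K u x) B"
      by (simp add: D.emeasure_eq_measure Kx.emeasure_eq_measure)
  qed
qed

lemma time_changed_expectation:
  fixes g :: "'b::euclidean_space \<Rightarrow> real"
  assumes fp: "feller_process M K x Y" and indep: "indep_processes M Y Zp" and t: "0 \<le> t"
    and Z0: "\<And>\<omega>. 0 \<le> Zp t \<omega>" and Z: "distributed M lborel (Zp t) (\<lambda>u. ennreal (q u))"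
    and q: "q \<in> borel_measurable borel" "\<And>u. 0 \<le> q u"
    and g [measurable]: "g \<in> borel_measurable borel" and gb: "\<And>z. \<bar>g z\<bar> \<le> B"
  shows "(\<lambda>\<omega>. Y (Zp t \<omega>) \<omega>) \<in> borel_measurable M"
    and "(\<lambda>u. kernel_op K (max 0 u) g x) \<in> borel_measurable borel"
    and "(LINT \<omega>|M. g (Y (Zp t \<omega>) \<omega>)) = (LINT u|lborel. kernel_op K (max 0 u) g x * q u)"
proof -
  have mp: "markov_process M K Y" and cad: "\<And>\<omega>. \<omega> \<in> space M \<Longrightarrow> cadlag_on_nonneg (\<lambda>t. Y t \<omega>)"
    using fp by (auto simp: feller_process_def)
  have Y: "Y s \<in> borel_measurable M" if "0 \<le> s" for s using mp that by (simp add: markov_process_def)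
  have rc: "continuous (at_right s) (\<lambda>t. Y t \<omega>)" if "0 \<le> s" "\<omega> \<in> space M" for s \<omega>
    using cad[OF that(2)] that(1) by (simp add: cadlag_on_nonneg_def)
  have Zm: "Zp t \<in> borel_measurable M" using distributed_measurable[OF Z] by simp
  note * = expectation_independent_time[OF Y rc indep t Z0 Zm g gb]
  show "(\<lambda>\<omega>. Y (Zp t \<omega>) \<omega>) \<in> borel_measurable M" by (rule *(1))
  have k: "(LINT \<omega>|M. g (Y (max 0 z) \<omega>)) = kernel_op K (max 0 z) g x" for z
    unfolding kernel_op_def using feller_process_law[OF fp, of "max 0 z", symmetric]
    by (simp add: integral_distr[OF Y[of "max 0 z"] g])
  show m: "(\<lambda>u. kernel_op K (max 0 u) g x) \<in> borel_measurable borel"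
    using *(2) unfolding k .
  have "distr M borel (Zp t) = density lborel (\<lambda>u. ennreal (q u))"
    using distributed_distr_eq_density[OF Z] by (simp cong: distr_cong)
  then have "(LINT \<omega>|M. g (Y (Zp t \<omega>) \<omega>)) = (LINT z|density lborel (\<lambda>u. ennreal (q u)). kernel_op K (max 0 z) g x)"
    using *(3) unfolding k by simp
  also have "\<dots> = (LINT u|lborel. q u *\<^sub>R kernel_op K (max 0 u) g x)"
    by (rule integral_density) (use m q in auto)
  finally show "(LINT \<omega>|M. g (Y (Zp t \<omega>) \<omega>)) = (LINT u|lborel. kernel_op K (max 0 u) g x * q u)"
    by (simp add: mult.commute)
qed

end

section \<open>The dual equation\<close>

lemma (in pair_sigma_finite) integrable_product_bound:
  fixes F :: "'a \<times> 'b \<Rightarrow> real"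
  assumes F: "F \<in> borel_measurable (M1 \<Otimes>\<^sub>M M2)" and a: "integrable M1 a" and b: "integrable M2 b"
    and bound: "AE x in M1. \<forall>y\<in>space M2. \<bar>F (x, y)\<bar> \<le> \<bar>a x\<bar> * \<bar>b y :: real\<bar>"
  shows "integrable (M1 \<Otimes>\<^sub>M M2) F"
proof (rule Fubini_integrable[OF F])
  have Fx: "(\<lambda>y. F (x, y)) \<in> borel_measurable M2" if "x \<in> space M1" for x
    using measurable_compose[OF measurable_Pair1'[OF that] F] .
  have ib: "integrable M2 (\<lambda>y. \<bar>a x\<bar> * \<bar>b y\<bar>)" for x using b by simp
  have int: "AE x in M1. integrable M2 (\<lambda>y. F (x, y)) \<and> (LINT y|M2. norm (F (x, y))) \<le> \<bar>a x\<bar> * (LINT y|M2. \<bar>b y\<bar>)"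
    using bound AE_space
  proof eventually_elim
    case (elim x)
    have i: "integrable M2 (\<lambda>y. F (x, y))"
      by (rule Bochner_Integration.integrable_bound[OF ib[of x] Fx]) (use elim in auto)
    have "(LINT y|M2. norm (F (x, y))) \<le> (LINT y|M2. \<bar>a x\<bar> * \<bar>b y\<bar>)"
      by (rule integral_mono[OF integrable_norm[OF i] ib]) (use elim in auto)
    then show ?case using i by simp
  qed
  then show "AE x in M1. integrable M2 (\<lambda>y. F (x, y))" by eventually_elim simp
  show "integrable M1 (\<lambda>x. LINT y|M2. norm (F (x, y)))"
  proof (rule Bochner_Integration.integrable_bound)
    show "integrable M1 (\<lambda>x. \<bar>a x\<bar> * (LINT y|M2. \<bar>b y\<bar>))" using a by simp
    show "(\<lambda>x. LINT y|M2. norm (F (x, y))) \<in> borel_measurable M1" using F by measurable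
    show "AE x in M1. norm (LINT y|M2. norm (F (x, y))) \<le> norm (\<bar>a x\<bar> * (LINT y|M2. \<bar>b y\<bar>))"
      using int by eventually_elim (simp add: integral_nonneg_AE)
  qed
qed

lemma integrable_exp_decay:
  fixes r :: real
  assumes "0 < r"
  shows "integrable lborel (\<lambda>s. indicator {0..} s * exp (- (r * s)))"
proof (rule integrableI_nonneg)
  have "(\<integral>\<^sup>+ s. ennreal (exp (- (r * s))) * indicator {0..} s \<partial>lborel) = ennreal (0 - (- exp (- (r * 0)) / r))"
  proof (rule nn_integral_FTC_atLeast)
    show "((\<lambda>s. - exp (- (r * s)) / r) has_real_derivative exp (- (r * s))) (at s)" for s
      using assms by (auto intro!: derivative_eq_intros)
    show "((\<lambda>s. - exp (- (r * s)) / r) \<longlongrightarrow> 0) at_top" using assms by real_asymp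
  qed auto
  moreover have "(\<integral>\<^sup>+ s. ennreal (indicator {0..} s * exp (- (r * s))) \<partial>lborel) = (\<integral>\<^sup>+ s. ennreal (exp (- (r * s))) * indicator {0..} s \<partial>lborel)"
    by (intro nn_integral_cong) (auto simp: indicator_def)
  ultimately show "(\<integral>\<^sup>+ s. ennreal (indicator {0..} s * exp (- (r * s))) \<partial>lborel) < \<infinity>" by simp
qed auto

section \<open>Testing in time: increments of functions and of the density Q\<close>

context stable_subordinator
begin

text \<open>For \<open>y > 0\<close> the integrand lives on \<open>{0..R}\<close> whatever
  \<open>y\<close> is: \<open>F\<close> vanishes to the left, both \<open>\<phi> t\<close> and
  \<open>\<phi> (t + y)\<close> to the right. This makes the bound uniform in \<open>y\<close> and
  integrable against \<open>\<nu>\<close>. The local bound \<open>C\<close> is kept apart from the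
  global \<open>C'\<close> since for \<open>F = D\<close> at time \<open>s\<close> the local one
  decays in \<open>s\<close>.\<close>

lemma regular_increment:
  assumes [measurable]: "F \<in> borel_measurable borel" and F0: "\<And>t. t < 0 \<Longrightarrow> F t = 0"
    and FC: "\<And>t. \<bar>t\<bar> \<le> R \<Longrightarrow> \<bar>F t\<bar> \<le> C" and Fb: "\<And>t. \<bar>F t\<bar> \<le> C'"
    and \<phi>: "\<phi> \<in> test_fun" and R: "0 < R" "\<And>t. R < \<bar>t\<bar> \<Longrightarrow> \<phi> t = 0" and K: "0 < K" "\<And>t. \<bar>\<phi> t\<bar> \<le> K"
    and incr: "\<And>t y. 0 < y \<Longrightarrow> \<bar>\<phi> (t + y) - \<phi> t\<bar> \<le> K * min 1 y"
  shows "integrable lborel (\<lambda>t. F t * \<phi> (t + y))"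
    and "0 < y \<Longrightarrow> \<bar>regular F (\<lambda>t. \<phi> (t + y)) - regular F \<phi>\<bar> \<le> C * (R * K) * min 1 y"
    and "integrable \<nu> (\<lambda>y. regular F (\<lambda>t. \<phi> (t + y)) - regular F \<phi>)"
proof -
  have [measurable]: "\<phi> \<in> borel_measurable borel"
    using test_fun_continuous[OF \<phi>] by (rule borel_measurable_continuous_onI)
  have C: "0 \<le> C" using FC[of 0] R by (auto intro: order_trans[OF abs_ge_zero])
  have C': "0 \<le> C'" using Fb[of 0] by (auto intro: order_trans[OF abs_ge_zero])
  have i: "integrable lborel (\<lambda>t. F t * \<phi> (t + y))" for y
  proof (rule integrable_compact_support[where R="R + \<bar>y\<bar>" and K="C' * K"])
    show "\<bar>F t * \<phi> (t + y)\<bar> \<le> C' * K" for t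
      unfolding abs_mult using Fb K C' by (intro mult_mono) auto
  qed (use R in auto)
  then show "integrable lborel (\<lambda>t. F t * \<phi> (t + y))" .
  have b: "\<bar>regular F (\<lambda>t. \<phi> (t + y)) - regular F \<phi>\<bar> \<le> C * (R * K) * min 1 y" if y: "0 < y" for y
  proof -
    have "regular F (\<lambda>t. \<phi> (t + y)) - regular F \<phi> = (LINT t|lborel. F t * (\<phi> (t + y) - \<phi> t))"
      unfolding regular_def using i[of y] i[of 0] by (simp add: right_diff_distrib)
    also have "\<bar>\<dots>\<bar> \<le> (LINT t|lborel. \<bar>F t * (\<phi> (t + y) - \<phi> t)\<bar>)"
      using integral_norm_bound[of lborel "\<lambda>t. F t * (\<phi> (t + y) - \<phi> t)"] by simp
    also have "\<dots> \<le> (LINT t|lborel. (C * (K * min 1 y)) * indicator {0..R} t)"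
    proof (rule integral_mono)
      show "integrable lborel (\<lambda>t. \<bar>F t * (\<phi> (t + y) - \<phi> t)\<bar>)"
        using Bochner_Integration.integrable_diff[OF i[of y] i[of 0]] by (simp add: right_diff_distrib)
      show "integrable lborel (\<lambda>t. (C * (K * min 1 y)) * indicator {0..R} t)"
        by (intro integrable_mult_right integrable_real_indicator) (auto simp: emeasure_lborel_Icc_eq)
      show "\<bar>F t * (\<phi> (t + y) - \<phi> t)\<bar> \<le> (C * (K * min 1 y)) * indicator {0..R} t" for t
      proof (cases "t \<in> {0..R}")
        case True
        then show ?thesis
          unfolding abs_mult using FC[of t] incr[OF y, of t] C by (auto intro!: mult_mono)
      next
        case False
        then have "F t * (\<phi> (t + y) - \<phi> t) = 0" using F0[of t] R(2)[of t] R(2)[of "t + y"] y by auto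
        then show ?thesis using False by (auto simp: indicator_def)
      qed
    qed
    also have "\<dots> = C * (R * K) * min 1 y" using R(1) by simp
    finally show ?thesis .
  qed
  then show "0 < y \<Longrightarrow> \<bar>regular F (\<lambda>t. \<phi> (t + y)) - regular F \<phi>\<bar> \<le> C * (R * K) * min 1 y" .
  show "integrable \<nu> (\<lambda>y. regular F (\<lambda>t. \<phi> (t + y)) - regular F \<phi>)"
  proof (rule nu_integrable[where C="C * (R * K)"])
    show "(\<lambda>y. regular F (\<lambda>t. \<phi> (t + y)) - regular F \<phi>) \<in> borel_measurable borel"
      unfolding regular_def by measurable
  qed (use b in auto)
qed

text \<open>Away from \<open>s > 0\<close> the distribution function of \<open>X(s)\<close> is replaced by 0, since nothing is assumed
  about \<open>X\<close> at negative times.\<close>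

definition DD :: "real \<Rightarrow> real \<Rightarrow> real" where
  "DD t s = (if 0 < s then D t s else 0)"

lemma DD_measurable [measurable (raw)]:
  assumes "f \<in> borel_measurable N" "g \<in> borel_measurable N"
  shows "(\<lambda>x. DD (f x) (g x)) \<in> borel_measurable N"
  using measurable_compose[OF measurable_Pair[OF assms] D_measurable] by (simp add: DD_def)

lemma Q_measurable_raw [measurable (raw)]:
  assumes "f \<in> borel_measurable N" "g \<in> borel_measurable N"
  shows "(\<lambda>x. Q (f x) (g x)) \<in> borel_measurable N"
  using measurable_compose[OF measurable_Pair[OF assms] Q_measurable] by simp

lemma DD_bound: "0 \<le> DD t s" "DD t s \<le> 1" "DD t s \<le> exp t * (indicator {0..} s * exp (- (rate * s)))"
  using D_decay[of s t] by (auto simp: DD_def)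

lemma integral_Q_tail: "0 < s \<Longrightarrow> (LINT u|lborel. indicator {s..} u * Q t u) = DD t s"
proof -
  assume s: "0 < s"
  have "(\<integral>\<^sup>+ u. ennreal (indicator {s..} u * Q t u) \<partial>lborel) = ennreal (D t s)"
    unfolding nn_integral_Q_tail[OF s, symmetric] by (intro nn_integral_cong) (auto simp: indicator_def)
  then have "(LINT u|lborel. indicator {s..} u * Q t u) = enn2real (ennreal (D t s))"
    using Q_nonneg by (subst integral_eq_nn_integral) auto
  then show ?thesis using s by (simp add: DD_def)
qed

text \<open>The weight with which the semigroup at time \<open>u\<close> enters an average tested
  against \<open>\<psi>\<close>. The point \<open>t = 0\<close> is left out because the total mass
  of \<open>Q t\<close> is known for \<open>t > 0\<close>.\<close>

definition Qtest :: "(real \<Rightarrow> real) \<Rightarrow> real \<Rightarrow> real" where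
  "Qtest \<psi> u = (LINT t|lborel. indicator {0<..} t * \<psi> t * Q t u)"

lemma Qtest_pair_integrable:
  assumes \<psi>: "integrable lborel \<psi>"
  shows "integrable (lborel \<Otimes>\<^sub>M lborel) (\<lambda>(t, u). indicator {0<..} t * \<psi> t * Q t u)"
    and "integrable lborel (Qtest \<psi>)"
proof -
  have [measurable]: "\<psi> \<in> borel_measurable borel" using borel_measurable_integrable[OF \<psi>] by simp
  show 1: "integrable (lborel \<Otimes>\<^sub>M lborel) (\<lambda>(t, u). indicator {0<..} t * \<psi> t * Q t u)"
  proof (rule lborel_pair.Fubini_integrable)
    show "(\<lambda>(t, u). indicator {0<..} t * \<psi> t * Q t u) \<in> borel_measurable (lborel \<Otimes>\<^sub>M lborel)"
      by measurable
    have e: "(LINT u|lborel. norm (indicator {0<..} t * \<psi> t * Q t u)) = indicator {0<..} t * \<bar>\<psi> t\<bar>" for t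
      using integral_Q[of t] Q_nonneg by (cases "0 < t") (auto simp: abs_mult)
    have "integrable lborel (\<lambda>t. indicator {0<..} t * \<bar>\<psi> t\<bar>)"
      by (rule Bochner_Integration.integrable_bound[OF \<psi>]) (auto simp: indicator_def)
    then show "integrable lborel (\<lambda>t. LINT u|lborel. norm (case (t, u) of (t, u) \<Rightarrow> indicator {0<..} t * \<psi> t * Q t u))"
      unfolding split_conv e .
    show "AE t in lborel. integrable lborel (\<lambda>u. case (t, u) of (t, u) \<Rightarrow> indicator {0<..} t * \<psi> t * Q t u)"
    proof (rule AE_I2)
      show "integrable lborel (\<lambda>u. case (t, u) of (t, u) \<Rightarrow> indicator {0<..} t * \<psi> t * Q t u)" for t
        using integrable_Q[of t] by (cases "0 < t") auto
    qed
  qed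
  from lborel_pair.integrable_snd[OF 1] show "integrable lborel (Qtest \<psi>)"
    by (simp add: Qtest_def[abs_def])
qed

end

section \<open>Averages expressed by the semigroup and Q\<close>

locale time_change = stable_subordinator M X \<nu> a \<epsilon> \<beta> + feller K
  for M :: "'w measure" and X and \<nu> and a \<epsilon> \<beta> and K :: "real \<Rightarrow> 'a::euclidean_space \<Rightarrow> 'a measure"
begin

text \<open>The average without reference to the process \<open>Y\<close>; for
  \<open>t \<noteq> 0\<close> it agrees with \<open>average\<close>, as shown once \<open>Y\<close>
  is available.\<close>

definition avg :: "('a \<Rightarrow> real) \<Rightarrow> 'a \<Rightarrow> real \<Rightarrow> real" where
  "avg f x t = (if 0 < t then mixed (Q t) f x else 0)"

lemma kernel_measurable_raw [measurable (raw)]: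
  assumes "f \<in> C_inf" "g \<in> borel_measurable N"
  shows "(\<lambda>z. kernel_op K (max 0 (g z)) f x) \<in> borel_measurable N"
  using measurable_compose[OF assms(2) kernel_op_measurable_time[OF assms(1)]] .

lemma avg_measurable: "f \<in> C_inf \<Longrightarrow> avg f x \<in> borel_measurable borel"
  unfolding avg_def mixed_def by measurable

lemma avg_bound:
  assumes "f \<in> C_inf" "\<And>z. \<bar>f z\<bar> \<le> B"
  shows "\<bar>avg f x t\<bar> \<le> B"
proof (cases "0 < t")
  case True
  then show ?thesis
    using mixed_bound[OF assms(1) integrable_Q[OF True] assms(2), of x] integral_Q[OF True] Q_nonneg
    by (simp add: avg_def)
qed (use assms(2)[of x] in \<open>simp add: avg_def\<close>)

text \<open>After testing in time the average is again a mixture with an integrable weight, so that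
  \<open>mixed_generator\<close> applies to it as well.\<close>

lemma regular_avg:
  assumes f: "f \<in> C_inf" and \<psi>: "integrable lborel \<psi>"
  shows "regular (avg f x) \<psi> = mixed (Qtest \<psi>) f x"
proof -
  obtain B where B: "0 < B" "\<And>z. \<bar>f z\<bar> \<le> B" using C_inf_bounded[OF f] by blast
  have b: "\<bar>kernel_op K (max 0 u) f x\<bar> \<le> B" for u
    by (rule kernel_op_bound) (use B C_inf_measurable[OF f] in auto)
  have [measurable]: "\<psi> \<in> borel_measurable borel" using borel_measurable_integrable[OF \<psi>] by simp
  note f[measurable]
  let ?J = "\<lambda>t u. kernel_op K (max 0 u) f x * (indicator {0<..} t * \<psi> t * Q t u)"
  have 1: "integrable (lborel \<Otimes>\<^sub>M lborel) (\<lambda>(t, u). ?J t u)"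
  proof (rule Bochner_Integration.integrable_bound)
    show "integrable (lborel \<Otimes>\<^sub>M lborel) (\<lambda>p. B * (\<lambda>(t, u). indicator {0<..} t * \<psi> t * Q t u) p)"
      using Qtest_pair_integrable(1)[OF \<psi>] by (rule integrable_mult_right)
    have "\<bar>?J t u\<bar> \<le> B * \<bar>indicator {0<..} t * \<psi> t * Q t u\<bar>" for t u
      unfolding abs_mult[of "kernel_op K (max 0 u) f x"] by (rule mult_right_mono[OF b]) simp
    then show "AE p in lborel \<Otimes>\<^sub>M lborel. norm (case p of (t, u) \<Rightarrow> ?J t u) \<le> norm (B * (\<lambda>(t, u). indicator {0<..} t * \<psi> t * Q t u) p)"
      using B(1) by (intro AE_I2) (auto simp: abs_mult[of B])
  qed measurable
  have "regular (avg f x) \<psi> = (LINT t|lborel. LINT u|lborel. ?J t u)"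
    unfolding regular_def
  proof (rule Bochner_Integration.integral_cong)
    fix t
    have "(LINT u|lborel. ?J t u) = (LINT u|lborel. (kernel_op K (max 0 u) f x * Q t u) * (indicator {0<..} t * \<psi> t))"
      by (rule Bochner_Integration.integral_cong) (auto simp: ac_simps)
    also have "\<dots> = mixed (Q t) f x * (indicator {0<..} t * \<psi> t)" by (simp add: mixed_def)
    finally show "avg f x t * \<psi> t = (LINT u|lborel. ?J t u)" by (simp add: avg_def)
  qed simp
  also have "\<dots> = (LINT u|lborel. LINT t|lborel. ?J t u)"
    by (rule lborel_pair.Fubini_integral[symmetric, OF 1])
  also have "\<dots> = mixed (Qtest \<psi>) f x" by (simp add: mixed_def Qtest_def)
  finally show ?thesis .
qed

lemma avg_decomposition:
  assumes fg: "has_generator_value K f g" and t: "0 < t"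
  shows "avg f x t = f x + (LINT s|lborel. kernel_op K (max 0 s) g x * DD t s)"
proof -
  have f: "f \<in> C_inf" and g: "g \<in> C_inf" using fg by (auto simp: has_generator_value_def)
  obtain B where B: "0 < B" "\<And>z. \<bar>g z\<bar> \<le> B" using C_inf_bounded[OF g] by blast
  have b: "\<bar>kernel_op K (max 0 u) g x\<bar> \<le> B" for u
    by (rule kernel_op_bound) (use B C_inf_measurable[OF g] in auto)
  note g[measurable]
  \<comment> \<open>The indicators describe the triangle \<open>0 \<le> s \<le> u\<close>:
    integration over \<open>u\<close> produces the tail of \<open>Q t\<close>, which is
    \<open>D\<close>, and integration over \<open>s\<close> produces Dynkin's formula.\<close>
  let ?J = "\<lambda>s u. kernel_op K (max 0 s) g x * (indicator {0..} s * (indicator {s..} u * Q t u))"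
  \<comment> \<open>The decay of \<open>D\<close> extends to \<open>s = 0\<close>, where the tail is
    the total mass 1, at most \<open>exp t\<close>.\<close>
  have tail: "(LINT u|lborel. indicator {s..} u * Q t u) \<le> exp t * exp (- (rate * s))" if "0 \<le> s" for s
  proof (cases "s = 0")
    case True
    have "(LINT u|lborel. indicator {s..} u * Q t u) = (LINT u|lborel. Q t u)"
      by (rule Bochner_Integration.integral_cong) (auto simp: True indicator_def Q_def)
    then show ?thesis using integral_Q[OF t] t True by simp
  next
    case False
    then show ?thesis using integral_Q_tail[of s t] DD_bound(3)[of t s] that by simp
  qed
  have iQ: "integrable lborel (\<lambda>u. indicator {s..} u * Q t u)" for s
    by (rule Bochner_Integration.integrable_bound[OF integrable_Q[OF t]]) (auto simp: indicator_def)
  have 1: "integrable (lborel \<Otimes>\<^sub>M lborel) (\<lambda>(s, u). ?J s u)"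
  proof (rule lborel_pair.Fubini_integrable)
    show m: "(\<lambda>(s, u). ?J s u) \<in> borel_measurable (lborel \<Otimes>\<^sub>M lborel)"
    proof -
      have "(\<lambda>(s, u). kernel_op K (max 0 s) g x * (indicator {0..} s * (of_bool (s \<le> u) * Q t u))) \<in> borel_measurable (lborel \<Otimes>\<^sub>M lborel)"
        by measurable
      then show ?thesis by (simp add: indicator_def)
    qed
    show "AE s in lborel. integrable lborel (\<lambda>u. case (s, u) of (s, u) \<Rightarrow> ?J s u)"
      using iQ by auto
    have e: "(LINT u|lborel. norm (?J s u)) = \<bar>kernel_op K (max 0 s) g x\<bar> * (indicator {0..} s * (LINT u|lborel. indicator {s..} u * Q t u))" for s
      using Q_nonneg by (simp add: abs_mult)
    show "integrable lborel (\<lambda>s. LINT u|lborel. norm (case (s, u) of (s, u) \<Rightarrow> ?J s u))"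
    proof (rule Bochner_Integration.integrable_bound)
      show "integrable lborel (\<lambda>s. B * exp t * (indicator {0..} s * exp (- (rate * s))))"
        using integrable_exp_decay[OF rate_pos] by (rule integrable_mult_right)
      show "(\<lambda>s. LINT u|lborel. norm (case (s, u) of (s, u) \<Rightarrow> ?J s u)) \<in> borel_measurable lborel"
        using m by measurable
      have "\<bar>kernel_op K (max 0 s) g x\<bar> * (indicator {0..} s * (LINT u|lborel. indicator {s..} u * Q t u))
          \<le> B * (exp t * (indicator {0..} s * exp (- (rate * s))))" for s
      proof (rule mult_mono[OF b])
        show "indicator {0..} s * (LINT u|lborel. indicator {s..} u * Q t u) \<le> exp t * (indicator {0..} s * exp (- (rate * s)))"
          using tail[of s] by (simp add: indicator_def)
        show "0 \<le> indicator {0..} s * (LINT u|lborel. indicator {s..} u * Q t u)"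
          using Q_nonneg by (intro mult_nonneg_nonneg integral_nonneg_AE) auto
      qed (use B in simp)
      moreover have "0 \<le> \<bar>kernel_op K (max 0 s) g x\<bar> * (indicator {0..} s * (LINT u|lborel. indicator {s..} u * Q t u))" for s
        using Q_nonneg by (intro mult_nonneg_nonneg integral_nonneg_AE) auto
      ultimately show "AE s in lborel. norm (LINT u|lborel. norm (case (s, u) of (s, u) \<Rightarrow> ?J s u)) \<le> norm (B * exp t * (indicator {0..} s * exp (- (rate * s))))"
        unfolding split_conv e by (intro AE_I2) (auto simp: mult.assoc intro: order_trans[OF _ abs_ge_self])
    qed
  qed
  have inner: "(LINT s|lborel. ?J s u) = (kernel_op K (max 0 u) f x - f x) * Q t u" for u
  proof (cases "0 < u")
    case True
    have "(LINT s|lborel. ?J s u) = (LINT s|lborel. (indicator {0..u} s * kernel_op K (max 0 s) g x) * Q t u)"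
      by (rule Bochner_Integration.integral_cong) (auto simp: indicator_def)
    then show ?thesis using kernel_op_FTC(1)[OF fg True, of x] True by simp
  qed (simp add: Q_def)
  have iT: "integrable lborel (\<lambda>u. kernel_op K (max 0 u) f x * Q t u)"
    by (rule mixed_integrable[OF f integrable_Q[OF t]])
  have "(LINT s|lborel. kernel_op K (max 0 s) g x * DD t s) = (LINT s|lborel. LINT u|lborel. ?J s u)"
  \<comment> \<open>At \<open>s = 0\<close> the function \<open>DD\<close> is 0 by definition while
    the tail of \<open>Q t\<close> is 1.\<close>
  proof (rule integral_discrete_difference[where X="{0}"])
    fix s :: real assume "s \<notin> {0}"
    then have "s < 0 \<or> 0 < s" by auto
    then show "kernel_op K (max 0 s) g x * DD t s = (LINT u|lborel. ?J s u)"
    proof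
      assume "0 < s"
      then show ?thesis using integral_Q_tail[of s t] by simp
    qed (simp add: DD_def)
  qed auto
  also have "\<dots> = (LINT u|lborel. LINT s|lborel. ?J s u)"
    by (rule lborel_pair.Fubini_integral[symmetric, OF 1])
  also have "\<dots> = (LINT u|lborel. kernel_op K (max 0 u) f x * Q t u - f x * Q t u)"
    unfolding inner by (simp add: left_diff_distrib)
  also have "\<dots> = avg f x t - f x"
    using iT integrable_Q[OF t] integral_Q[OF t] t by (simp add: avg_def mixed_def)
  finally show ?thesis by simp
qed

text \<open>\<open>split\<close> inserts the decomposition of the average into a functional of time,
  and \<open>nu_part\<close> takes the jump part of \<open>A_star\<close> inside the integral over
  \<open>s\<close>. For each \<open>s > 0\<close> the key identity then identifies
  \<open>A_star\<close> of \<open>D\<close>, and the resulting integral over \<open>s\<close> is the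
  tested average of \<open>g\<close>.\<close>

lemma A_star_avg:
  assumes fg: "has_generator_value K f g" and \<phi>: "\<phi> \<in> test_fun"
  shows "integrable \<nu> (\<lambda>y. regular (avg f x) (\<lambda>t. \<phi> (t + y)) - regular (avg f x) \<phi>)"
    and "A_star \<nu> a (regular (avg f x)) \<phi> = - regular (avg g x) \<phi> + f x * A_star \<nu> a (regular theta) \<phi>"
proof -
  have f: "f \<in> C_inf" and g: "g \<in> C_inf" using fg by (auto simp: has_generator_value_def)
  obtain B where B: "0 < B" "\<And>z. \<bar>f z\<bar> \<le> B" using C_inf_bounded[OF f] by blast
  obtain B' where B': "0 < B'" "\<And>z. \<bar>g z\<bar> \<le> B'" using C_inf_bounded[OF g] by blast
  obtain R C where RC: "0 < R" "0 < C" "\<And>t. R < \<bar>t\<bar> \<Longrightarrow> \<phi> t = 0" "\<And>t. \<bar>\<phi> t\<bar> \<le> C"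
    "\<And>t y. 0 < y \<Longrightarrow> \<bar>\<phi> (t + y) - \<phi> t\<bar> \<le> C * min 1 y"
    using test_fun_increment_bound[OF \<phi>] by metis
  obtain R' C' where RC': "0 < R'" "0 < C'" "\<And>t. R' < \<bar>t\<bar> \<Longrightarrow> deriv \<phi> t = 0" "\<And>t. \<bar>deriv \<phi> t\<bar> \<le> C'"
    using test_fun_increment_bound[OF test_fun_deriv[OF \<phi>]] by metis
  have [measurable]: "\<phi> \<in> borel_measurable borel" "deriv \<phi> \<in> borel_measurable borel"
    using test_fun_continuous[OF \<phi>] test_fun_continuous[OF test_fun_deriv[OF \<phi>]]
    by (auto intro: borel_measurable_continuous_onI)
  note g[measurable]
  define k where "k s = kernel_op K (max 0 s) g x" for s
  have [measurable]: "k \<in> borel_measurable borel" unfolding k_def by measurable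
  have kb: "\<bar>k s\<bar> \<le> B'" for s
    unfolding k_def by (rule kernel_op_bound) (use B' C_inf_measurable[OF g] in auto)
  have iphi: "integrable lborel (\<lambda>t. \<phi> (t + y))" for y
    by (rule integrable_compact_support[where R="R + \<bar>y\<bar>" and K=C]) (use RC in auto)
  have idphi: "integrable lborel (deriv \<phi>)"
    by (rule integrable_compact_support[where R=R' and K=C']) (use RC' in auto)
  \<comment> \<open>The common majorant in \<open>s\<close>: on the support of a function supported
    in \<open>{-R..R}\<close>, \<open>DD t s\<close> is at most \<open>exp R * E s\<close>.\<close>
  define E where "E s = indicator {0..} s * exp (- (rate * s))" for s
  have iE: "integrable lborel E" unfolding E_def[abs_def] by (rule integrable_exp_decay[OF rate_pos])
  have E0: "0 \<le> E s" for s by (simp add: E_def)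
  note DDb = DD_bound[folded E_def]
  note reg_avg = regular_increment[where F="avg f x" and C=B and C'=B, OF avg_measurable[OF f] _ avg_bound[OF f B(2)] avg_bound[OF f B(2)] \<phi> RC(1,3,2,4,5)]
  show int_avg: "integrable \<nu> (\<lambda>y. regular (avg f x) (\<lambda>t. \<phi> (t + y)) - regular (avg f x) \<phi>)"
    by (rule reg_avg(3)) (auto simp: avg_def)
  have theta_meas: "theta \<in> borel_measurable borel" unfolding theta_def by measurable
  note reg_theta = regular_increment[where F=theta and C=1 and C'=1, OF theta_meas _ _ _ \<phi> RC(1,3,2,4,5)]
  have int_theta: "integrable \<nu> (\<lambda>y. regular theta (\<lambda>t. \<phi> (t + y)) - regular theta \<phi>)"
    by (rule reg_theta(3)) (auto simp: theta_def)
  define Rs where "Rs s \<psi> = regular (\<lambda>t. DD t s) \<psi>" for s \<psi>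
  \<comment> \<open>Stated for a general \<open>\<psi>\<close> of bounded support because it is
    needed for \<open>\<phi>\<close>, all its translates and \<open>deriv \<phi>\<close>.\<close>
  have split: "regular (avg f x) \<psi> = f x * regular theta \<psi> + (LINT s|lborel. k s * Rs s \<psi>)"
    and split_int: "integrable lborel (\<lambda>s. k s * Rs s \<psi>)"
    if \<psi>: "integrable lborel \<psi>" "\<And>t. R'' < \<bar>t\<bar> \<Longrightarrow> \<psi> t = 0" for \<psi> R''
  proof -
    have [measurable]: "\<psi> \<in> borel_measurable borel" using borel_measurable_integrable[OF \<psi>(1)] by simp
    have 1: "integrable (lborel \<Otimes>\<^sub>M lborel) (\<lambda>(t, s). k s * (DD t s * \<psi> t))"
    proof (rule lborel_pair.integrable_product_bound[where a="\<lambda>t. exp R'' * \<psi> t" and b="\<lambda>s. B' * E s"])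
      show "integrable lborel (\<lambda>t. exp R'' * \<psi> t)" "integrable lborel (\<lambda>s. B' * E s)" using \<psi> iE by auto
      have "\<bar>k s * (DD t s * \<psi> t)\<bar> \<le> \<bar>exp R'' * \<psi> t\<bar> * \<bar>B' * E s\<bar>" for t s
      proof (cases "R'' < \<bar>t\<bar>")
        case False
        have "exp t * E s \<le> exp R'' * E s"
          using False E0[of s] by (intro mult_right_mono) auto
        then have "DD t s \<le> exp R'' * E s"
          using DDb(3)[of t s] by simp
        then have "\<bar>k s\<bar> * (DD t s * \<bar>\<psi> t\<bar>) \<le> B' * ((exp R'' * E s) * \<bar>\<psi> t\<bar>)"
          using kb DDb(1)[of t s] B' by (intro mult_mono) (auto intro: mult_right_mono mult_nonneg_nonneg)
        then show ?thesis using DDb(1)[of t s] B' E0[of s] by (simp add: abs_mult ac_simps)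
      qed (use \<psi>(2) in simp)
      then show "AE t in lborel. \<forall>s\<in>space lborel. \<bar>case (t, s) of (t, s) \<Rightarrow> k s * (DD t s * \<psi> t)\<bar> \<le> \<bar>exp R'' * \<psi> t\<bar> * \<bar>B' * E s\<bar>"
        by auto
    qed measurable
    have itheta: "integrable lborel (\<lambda>t. theta t * \<psi> t)"
      by (rule Bochner_Integration.integrable_bound[OF \<psi>(1)]) (use theta_meas in \<open>auto simp: theta_def indicator_def\<close>)
    have i2: "integrable lborel (\<lambda>t. LINT s|lborel. k s * (DD t s * \<psi> t))"
      using lborel_pair.integrable_fst'[OF 1] by simp
    show "integrable lborel (\<lambda>s. k s * Rs s \<psi>)"
      using lborel_pair.integrable_snd[OF 1] by (simp add: Rs_def regular_def)
    have "regular (avg f x) \<psi> = (LINT t|lborel. f x * (theta t * \<psi> t) + (LINT s|lborel. k s * (DD t s * \<psi> t)))"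
      unfolding regular_def
    proof (rule integral_discrete_difference[where X="{0}"])
      fix t :: real assume "t \<notin> {0}"
      have e: "(LINT s|lborel. k s * (DD t s * \<psi> t)) = (LINT s|lborel. k s * DD t s) * \<psi> t"
        unfolding mult.assoc[symmetric] by simp
      show "avg f x t * \<psi> t = f x * (theta t * \<psi> t) + (LINT s|lborel. k s * (DD t s * \<psi> t))"
      proof (cases "0 < t")
        case True
        then show ?thesis unfolding e avg_decomposition[OF fg True] k_def
          by (simp add: theta_def algebra_simps)
      next
        case False
        then have "DD t s = 0" for s using \<open>t \<notin> {0}\<close> D_negative[of s t] by (simp add: DD_def)
        then show ?thesis using False by (simp add: avg_def theta_def)
      qed
    qed auto
    also have "\<dots> = f x * regular theta \<psi> + (LINT t|lborel. LINT s|lborel. k s * (DD t s * \<psi> t))"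
      using itheta i2 by (simp add: regular_def)
    also have "(LINT t|lborel. LINT s|lborel. k s * (DD t s * \<psi> t)) = (LINT s|lborel. LINT t|lborel. k s * (DD t s * \<psi> t))"
      by (rule lborel_pair.Fubini_integral[symmetric, OF 1])
    finally show "regular (avg f x) \<psi> = f x * regular theta \<psi> + (LINT s|lborel. k s * Rs s \<psi>)"
      by (simp add: Rs_def regular_def)
  qed
  have sp_y: "regular (avg f x) (\<lambda>t. \<phi> (t + y)) = f x * regular theta (\<lambda>t. \<phi> (t + y)) + (LINT s|lborel. k s * Rs s (\<lambda>t. \<phi> (t + y)))"
    "integrable lborel (\<lambda>s. k s * Rs s (\<lambda>t. \<phi> (t + y)))" for y
  proof -
    have "\<phi> (t + y) = 0" if "R + \<bar>y\<bar> < \<bar>t\<bar>" for t using RC(3)[of "t + y"] that by linarith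
    note supp_y = this
    show "regular (avg f x) (\<lambda>t. \<phi> (t + y)) = f x * regular theta (\<lambda>t. \<phi> (t + y)) + (LINT s|lborel. k s * Rs s (\<lambda>t. \<phi> (t + y)))"
      by (rule split[OF iphi supp_y])
    show "integrable lborel (\<lambda>s. k s * Rs s (\<lambda>t. \<phi> (t + y)))"
      by (rule split_int[OF iphi supp_y])
  qed
  note sp = sp_y[of 0, simplified]
  have sp_d: "regular (avg f x) (deriv \<phi>) = f x * regular theta (deriv \<phi>) + (LINT s|lborel. k s * Rs s (deriv \<phi>))"
    "integrable lborel (\<lambda>s. k s * Rs s (deriv \<phi>))"
    by (rule split[OF idphi RC'(3)], assumption) (rule split_int[OF idphi RC'(3)], assumption)
  interpret P: pair_sigma_finite \<nu> lborel ..
  \<comment> \<open>With the local bound \<open>exp R * E s\<close> the increment is dominated by a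
    function of \<open>s\<close> times one of \<open>y\<close>, each integrable; this justifies
    exchanging \<open>\<nu>\<close> with the integral over \<open>s\<close>.\<close>
  have Rs_incr: "\<bar>Rs s (\<lambda>t. \<phi> (t + y)) - Rs s \<phi>\<bar> \<le> (exp R * E s) * (R * C) * min 1 y" if "0 < y" for s y
    unfolding Rs_def
  proof (rule regular_increment(2)[where C'=1, OF _ _ _ _ \<phi> RC(1,3,2,4,5) that])
    show "\<bar>DD t s\<bar> \<le> exp R * E s" if "\<bar>t\<bar> \<le> R" for t
    proof -
      have "exp t * E s \<le> exp R * E s" using that E0[of s] by (intro mult_right_mono) auto
      then show ?thesis using DDb[of t s] by simp
    qed
    show "DD t s = 0" if "t < 0" for t using that by (simp add: DD_def D_negative)
  qed (use DDb in auto)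
  have 2: "integrable (\<nu> \<Otimes>\<^sub>M lborel) (\<lambda>(y, s). k s * (Rs s (\<lambda>t. \<phi> (t + y)) - Rs s \<phi>))"
  proof (rule P.integrable_product_bound[where a="\<lambda>y. R * C * min 1 y" and b="\<lambda>s. B' * exp R * E s"])
    show "(\<lambda>(y, s). k s * (Rs s (\<lambda>t. \<phi> (t + y)) - Rs s \<phi>)) \<in> borel_measurable (\<nu> \<Otimes>\<^sub>M lborel)"
      unfolding Rs_def regular_def by measurable
    show "integrable \<nu> (\<lambda>y. R * C * min 1 y)" using nu_min_integrable by simp
    show "integrable lborel (\<lambda>s. B' * exp R * E s)" using iE by simp
    show "AE y in \<nu>. \<forall>s\<in>space lborel. \<bar>case (y, s) of (y, s) \<Rightarrow> k s * (Rs s (\<lambda>t. \<phi> (t + y)) - Rs s \<phi>)\<bar> \<le> \<bar>R * C * min 1 y\<bar> * \<bar>B' * exp R * E s\<bar>"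
      using nu_pos
    proof eventually_elim
      case (elim y)
      have "\<bar>k s\<bar> * \<bar>Rs s (\<lambda>t. \<phi> (t + y)) - Rs s \<phi>\<bar> \<le> B' * ((exp R * E s) * (R * C) * min 1 y)" for s
        using kb Rs_incr[OF elim] B' by (intro mult_mono) auto
      moreover have "\<bar>R * C * min 1 y\<bar> * \<bar>B' * exp R * E s\<bar> = B' * ((exp R * E s) * (R * C) * min 1 y)" for s
        using RC(1,2) B' E0[of s] elim by (simp add: abs_mult)
      ultimately have "\<bar>k s * (Rs s (\<lambda>t. \<phi> (t + y)) - Rs s \<phi>)\<bar> \<le> \<bar>R * C * min 1 y\<bar> * \<bar>B' * exp R * E s\<bar>" for s
        by (simp only: abs_mult[of "k s"])
      then show ?case unfolding split_conv by blast
    qed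
  qed
  have nu_part: "(LINT y|\<nu>. regular (avg f x) (\<lambda>t. \<phi> (t + y)) - regular (avg f x) \<phi>)
      = f x * (LINT y|\<nu>. regular theta (\<lambda>t. \<phi> (t + y)) - regular theta \<phi>)
        + (LINT s|lborel. k s * (LINT y|\<nu>. Rs s (\<lambda>t. \<phi> (t + y)) - Rs s \<phi>))"
  proof -
    have "regular (avg f x) (\<lambda>t. \<phi> (t + y)) - regular (avg f x) \<phi>
        = f x * (regular theta (\<lambda>t. \<phi> (t + y)) - regular theta \<phi>) + (LINT s|lborel. k s * (Rs s (\<lambda>t. \<phi> (t + y)) - Rs s \<phi>))" for y
      using sp(2) sp_y(2)[of y] unfolding sp(1) sp_y(1) by (simp add: right_diff_distrib)
    then have "(LINT y|\<nu>. regular (avg f x) (\<lambda>t. \<phi> (t + y)) - regular (avg f x) \<phi>)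
      = f x * (LINT y|\<nu>. regular theta (\<lambda>t. \<phi> (t + y)) - regular theta \<phi>)
        + (LINT y|\<nu>. LINT s|lborel. k s * (Rs s (\<lambda>t. \<phi> (t + y)) - Rs s \<phi>))"
      using int_theta P.integrable_fst'[OF 2] by simp
    also have "(LINT y|\<nu>. LINT s|lborel. k s * (Rs s (\<lambda>t. \<phi> (t + y)) - Rs s \<phi>))
        = (LINT s|lborel. LINT y|\<nu>. k s * (Rs s (\<lambda>t. \<phi> (t + y)) - Rs s \<phi>))"
      by (rule P.Fubini_integral[symmetric, OF 2])
    finally show ?thesis by simp
  qed
  have i3: "integrable lborel (\<lambda>s. k s * (LINT y|\<nu>. Rs s (\<lambda>t. \<phi> (t + y)) - Rs s \<phi>))"
    using P.integrable_snd[OF 2] by simp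
  have "A_star \<nu> a (regular (avg f x)) \<phi>
      = f x * A_star \<nu> a (regular theta) \<phi>
        + ((LINT s|lborel. k s * (LINT y|\<nu>. Rs s (\<lambda>t. \<phi> (t + y)) - Rs s \<phi>)) + a * (LINT s|lborel. k s * Rs s (deriv \<phi>)))"
    unfolding A_star_def gderiv_def nu_part sp_d(1) by (simp add: algebra_simps)
  also have "(LINT s|lborel. k s * (LINT y|\<nu>. Rs s (\<lambda>t. \<phi> (t + y)) - Rs s \<phi>)) + a * (LINT s|lborel. k s * Rs s (deriv \<phi>))
      = (LINT s|lborel. k s * (LINT y|\<nu>. Rs s (\<lambda>t. \<phi> (t + y)) - Rs s \<phi>) + a * (k s * Rs s (deriv \<phi>)))"
    using i3 sp_d(2) by simp
  also have "\<dots> = (LINT s|lborel. k s * (- Qtest \<phi> s))"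
  proof (rule Bochner_Integration.integral_cong)
    fix s :: real
    show "k s * (LINT y|\<nu>. Rs s (\<lambda>t. \<phi> (t + y)) - Rs s \<phi>) + a * (k s * Rs s (deriv \<phi>)) = k s * (- Qtest \<phi> s)"
    proof (cases "0 < s")
      case True
      \<comment> \<open>The integrals differ at most on the null set \<open>t = 0\<close>, since
        \<open>Q\<close> vanishes for \<open>t < 0\<close>.\<close>
      have "Qtest \<phi> s = (LINT t|lborel. \<phi> t * Q t s)"
        unfolding Qtest_def
        by (rule integral_discrete_difference[where X="{0}"]) (auto simp: indicator_def Q_def)
      also have "\<dots> = - A_star \<nu> a (Rs s) \<phi>"
        using integral_test_Q[OF \<phi> True] True by (simp add: Rs_def[abs_def] DD_def)
      finally have q: "Qtest \<phi> s = - ((LINT y|\<nu>. Rs s (\<lambda>t. \<phi> (t + y)) - Rs s \<phi>) + a * Rs s (deriv \<phi>))"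
        by (simp add: A_star_def gderiv_def)
      show ?thesis unfolding q by (simp add: algebra_simps)
    next
      case False
      then show ?thesis by (simp add: Rs_def DD_def Q_def Qtest_def regular_def)
    qed
  qed simp
  also have "\<dots> = - mixed (Qtest \<phi>) g x" by (simp add: mixed_def k_def)
  also have "mixed (Qtest \<phi>) g x = regular (avg g x) \<phi>"
    by (rule regular_avg[OF g iphi[of 0, simplified], symmetric])
  finally show "A_star \<nu> a (regular (avg f x)) \<phi> = - regular (avg g x) \<phi> + f x * A_star \<nu> a (regular theta) \<phi>"
    by simp
qed

end

section \<open>Smoothness of parameter integrals\<close>

lemma onorm_linear_le:
  fixes L :: "'w::euclidean_space \<Rightarrow> real"
  assumes "linear L"
  shows "onorm L \<le> (\<Sum>b\<in>Basis. \<bar>L b\<bar>)"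
  using onorm_componentwise[of L] assms by (simp add: linear_conv_bounded_linear)

text \<open>Domination of the partial derivatives suffices, since the operator norm of a functional
  is at most the sum of its absolute values on the basis; the neighbourhoods for the finitely many
  basis vectors are intersected.\<close>

lemma integral_dominated_partial:
  fixes q :: "real \<Rightarrow> 'w::euclidean_space \<Rightarrow> real" and Q :: "real \<Rightarrow> real"
  assumes W: "open W" "z \<in> W"
    and sm: "\<And>u. 0 < u \<Longrightarrow> smooth_on UNIV (q u)"
    and meas: "\<And>bs w. set bs \<subseteq> Basis \<Longrightarrow> (\<lambda>u. indicator {0<..} u * (dpart bs (q u) w * Q u)) \<in> borel_measurable borel"
    and dom: "\<And>z bs. z \<in> W \<Longrightarrow> set bs \<subseteq> Basis \<Longrightarrow>
      \<exists>N m. open N \<and> z \<in> N \<and> set_integrable lborel {0<..} m \<and> (\<forall>u>0. \<forall>w\<in>N. \<bar>dpart bs (q u) w * Q u\<bar> \<le> m u)"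
  shows "(\<lambda>w. LINT u|lborel. indicator {0<..} u * (q u w * Q u)) differentiable at z"
    and "b \<in> Basis \<Longrightarrow> frechet_derivative (\<lambda>w. LINT u|lborel. indicator {0<..} u * (q u w * Q u)) (at z) b
      = (LINT u|lborel. indicator {0<..} u * (frechet_derivative (q u) (at z) b * Q u))"
proof -
  let ?D = "\<lambda>w u h. indicator {0<..} u * (frechet_derivative (q u) (at w) h * Q u) :: real"
  have "\<exists>N m. open N \<and> z \<in> N \<and> set_integrable lborel {0<..} m \<and> (\<forall>u>0. \<forall>w\<in>N. \<bar>frechet_derivative (q u) (at w) b * Q u\<bar> \<le> m u)"
    if "b \<in> Basis" for b
    using dom[OF W(2), of "[b]"] that by simp
  then obtain N m where Nm: "\<And>b. b \<in> Basis \<Longrightarrow> open (N b) \<and> z \<in> N b \<and> set_integrable lborel {0<..} (m b) \<and>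
      (\<forall>u>0. \<forall>w\<in>N b. \<bar>frechet_derivative (q u) (at w) b * Q u\<bar> \<le> m b u)"
    by metis
  obtain m0 where m0: "set_integrable lborel {0<..} m0" "\<And>u. 0 < u \<Longrightarrow> \<bar>q u z * Q u\<bar> \<le> m0 u"
    using dom[OF W(2), of "[]"] by auto
  have "open (\<Inter>b\<in>Basis. N b)" "z \<in> (\<Inter>b\<in>Basis. N b)"
    using Nm by (auto intro!: open_INT)
  then obtain r where r: "0 < r" "ball z r \<subseteq> (\<Inter>b\<in>Basis. N b)" using open_contains_ball by blast
  have dif: "(q u has_derivative frechet_derivative (q u) (at w)) (at w)" if "0 < u" for u w
    using smooth_on_imp_differentiable[OF sm[OF that], of w] frechet_derivative_works by auto
  have lin: "linear (frechet_derivative (q u) (at w))" if "0 < u" for u w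
    using dif[OF that] has_derivative_linear by blast
  have der: "((\<lambda>w. indicator {0<..} u * (q u w * Q u)) has_derivative ?D w u) (at w)" for w u
  proof (cases "0 < u")
    case True
    then show ?thesis
      by (intro has_derivative_mult_right has_derivative_mult_left dif)
  qed simp
  have mD: "(\<lambda>u. ?D z u h) \<in> borel_measurable lborel" for h
  proof -
    \<comment> \<open>Measurability in \<open>u\<close> is known along basis vectors; linearity
      extends it to all directions.\<close>
    have "?D z u h = (\<Sum>b\<in>Basis. (h \<bullet> b) * ?D z u b)" for u
    proof (cases "0 < u")
      case True
      have "frechet_derivative (q u) (at z) h = frechet_derivative (q u) (at z) (\<Sum>b\<in>Basis. (h \<bullet> b) *\<^sub>R b)"
        by (simp add: euclidean_representation)
      also have "\<dots> = (\<Sum>b\<in>Basis. (h \<bullet> b) * frechet_derivative (q u) (at z) b)"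
        using lin[OF True, of z] by (simp add: linear_sum linear_scale)
      finally show ?thesis using True by (simp add: sum_distrib_right mult.assoc)
    qed simp
    moreover have "(\<lambda>u. ?D z u b) \<in> borel_measurable lborel" if "b \<in> Basis" for b
      using meas[of "[b]" z] that by simp
    ultimately show ?thesis by simp
  qed
  have main: "((\<lambda>w. LINT u|lborel. indicator {0<..} u * (q u w * Q u)) has_derivative (\<lambda>h. LINT u|lborel. ?D z u h)) (at z)"
  proof (rule has_derivative_integral_dominated(1)[OF r(1), where D="?D" and m="\<lambda>u. \<Sum>b\<in>Basis. indicator {0<..} u * m b u"])
    show "(\<lambda>u. indicator {0<..} u * (q u w * Q u)) \<in> borel_measurable lborel" for w
      using meas[of "[]" w] by simp
    show "integrable lborel (\<lambda>u. indicator {0<..} u * (q u z * Q u))"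
    proof (rule Bochner_Integration.integrable_bound)
      show "integrable lborel (\<lambda>u. indicator {0<..} u * m0 u)" using m0(1) by (simp add: set_integrable_def)
      show "AE u in lborel. norm (indicator {0<..} u * (q u z * Q u)) \<le> norm (indicator {0<..} u * m0 u)"
        using m0(2) by (intro AE_I2) (auto simp: indicator_def intro: order_trans[OF _ abs_ge_self])
      show "(\<lambda>u. indicator {0<..} u * (q u z * Q u)) \<in> borel_measurable lborel" using meas[of "[]" z] by simp
    qed
    show "integrable lborel (\<lambda>u. \<Sum>b\<in>Basis. indicator {0<..} u * m b u)"
      using Nm by (intro Bochner_Integration.integrable_sum) (simp add: set_integrable_def)
    show "onorm (?D w u) \<le> (\<Sum>b\<in>Basis. indicator {0<..} u * m b u)" if w: "w \<in> ball z r" for w u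
    proof -
      have "onorm (?D w u) \<le> (\<Sum>b\<in>Basis. \<bar>?D w u b\<bar>)"
        by (rule onorm_linear_le[OF has_derivative_linear[OF der]])
      also have "\<dots> \<le> (\<Sum>b\<in>Basis. indicator {0<..} u * m b u)"
      proof (rule sum_mono)
        fix b :: 'w assume b: "b \<in> Basis"
        then have "w \<in> N b" using w r(2) by blast
        then show "\<bar>?D w u b\<bar> \<le> indicator {0<..} u * m b u"
          using Nm[OF b] by (auto simp: indicator_def)
      qed
      finally show ?thesis .
    qed
  qed (use der mD in auto)
  then show "(\<lambda>w. LINT u|lborel. indicator {0<..} u * (q u w * Q u)) differentiable at z"
    unfolding differentiable_def by blast
  show "frechet_derivative (\<lambda>w. LINT u|lborel. indicator {0<..} u * (q u w * Q u)) (at z) b = (LINT u|lborel. ?D z u b)"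
    using frechet_derivative_at[OF main, symmetric] by simp
qed

text \<open>The hypotheses concern all iterated partials, so they pass from \<open>q\<close> to each
  of its partial derivatives; the induction over the list of directions uses this and leaves
  \<open>q\<close> arbitrary.\<close>

lemma smooth_on_integral:
  fixes q :: "real \<Rightarrow> 'w::euclidean_space \<Rightarrow> real" and Q :: "real \<Rightarrow> real"
  assumes W: "open W"
    and sm: "\<And>u. 0 < u \<Longrightarrow> smooth_on UNIV (q u)"
    and meas: "\<And>bs w. set bs \<subseteq> Basis \<Longrightarrow> (\<lambda>u. indicator {0<..} u * (dpart bs (q u) w * Q u)) \<in> borel_measurable borel"
    and dom: "\<And>z bs. z \<in> W \<Longrightarrow> set bs \<subseteq> Basis \<Longrightarrow>
      \<exists>N m. open N \<and> z \<in> N \<and> set_integrable lborel {0<..} m \<and> (\<forall>u>0. \<forall>w\<in>N. \<bar>dpart bs (q u) w * Q u\<bar> \<le> m u)"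
  shows "smooth_on W (\<lambda>w. LINT u|lborel. indicator {0<..} u * (q u w * Q u))"
proof -
  let ?G = "\<lambda>q w. LINT u|lborel. indicator {0<..} u * (q u w * Q u)"
  have dif: "dpart bs (?G q) differentiable at z" if "set bs \<subseteq> Basis" "z \<in> W" for bs z
    using that sm meas dom
  proof (induction bs arbitrary: q z)
    case Nil
    show ?case
      unfolding dpart.simps
      by (rule integral_dominated_partial(1)[OF W Nil.prems(2)]) (fact Nil.prems)+
  next
    case (Cons b bs)
    then have b: "b \<in> Basis" and bs: "set bs \<subseteq> Basis" by auto
    define q' where "q' u x = frechet_derivative (q u) (at x) b" for u x
    have q': "dpart cs (q' u) = dpart (b # cs) (q u)" for cs u by (simp add: q'_def[abs_def])
    have IH: "dpart bs (?G q') differentiable at z"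
    proof (rule Cons.IH[OF bs Cons.prems(2)])
      show "smooth_on UNIV (q' u)" if "0 < u" for u
        using smooth_on_dpart[OF Cons.prems(3)[OF that], of "[b]"] b by (simp add: q'_def[abs_def])
      show "(\<lambda>u. indicator {0<..} u * (dpart cs (q' u) w * Q u)) \<in> borel_measurable borel" if "set cs \<subseteq> Basis" for cs w
        unfolding q' using Cons.prems(4)[of "b # cs" w] that b by simp
      show "\<exists>N m. open N \<and> z \<in> N \<and> set_integrable lborel {0<..} m \<and> (\<forall>u>0. \<forall>w\<in>N. \<bar>dpart cs (q' u) w * Q u\<bar> \<le> m u)"
        if "z \<in> W" "set cs \<subseteq> Basis" for z cs
        unfolding q' using Cons.prems(5)[of z "b # cs"] that b by simp
    qed
    have "frechet_derivative (?G q) (at x) b = ?G q' x" if "x \<in> W" for x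
      unfolding q'_def by (rule integral_dominated_partial(2)[OF W that _ _ _ b]) (fact Cons.prems)+
    then have eq: "dpart (b # bs) (?G q) x = dpart bs (?G q') x" if "x \<in> W" for x
      unfolding dpart.simps by (intro dpart_cong_open[OF W _ that]) auto
    from IH obtain D where "(dpart bs (?G q') has_derivative D) (at z)" unfolding differentiable_def by blast
    then have "(dpart (b # bs) (?G q) has_derivative D) (at z)"
      by (rule has_derivative_transform_within_open[OF _ W Cons.prems(2)]) (simp only: eq)
    then show ?case unfolding differentiable_def by blast
  qed
  then show ?thesis
    unfolding smooth_on_iff
    by (auto intro!: continuous_at_imp_continuous_on differentiable_imp_continuous_within)
qed

text \<open>The transition density is smooth jointly with time, whereas
  \<open>regular_region\<close> speaks of derivatives in space at fixed time; these are joint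
  derivatives along the vectors \<open>(0, b)\<close>.\<close>

lemma smooth_slice:
  fixes P :: "real \<times> 'w::euclidean_space \<Rightarrow> real"
  assumes P: "smooth_on {z. 0 < fst z} P" and u: "0 < u" and bs: "set bs \<subseteq> Basis"
  shows "dpart bs (\<lambda>w. P (u, w)) = (\<lambda>w. dpart (map (Pair 0) bs) P (u, w))"
    and "smooth_on {z. 0 < fst z} (dpart (map (Pair 0) bs) P)"
proof -
  have "set (map (Pair (0::real)) bs) \<subseteq> Basis" using bs by (auto simp: Basis_prod_def)
  then show "smooth_on {z. 0 < fst z} (dpart (map (Pair 0) bs) P)" by (rule smooth_on_dpart[OF P])
  show "dpart bs (\<lambda>w. P (u, w)) = (\<lambda>w. dpart (map (Pair 0) bs) P (u, w))"
    using P bs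
  proof (induction bs arbitrary: P)
    case (Cons b bs)
    have "frechet_derivative (\<lambda>w. P (u, w)) (at x) b = frechet_derivative P (at (u, x)) (0, b)" for x
    proof -
      have "(P has_derivative frechet_derivative P (at (u, x))) (at (u, x))"
        using smooth_on_imp_differentiable[OF Cons.prems(1), of "(u, x)"] u frechet_derivative_works by auto
      moreover have "((\<lambda>w. (u, w)) has_derivative (\<lambda>h. (0, h))) (at x)"
        by (auto intro!: derivative_eq_intros)
      ultimately have "((\<lambda>w. P (u, w)) has_derivative (\<lambda>h. frechet_derivative P (at (u, x)) (0, h))) (at x)"
        using has_derivative_compose[of "\<lambda>w. (u, w)" "\<lambda>h. (0, h)" x UNIV P] by simp
      then show ?thesis by (simp add: frechet_derivative_at[symmetric])
    qed
    moreover have "smooth_on {z. 0 < fst z} (\<lambda>z. frechet_derivative P (at z) (0, b))"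
      using smooth_on_dpart[OF Cons.prems(1), of "[(0, b)]"] Cons.prems(2) by (auto simp: Basis_prod_def)
    ultimately show ?case using Cons.IH[of "\<lambda>z. frechet_derivative P (at z) (0, b)"] Cons.prems(2) by simp
  qed simp
qed

lemma smooth_slice_smooth:
  fixes P :: "real \<times> 'w::euclidean_space \<Rightarrow> real"
  assumes P: "smooth_on {z. 0 < fst z} P" and u: "0 < u"
  shows "smooth_on UNIV (\<lambda>w. P (u, w))"
proof -
  have "dpart bs (\<lambda>w. P (u, w)) differentiable at w" if "set bs \<subseteq> Basis" for bs w
  proof -
    note * = smooth_slice[OF P u that]
    have "dpart (map (Pair 0) bs) P differentiable at (u, w)"
      using smooth_on_imp_differentiable[OF *(2)] u by simp
    moreover have "(\<lambda>w. (u, w)) differentiable at w"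
      unfolding differentiable_def by (intro exI[of _ "\<lambda>h. (0, h)"]) (auto intro!: derivative_eq_intros)
    ultimately show ?thesis
      unfolding *(1) using differentiable_chain_at[of "\<lambda>w. (u, w)" w "dpart (map (Pair 0) bs) P"] by (simp add: comp_def)
  qed
  then show ?thesis
    unfolding smooth_on_iff
    by (auto intro!: continuous_at_imp_continuous_on differentiable_imp_continuous_within)
qed

lemma smooth_slice_measurable:
  fixes P :: "real \<times> 'w::euclidean_space \<Rightarrow> real"
  assumes P: "smooth_on {z. 0 < fst z} P" and bs: "set bs \<subseteq> Basis"
  shows "(\<lambda>(u, w). indicator {0<..} u * dpart bs (\<lambda>w. P (u, w)) w) \<in> borel_measurable (borel \<Otimes>\<^sub>M borel)"
proof -
  have s: "smooth_on {z. 0 < fst z} (dpart (map (Pair 0) bs) P)"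
    using smooth_slice(2)[OF P zero_less_one bs] .
  have "open {z :: real \<times> 'w. 0 < fst z}" by (intro open_Collect_less continuous_intros)
  then have "(\<lambda>z. indicator {z. 0 < fst z} z *\<^sub>R dpart (map (Pair 0) bs) P z) \<in> borel_measurable borel"
    by (intro borel_measurable_continuous_on_indicator smooth_on_imp_continuous_on[OF s]) auto
  also have "(\<lambda>z. indicator {z. 0 < fst z} z *\<^sub>R dpart (map (Pair 0) bs) P z)
      = (\<lambda>(u, w). indicator {0<..} u * dpart bs (\<lambda>w. P (u, w)) w)"
    by (auto simp: fun_eq_iff indicator_def smooth_slice(1)[OF P _ bs])
  finally show ?thesis by (simp only: borel_prod)
qed

section \<open>The time-changed process\<close>

text \<open>The time 0 is a null set; this absorbs the different values of \<open>average\<close>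
  and \<open>avg\<close> there.\<close>

lemma regular_cong_nonzero: "(\<And>t. t \<noteq> 0 \<Longrightarrow> F t = G t) \<Longrightarrow> regular F = regular G"
  unfolding regular_def fun_eq_iff
  by (intro allI integral_discrete_difference[where X="{0}"]) auto

lemma A_star_gderiv:
  assumes "\<phi> \<in> test_fun"
  shows "A_star \<nu> a (gderiv v) \<phi> = - A_star \<nu> a v (deriv \<phi>)"
proof -
  have "(LINT y|\<nu>. gderiv v (\<lambda>t. \<phi> (t + y)) - gderiv v \<phi>) = (LINT y|\<nu>. - (v (\<lambda>t. deriv \<phi> (t + y)) - v (deriv \<phi>)))"
    by (simp add: gderiv_def deriv_translate[OF assms])
  also have "\<dots> = - (LINT y|\<nu>. v (\<lambda>t. deriv \<phi> (t + y)) - v (deriv \<phi>))"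
    by (rule integral_minus)
  finally show ?thesis by (simp add: A_star_def gderiv_def)
qed

lemma A_star_eq_on_cong:
  assumes "A_star_eq_on I \<nu> a u r" "\<And>\<phi>. \<phi> \<in> test_fun \<Longrightarrow> r \<phi> = r' \<phi>"
  shows "A_star_eq_on I \<nu> a u r'"
  using assms by (simp add: A_star_eq_on_def)

context time_change
begin

lemma A_star_eq_avg:
  assumes "has_generator_value K f g"
  shows "A_star_eq_on UNIV \<nu> a (regular (avg f x)) (\<lambda>\<phi>. - regular (avg g x) \<phi> + f x * A_star \<nu> a (regular theta) \<phi>)"
  unfolding A_star_eq_on_def using A_star_avg[OF assms] by blast

lemma A_star_eq_gderiv_avg:
  assumes fg: "has_generator_value K f g"
  shows "A_star_eq_on {0<..} \<nu> a (gderiv (regular (avg f x)))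
    (\<lambda>\<phi>. - gderiv (regular (avg g x)) \<phi> + f x * gderiv (A_star \<nu> a (regular theta)) \<phi>)"
  unfolding A_star_eq_on_def
proof (intro ballI impI conjI)
  fix \<phi> :: "real \<Rightarrow> real" assume \<phi>: "\<phi> \<in> test_fun"
  note * = A_star_avg[OF fg test_fun_deriv[OF \<phi>], of x]
  have "integrable \<nu> (\<lambda>y. - (regular (avg f x) (\<lambda>t. deriv \<phi> (t + y)) - regular (avg f x) (deriv \<phi>)))"
    using *(1) by (rule integrable_minus)
  then show "integrable \<nu> (\<lambda>y. gderiv (regular (avg f x)) (\<lambda>t. \<phi> (t + y)) - gderiv (regular (avg f x)) \<phi>)"
    by (simp add: gderiv_def deriv_translate[OF \<phi>])
  show "A_star \<nu> a (gderiv (regular (avg f x))) \<phi>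
      = - gderiv (regular (avg g x)) \<phi> + f x * gderiv (A_star \<nu> a (regular theta)) \<phi>"
    unfolding A_star_gderiv[OF \<phi>] *(2) by (simp add: gderiv_def)
qed

lemma regular_avg_generator:
  assumes fg: "has_generator_value K f g" and \<phi>: "\<phi> \<in> test_fun"
  shows "has_generator_value K (\<lambda>z. regular (avg f z) \<phi>) (\<lambda>z. regular (avg g z) \<phi>)"
    and "has_generator_value K (\<lambda>z. gderiv (regular (avg f z)) \<phi>) (\<lambda>z. gderiv (regular (avg g z)) \<phi>)"
proof -
  have f: "f \<in> C_inf" and g: "g \<in> C_inf" using fg by (auto simp: has_generator_value_def)
  have \<psi>: "integrable lborel \<psi>" "integrable lborel (Qtest \<psi>)" if "\<psi> \<in> test_fun" for \<psi>
    using test_fun_integrable[OF that] Qtest_pair_integrable(2) by auto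
  have r: "regular (avg f z) \<psi> = mixed (Qtest \<psi>) f z" "regular (avg g z) \<psi> = mixed (Qtest \<psi>) g z"
    if "\<psi> \<in> test_fun" for \<psi> z
    using regular_avg[OF f \<psi>(1)[OF that]] regular_avg[OF g \<psi>(1)[OF that]] by auto
  show "has_generator_value K (\<lambda>z. regular (avg f z) \<phi>) (\<lambda>z. regular (avg g z) \<phi>)"
    unfolding r[OF \<phi>] using mixed_generator[OF fg \<psi>(2)[OF \<phi>]] by simp
  have m: "- mixed w F z = mixed (\<lambda>u. - w u) F z" for w F z by (simp add: mixed_def)
  show "has_generator_value K (\<lambda>z. gderiv (regular (avg f z)) \<phi>) (\<lambda>z. gderiv (regular (avg g z)) \<phi>)"
    unfolding gderiv_def r[OF test_fun_deriv[OF \<phi>]] m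
    using mixed_generator[OF fg integrable_minus[OF \<psi>(2)[OF test_fun_deriv[OF \<phi>]]]] by simp
qed

lemma avg_generator:
  assumes fg: "has_generator_value K f g" and t: "t \<noteq> 0"
  shows "has_generator_value K (\<lambda>x. avg f x t) (\<lambda>x. avg g x t)"
proof (cases "0 < t")
  case True
  then show ?thesis
    using mixed_generator[OF fg integrable_Q[OF True]] by (simp add: avg_def[abs_def])
next
  case False
  \<comment> \<open>For \<open>t < 0\<close> both averages are 0, which is the mixture with weight
    0.\<close>
  have "has_generator_value K (mixed (\<lambda>_. 0) f) (mixed (\<lambda>_. 0) g)"
    by (rule mixed_generator[OF fg]) simp
  moreover have "mixed (\<lambda>_. 0) F = (\<lambda>_. 0)" for F by (simp add: mixed_def fun_eq_iff)
  ultimately show ?thesis using False by (simp add: avg_def)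
qed

section \<open>Passage to the given Feller process\<close>

context
  fixes Y :: "'a \<Rightarrow> real \<Rightarrow> 'w \<Rightarrow> 'a"
  assumes Y: "\<And>x. feller_process M K x (Y x)"
    and indep: "\<And>x. indep_processes M (Y x) (hitting_time X)"
begin

text \<open>Independence of families of sets includes that their members are events, which is where
  measurability of \<open>Z(t)\<close> comes from.\<close>

lemma hitting_time_measurable:
  assumes "0 \<le> t"
  shows "hitting_time X t \<in> borel_measurable M"
proof (rule measurableI)
  fix B :: "real set" assume "B \<in> sets borel"
  then have "hitting_time X t -` B \<inter> space M \<in> sigma_sets (space M) (path_events M (hitting_time X) {0..})"
    using assms by (intro sigma_sets.Basic) (auto simp: path_events_def)
  then show "hitting_time X t -` B \<inter> space M \<in> sets M"
    using indep unfolding indep_processes_def indep_sets2_eq by blast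
qed simp

lemma hitting_time_distr: "0 < t \<Longrightarrow> distributed M lborel (hitting_time X t) (\<lambda>u. ennreal (Q t u))"
  using hitting_time_distributed[OF hitting_time_measurable] by simp

lemma time_changed:
  fixes g :: "'a \<Rightarrow> real"
  assumes t: "0 < t" and g: "g \<in> borel_measurable borel" "\<And>z. \<bar>g z\<bar> \<le> B"
  shows "(\<lambda>\<omega>. Y x (hitting_time X t \<omega>) \<omega>) \<in> borel_measurable M"
    and "(\<lambda>u. kernel_op K (max 0 u) g x) \<in> borel_measurable borel"
    and "(LINT \<omega>|M. g (Y x (hitting_time X t \<omega>) \<omega>)) = mixed (Q t) g x"
  unfolding mixed_def
  using time_changed_expectation[OF Y indep less_imp_le[OF t] hitting_time_nonneg hitting_time_distr[OF t] _ Q_nonneg g]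
  by auto

lemma kernel_op_indicator: "0 \<le> u \<Longrightarrow> B \<in> sets borel \<Longrightarrow> kernel_op K u (indicator B) x = measure (K u x) B"
  unfolding kernel_op_def using K_sets[of u x] K_space[of u x] by simp

lemma time_changed_prob:
  assumes t: "0 < t" and B: "B \<in> sets borel"
  shows "measure M {\<omega> \<in> space M. Y x (hitting_time X t \<omega>) \<omega> \<in> B} = (LINT u:{0<..}|lborel. measure (K u x) B * Q t u)"
proof -
  have bm: "indicator B \<in> borel_measurable (borel :: 'a measure)" using B by simp
  have b1: "\<bar>indicator B z :: real\<bar> \<le> 1" for z :: 'a by (simp add: indicator_def)
  note * = time_changed[OF t bm b1, of x]
  have "measure M {\<omega> \<in> space M. Y x (hitting_time X t \<omega>) \<omega> \<in> B} = (LINT \<omega>|M. indicator B (Y x (hitting_time X t \<omega>) \<omega>))"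
  proof -
    have "{\<omega> \<in> space M. Y x (hitting_time X t \<omega>) \<omega> \<in> B} \<in> sets M" using *(1) B by measurable
    then have "measure M {\<omega> \<in> space M. Y x (hitting_time X t \<omega>) \<omega> \<in> B}
        = (LINT \<omega>|M. indicator {\<omega> \<in> space M. Y x (hitting_time X t \<omega>) \<omega> \<in> B} \<omega>)" by simp
    also have "\<dots> = (LINT \<omega>|M. indicator B (Y x (hitting_time X t \<omega>) \<omega>))"
      by (rule Bochner_Integration.integral_cong) (auto simp: indicator_def)
    finally show ?thesis .
  qed
  also have "\<dots> = mixed (Q t) (indicator B) x" by (rule *(3))
  also have "\<dots> = (LINT u:{0<..}|lborel. measure (K u x) B * Q t u)"
    unfolding mixed_def set_lebesgue_integral_def
    by (rule Bochner_Integration.integral_cong) (auto simp: indicator_def[of "{0<..}"] Q_def kernel_op_indicator[OF _ B])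
  finally show ?thesis .
qed

lemma average_eq_avg:
  assumes f: "f \<in> C_inf" and t: "t \<noteq> 0"
  shows "average M X Y f t x = avg f x t"
proof -
  obtain B where "\<And>z. \<bar>f z\<bar> \<le> B" using C_inf_bounded[OF f] by blast
  then show ?thesis
    using time_changed(3)[of t f B x] C_inf_measurable[OF f] t by (auto simp: average_def avg_def)
qed

lemma regular_average: "f \<in> C_inf \<Longrightarrow> regular (\<lambda>t. average M X Y f t x) = regular (avg f x)"
  by (rule regular_cong_nonzero) (rule average_eq_avg)

lemma average_generator:
  assumes fg: "has_generator_value K f g" and t: "t \<noteq> 0"
  shows "has_generator_value K (average M X Y f t) (\<lambda>x. avg g x t)"
proof -
  have "f \<in> C_inf" using fg by (simp add: has_generator_value_def)
  then have "average M X Y f t = (\<lambda>x. avg f x t)" using average_eq_avg[OF _ t] by auto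
  then show ?thesis using avg_generator[OF fg t] by simp
qed

lemma regular_gen_average:
  assumes fg: "has_generator_value K f g"
  shows "regular (\<lambda>t. gen K (average M X Y f t) x) = regular (avg g x)"
  by (rule regular_cong_nonzero) (simp add: gen_eq[OF average_generator[OF fg]])

section \<open>Processes with a smooth transition density\<close>

context
  fixes p :: "real \<Rightarrow> 'a \<Rightarrow> 'a \<Rightarrow> real"
  assumes p: "smooth_transition_density K p"
begin

lemma p_smooth: "smooth_on {z. 0 < fst z} (\<lambda>z. p (fst z) (fst (snd z)) (snd (snd z)))"
proof -
  have "{(t, x, y). 0 < t} = {z :: real \<times> 'a \<times> 'a. 0 < fst z}" by auto
  moreover have "(\<lambda>(t, x, y). p t x y) = (\<lambda>z. p (fst z) (fst (snd z)) (snd (snd z)))" by auto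
  ultimately show ?thesis using p by (simp add: smooth_transition_density_def)
qed

lemma p_nonneg: "0 < u \<Longrightarrow> 0 \<le> p u x y"
  and K_density: "0 < u \<Longrightarrow> K u x = density lborel (\<lambda>y. ennreal (p u x y))"
  using p by (auto simp: smooth_transition_density_def)

lemma p_measurable: "(\<lambda>(u, y). indicator {0<..} u * p u x y) \<in> borel_measurable (borel \<Otimes>\<^sub>M borel)"
proof -
  have "(\<lambda>(u, w). indicator {0<..} u * p u (fst w) (snd w)) \<in> borel_measurable (borel \<Otimes>\<^sub>M borel)"
    using smooth_slice_measurable[OF p_smooth, of "[]"] by simp
  from measurable_compose[OF _ this, of "\<lambda>(u, y). (u, x, y)" "borel \<Otimes>\<^sub>M borel"]
  show ?thesis by (simp add: case_prod_unfold borel_prod[symmetric])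
qed

lemma changed_density_eq: "changed_density Q p t x y = (LINT u|lborel. (indicator {0<..} u * p u x y) * Q t u)"
  by (simp add: changed_density_def set_lebesgue_integral_def mult.assoc)

lemma changed_density_nonneg: "0 \<le> changed_density Q p t x y"
  unfolding changed_density_eq using p_nonneg Q_nonneg by (intro integral_nonneg_AE AE_I2) (auto simp: indicator_def)

lemma changed_density_measurable: "changed_density Q p t x \<in> borel_measurable borel"
proof -
  note p_measurable[measurable]
  have "(\<lambda>(y, u). (\<lambda>(u, y). indicator {0<..} u * p u x y) (u, y) * Q t u) \<in> borel_measurable (borel \<Otimes>\<^sub>M lborel)"
    by measurable
  from lborel.borel_measurable_lebesgue_integral[OF this]
  show ?thesis by (simp add: changed_density_eq[abs_def])
qed

text \<open>Tonelli's theorem gives the density as the nonnegative integral \<open>\<gamma>\<close>,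
  with values in the extended half-line. It has mass 1 and is therefore finite almost everywhere; on
  the exceptional null set \<open>changed_density\<close> takes the default value of a divergent
  integral, which does not affect the law.\<close>

lemma time_changed_density:
  assumes t: "0 < t"
  shows "distributed M lborel (\<lambda>\<omega>. Y x (hitting_time X t \<omega>) \<omega>) (\<lambda>y. ennreal (changed_density Q p t x y))"
proof -
  let ?V = "\<lambda>\<omega>. Y x (hitting_time X t \<omega>) \<omega>"
  have V [measurable]: "?V \<in> borel_measurable M" by (rule time_changed(1)[OF t, of "\<lambda>_. 0" 0]) auto
  define q where "q u y = indicator {0<..} u * p u x y" for u y
  have [measurable]: "(\<lambda>(u, y). q u y) \<in> borel_measurable (borel \<Otimes>\<^sub>M borel)" unfolding q_def by (rule p_measurable)
  have q0: "0 \<le> q u y" for u y using p_nonneg by (simp add: q_def indicator_def)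
  define \<gamma> where "\<gamma> y = (\<integral>\<^sup>+ u. ennreal (q u y * Q t u) \<partial>lborel)" for y
  have [measurable]: "\<gamma> \<in> borel_measurable borel" unfolding \<gamma>_def by measurable
  have eq: "emeasure (distr M lborel ?V) B = (\<integral>\<^sup>+ y. \<gamma> y * indicator B y \<partial>lborel)" if B [measurable]: "B \<in> sets borel" for B
  proof -
    have "emeasure (distr M lborel ?V) B = ennreal (measure M {\<omega> \<in> space M. ?V \<omega> \<in> B})"
      using B by (subst emeasure_distr) (auto simp: emeasure_eq_measure intro!: arg_cong[where f="measure M"])
    also have "\<dots> = ennreal (LINT u|lborel. kernel_op K (max 0 u) (indicator B) x * Q t u)"
      unfolding time_changed_prob[OF t B] set_lebesgue_integral_def
      by (intro arg_cong[where f=ennreal] Bochner_Integration.integral_cong)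
        (auto simp: indicator_def[of "{0<..}"] Q_def kernel_op_indicator[OF _ B])
    also have "\<dots> = (\<integral>\<^sup>+ u. ennreal (kernel_op K (max 0 u) (indicator B) x * Q t u) \<partial>lborel)"
    proof (rule nn_integral_eq_integral[symmetric])
      have m: "(\<lambda>u. kernel_op K (max 0 u) (indicator B) x) \<in> borel_measurable borel"
        by (rule time_changed(2)[OF t, where B=1]) (auto simp: indicator_def)
      have k: "0 \<le> kernel_op K (max 0 u) (indicator B) x" "kernel_op K (max 0 u) (indicator B) x \<le> 1" for u
        using prob_space.prob_le_1[OF K_prob[of "max 0 u" x]] by (auto simp: kernel_op_indicator[OF _ B])
      show "integrable lborel (\<lambda>u. kernel_op K (max 0 u) (indicator B) x * Q t u)"
        by (rule Bochner_Integration.integrable_bound[OF integrable_Q[OF t]])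
          (use m k Q_nonneg in \<open>auto simp: abs_mult mult_left_le_one_le\<close>)
      show "AE u in lborel. 0 \<le> kernel_op K (max 0 u) (indicator B) x * Q t u"
        using k Q_nonneg by auto
    qed
    also have "\<dots> = (\<integral>\<^sup>+ u. \<integral>\<^sup>+ y. ennreal (q u y * Q t u) * indicator B y \<partial>lborel \<partial>lborel)"
    proof (rule nn_integral_cong)
      fix u
      show "ennreal (kernel_op K (max 0 u) (indicator B) x * Q t u) = (\<integral>\<^sup>+ y. ennreal (q u y * Q t u) * indicator B y \<partial>lborel)"
      proof (cases "0 < u")
        case True
        interpret Ku: prob_space "K u x" using K_prob[of u x] True by simp
        have qm [measurable]: "(\<lambda>y. q u y) \<in> borel_measurable borel" by measurable
        have pm: "(\<lambda>y. p u x y) \<in> borel_measurable borel" using qm True by (simp add: q_def)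
        have "ennreal (kernel_op K (max 0 u) (indicator B) x * Q t u) = emeasure (K u x) B * ennreal (Q t u)"
          using True by (simp add: kernel_op_indicator[OF _ B] ennreal_mult Q_nonneg Ku.emeasure_eq_measure)
        also have "emeasure (K u x) B = (\<integral>\<^sup>+ y. ennreal (q u y) * indicator B y \<partial>lborel)"
          unfolding K_density[OF True] using pm True by (subst emeasure_density) (auto simp: q_def)
        also have "\<dots> * ennreal (Q t u) = (\<integral>\<^sup>+ y. (ennreal (q u y) * indicator B y) * ennreal (Q t u) \<partial>lborel)"
          by (rule nn_integral_multc[symmetric]) measurable
        also have "\<dots> = (\<integral>\<^sup>+ y. ennreal (q u y * Q t u) * indicator B y \<partial>lborel)"
          by (intro nn_integral_cong) (simp add: ennreal_mult q0 Q_nonneg ac_simps)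
        finally show ?thesis .
      qed (simp add: Q_def)
    qed
    also have "\<dots> = (\<integral>\<^sup>+ y. \<integral>\<^sup>+ u. ennreal (q u y * Q t u) * indicator B y \<partial>lborel \<partial>lborel)"
      by (rule lborel_pair.Fubini') measurable
    also have "\<dots> = (\<integral>\<^sup>+ y. \<gamma> y * indicator B y \<partial>lborel)"
      unfolding \<gamma>_def by (intro nn_integral_cong nn_integral_multc) measurable
    finally show ?thesis .
  qed
  interpret V: prob_space "distr M lborel ?V" by (rule prob_space_distr) simp
  have "(\<integral>\<^sup>+ y. \<gamma> y \<partial>lborel) = emeasure (distr M lborel ?V) UNIV" by (simp add: eq)
  also have "\<dots> = 1" using V.emeasure_space_1 by simp
  finally have "AE y in lborel. \<gamma> y \<noteq> \<infinity>" by (intro nn_integral_PInf_AE) auto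
  then have ae: "AE y in lborel. \<gamma> y = ennreal (changed_density Q p t x y)"
  proof eventually_elim
    case (elim y)
    have "integrable lborel (\<lambda>u. q u y * Q t u)"
      using elim q0 Q_nonneg by (intro integrableI_nonneg) (auto simp: \<gamma>_def less_top)
    then show ?case
      unfolding \<gamma>_def changed_density_eq q_def[symmetric]
      using q0 Q_nonneg by (intro nn_integral_eq_integral) auto
  qed
  have "distr M lborel ?V = density lborel \<gamma>"
    by (rule measure_eqI) (auto simp: eq emeasure_density)
  also have "\<dots> = density lborel (\<lambda>y. ennreal (changed_density Q p t x y))"
    using ae changed_density_measurable[of t x] by (intro density_cong) auto
  finally show ?thesis
    using changed_density_measurable[of t x] by (simp add: distributed_def)
qed

text \<open>Stated on \<open>C_inf\<close> rather than for test functions, because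
  \<open>L \<psi>\<close> need not have compact support but must be paired with the density as
  well.\<close>

lemma pairing_eq:
  assumes f: "f \<in> C_inf"
  shows "pairing (changed_density Q p) x f = regular (avg f x)"
  unfolding pairing_def
proof (rule regular_cong_nonzero)
  fix t :: real assume "t \<noteq> 0"
  show "(LINT y|lborel. changed_density Q p t x y * f y) = avg f x t"
  proof (cases "0 < t")
    case True
    obtain B where B: "\<And>z. \<bar>f z\<bar> \<le> B" using C_inf_bounded[OF f] by blast
    have fm: "f \<in> borel_measurable borel" by (rule C_inf_measurable[OF f])
    have "(LINT y|lborel. changed_density Q p t x y * f y) = (LINT \<omega>|M. f (Y x (hitting_time X t \<omega>) \<omega>))"
      by (rule distributed_integral[OF time_changed_density[OF True]]) (use fm changed_density_nonneg in auto)
    then show ?thesis using time_changed(3)[OF True fm B] True by (simp add: avg_def)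
  next
    case False
    then have "Q t u = 0" for u using \<open>t \<noteq> 0\<close> by (simp add: Q_def)
    then show ?thesis using False by (simp add: changed_density_eq avg_def)
  qed
qed

lemma changed_density_smooth:
  assumes W: "regular_region Q p t W"
  shows "smooth_on W (\<lambda>(x, y). changed_density Q p t x y)"
proof -
  let ?P = "\<lambda>z. p (fst z) (fst (snd z)) (snd (snd z))"
  have e: "(\<lambda>(x, y). p u x y) = (\<lambda>w. ?P (u, w))" for u by auto
  have "smooth_on W (\<lambda>w. LINT u|lborel. indicator {0<..} u * ((\<lambda>(x, y). p u x y) w * Q t u))"
  proof (rule smooth_on_integral)
    show "open W" using W by (simp add: regular_region_def)
    show "smooth_on UNIV (\<lambda>(x, y). p u x y)" if "0 < u" for u
      unfolding e by (rule smooth_slice_smooth[OF p_smooth that])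
    show "(\<lambda>u. indicator {0<..} u * (dpart bs (\<lambda>(x, y). p u x y) w * Q t u)) \<in> borel_measurable borel"
      if "set bs \<subseteq> Basis" for bs w
    proof -
      have "(\<lambda>u. (\<lambda>(u, w). indicator {0<..} u * dpart bs (\<lambda>w. ?P (u, w)) w) (u, w)) \<in> borel_measurable borel"
        by (rule measurable_compose[OF _ smooth_slice_measurable[OF p_smooth that]]) simp
      then have "(\<lambda>u. (indicator {0<..} u * dpart bs (\<lambda>w. ?P (u, w)) w) * Q t u) \<in> borel_measurable borel"
        by simp
      then show ?thesis unfolding e by (simp add: mult.assoc)
    qed
    show "\<exists>N m. open N \<and> z \<in> N \<and> set_integrable lborel {0<..} m \<and>
        (\<forall>u>0. \<forall>w\<in>N. \<bar>dpart bs (\<lambda>(x, y). p u x y) w * Q t u\<bar> \<le> m u)"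
      if "z \<in> W" "set bs \<subseteq> Basis" for z bs
      using W that unfolding regular_region_def by blast
  qed
  also have "(\<lambda>w. LINT u|lborel. indicator {0<..} u * ((\<lambda>(x, y). p u x y) w * Q t u)) = (\<lambda>(x, y). changed_density Q p t x y)"
    by (auto simp: fun_eq_iff changed_density_eq mult.assoc)
  finally show ?thesis .
qed

end

end

end

theorem theorem4p2:
  fixes M :: "'w measure"
    and X :: "real \<Rightarrow> 'w \<Rightarrow> real"
    and \<nu> :: "real measure" and a \<epsilon> \<beta> :: real
    and T :: "real \<Rightarrow> 'a::euclidean_space \<Rightarrow> 'a measure"
    and Y :: "'a \<Rightarrow> real \<Rightarrow> 'w \<Rightarrow> 'a"
    and C2 :: "('a \<Rightarrow> real) set"
  defines "Z \<equiv> hitting_time X"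
    and "Q \<equiv> hitting_density M X"
    and "L \<equiv> gen T"
    and "F \<equiv> average M X Y"
  assumes M: "prob_space M"
    and a: "0 \<le> a"
    and nu: "levy_measure_subordinator \<nu>"
    and eps_beta: "0 < \<epsilon>" "0 < \<beta>" "\<beta> < 1" "stable_lower_bound \<nu> \<epsilon> \<beta>"
    and X: "subordinator_with_generator M X \<nu> a"
    and Y: "\<And>x. feller_process M T x (Y x)"
    and indep: "\<And>x. indep_processes M (Y x) Z"
    and C2: "C2 = C2_fun \<or> C2 = C2_bounded"
    and dom: "C_inf \<inter> C2 \<subseteq> gen_dom T"
  shows
    "(\<forall>t>0. distributed M lborel (Z t) (\<lambda>u. ennreal (Q t u))) \<and>
     (\<forall>t>0. \<forall>x. (\<lambda>\<omega>. Y x (Z t \<omega>) \<omega>) \<in> borel_measurable M \<and>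
       (\<forall>B\<in>sets borel. measure M {\<omega> \<in> space M. Y x (Z t \<omega>) \<omega> \<in> B}
          = (LINT u:{0<..}|lborel. measure (T u x) B * Q t u))) \<and>
     (\<forall>f \<in> C_inf \<inter> C2.
       (\<forall>t>0. F f t \<in> gen_dom T) \<and>
       (\<forall>x. A_star_eq_on UNIV \<nu> a (regular (\<lambda>t. F f t x))
          (\<lambda>\<phi>. - regular (\<lambda>t. L (F f t) x) \<phi> + f x * A_star \<nu> a (regular theta) \<phi>)) \<and>
       (let h = (\<lambda>x. gderiv (regular (\<lambda>t. F f t x))) in
          (\<forall>\<phi>\<in>test_fun. (\<lambda>z. h z \<phi>) \<in> gen_dom T) \<and>
          (\<forall>x. A_star_eq_on {0<..} \<nu> a (h x)
             (\<lambda>\<phi>. - L (\<lambda>z. h z \<phi>) x + f x * gderiv (A_star \<nu> a (regular theta)) \<phi>)))) \<and>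
     (\<forall>p. smooth_transition_density T p \<and> backward_equation T p \<and> forward_equation T p \<longrightarrow>
       (let g = changed_density Q p; h = (\<lambda>x \<psi>. gderiv (pairing g x \<psi>)) in
          (\<forall>t>0. \<forall>x. distributed M lborel (\<lambda>\<omega>. Y x (Z t \<omega>) \<omega>) (\<lambda>y. ennreal (g t x y))) \<and>
          (\<forall>t>0. \<forall>W. regular_region Q p t W \<longrightarrow> smooth_on W (\<lambda>(x, y). g t x y)) \<and>
          (\<forall>\<psi>\<in>test_fun.
             (\<forall>x. A_star_eq_on UNIV \<nu> a (pairing g x \<psi>)
                (\<lambda>\<phi>. - pairing g x (L \<psi>) \<phi> + \<psi> x * A_star \<nu> a (regular theta) \<phi>)) \<and>
             (\<forall>\<phi>\<in>test_fun. (\<lambda>z. pairing g z \<psi> \<phi>) \<in> gen_dom T) \<and>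
             (\<forall>x. A_star_eq_on UNIV \<nu> a (pairing g x \<psi>)
                (\<lambda>\<phi>. - L (\<lambda>z. pairing g z \<psi> \<phi>) x + \<psi> x * A_star \<nu> a (regular theta) \<phi>)) \<and>
             (\<forall>x. A_star_eq_on {0<..} \<nu> a (h x \<psi>)
                (\<lambda>\<phi>. - h x (L \<psi>) \<phi> + \<psi> x * gderiv (A_star \<nu> a (regular theta)) \<phi>)))))"
proof -
  interpret tc: time_change M X \<nu> a \<epsilon> \<beta> T
    using M a nu eps_beta X Y
    by (intro time_change.intro stable_subordinator.intro stable_subordinator_axioms.intro feller.intro)
      (auto simp: feller_process_def)
  note YI = Y indep[unfolded Z_def]
  have gen: "has_generator_value T f (gen T f)" if "f \<in> C_inf \<inter> C2" for f
    using tc.gen_dom_gen dom that by blast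
  \<comment> \<open>Test functions belong to both readings of C^2, so they lie in the domain of the
    generator for either choice of \<open>C2\<close>.\<close>
  have test: "\<psi> \<in> C_inf \<inter> C2" if "\<psi> \<in> test_fun" for \<psi>
    using that C2 test_fun_C_inf test_fun_C2 by auto
  have 1: "\<forall>t>0. distributed M lborel (hitting_time X t) (\<lambda>u. ennreal (tc.Q t u))"
    using tc.hitting_time_distr[OF YI] by blast
  have 2: "\<forall>t>0. \<forall>x. (\<lambda>\<omega>. Y x (hitting_time X t \<omega>) \<omega>) \<in> borel_measurable M \<and>
       (\<forall>B\<in>sets borel. measure M {\<omega> \<in> space M. Y x (hitting_time X t \<omega>) \<omega> \<in> B}
          = (LINT u:{0<..}|lborel. measure (T u x) B * tc.Q t u))"
    using tc.time_changed(1)[OF YI, of _ "\<lambda>_. 0" 0] tc.time_changed_prob[OF YI] by simp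
  have 3: "(\<forall>t>0. average M X Y f t \<in> gen_dom T) \<and>
       (\<forall>x. A_star_eq_on UNIV \<nu> a (regular (\<lambda>t. average M X Y f t x))
          (\<lambda>\<phi>. - regular (\<lambda>t. gen T (average M X Y f t) x) \<phi> + f x * A_star \<nu> a (regular theta) \<phi>)) \<and>
       (let h = (\<lambda>x. gderiv (regular (\<lambda>t. average M X Y f t x))) in
          (\<forall>\<phi>\<in>test_fun. (\<lambda>z. h z \<phi>) \<in> gen_dom T) \<and>
          (\<forall>x. A_star_eq_on {0<..} \<nu> a (h x)
             (\<lambda>\<phi>. - gen T (\<lambda>z. h z \<phi>) x + f x * gderiv (A_star \<nu> a (regular theta)) \<phi>)))"
    if f: "f \<in> C_inf \<inter> C2" for f
  proof -
    note fg = gen[OF f]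
    have fC: "f \<in> C_inf" using f by simp
    note h = tc.regular_avg_generator(2)[OF fg]
    have "average M X Y f t \<in> gen_dom T" if "0 < t" for t
      using tc.gen_domI[OF tc.average_generator[OF YI fg]] that by simp
    moreover have "A_star_eq_on {0<..} \<nu> a (gderiv (regular (tc.avg f x)))
        (\<lambda>\<phi>. - gen T (\<lambda>z. gderiv (regular (tc.avg f z)) \<phi>) x + f x * gderiv (A_star \<nu> a (regular theta)) \<phi>)" for x
      by (rule A_star_eq_on_cong[OF tc.A_star_eq_gderiv_avg[OF fg]]) (simp add: tc.gen_eq[OF h])
    ultimately show ?thesis
      using tc.A_star_eq_avg[OF fg] tc.gen_domI[OF h]
      by (simp add: Let_def tc.regular_average[OF YI fC] tc.regular_gen_average[OF YI fg])
  qed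
  have 4: "let g = changed_density tc.Q p; h = (\<lambda>x \<psi>. gderiv (pairing g x \<psi>)) in
          (\<forall>t>0. \<forall>x. distributed M lborel (\<lambda>\<omega>. Y x (hitting_time X t \<omega>) \<omega>) (\<lambda>y. ennreal (g t x y))) \<and>
          (\<forall>t>0. \<forall>W. regular_region tc.Q p t W \<longrightarrow> smooth_on W (\<lambda>(x, y). g t x y)) \<and>
          (\<forall>\<psi>\<in>test_fun.
             (\<forall>x. A_star_eq_on UNIV \<nu> a (pairing g x \<psi>)
                (\<lambda>\<phi>. - pairing g x (gen T \<psi>) \<phi> + \<psi> x * A_star \<nu> a (regular theta) \<phi>)) \<and>
             (\<forall>\<phi>\<in>test_fun. (\<lambda>z. pairing g z \<psi> \<phi>) \<in> gen_dom T) \<and>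
             (\<forall>x. A_star_eq_on UNIV \<nu> a (pairing g x \<psi>)
                (\<lambda>\<phi>. - gen T (\<lambda>z. pairing g z \<psi> \<phi>) x + \<psi> x * A_star \<nu> a (regular theta) \<phi>)) \<and>
             (\<forall>x. A_star_eq_on {0<..} \<nu> a (h x \<psi>)
                (\<lambda>\<phi>. - h x (gen T \<psi>) \<phi> + \<psi> x * gderiv (A_star \<nu> a (regular theta)) \<phi>)))"
    if p: "smooth_transition_density T p" for p
  proof -
    let ?g = "changed_density tc.Q p"
    have pair: "pairing ?g x \<psi> = regular (tc.avg \<psi> x)" "pairing ?g x (gen T \<psi>) = regular (tc.avg (gen T \<psi>) x)"
      if "\<psi> \<in> test_fun" for \<psi> x
      using tc.pairing_eq[OF YI p] gen[OF test[OF that]] by (auto simp: has_generator_value_def)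
    have eq: "A_star_eq_on UNIV \<nu> a (pairing ?g x \<psi>)
                (\<lambda>\<phi>. - pairing ?g x (gen T \<psi>) \<phi> + \<psi> x * A_star \<nu> a (regular theta) \<phi>) \<and>
             (\<forall>\<phi>\<in>test_fun. (\<lambda>z. pairing ?g z \<psi> \<phi>) \<in> gen_dom T) \<and>
             A_star_eq_on UNIV \<nu> a (pairing ?g x \<psi>)
                (\<lambda>\<phi>. - gen T (\<lambda>z. pairing ?g z \<psi> \<phi>) x + \<psi> x * A_star \<nu> a (regular theta) \<phi>) \<and>
             A_star_eq_on {0<..} \<nu> a (gderiv (pairing ?g x \<psi>))
                (\<lambda>\<phi>. - gderiv (pairing ?g x (gen T \<psi>)) \<phi> + \<psi> x * gderiv (A_star \<nu> a (regular theta)) \<phi>)"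
      if \<psi>: "\<psi> \<in> test_fun" for \<psi> x
    proof -
      note fg = gen[OF test[OF \<psi>]]
      note r = tc.regular_avg_generator(1)[OF fg]
      have "A_star_eq_on UNIV \<nu> a (regular (tc.avg \<psi> x))
          (\<lambda>\<phi>. - gen T (\<lambda>z. regular (tc.avg \<psi> z) \<phi>) x + \<psi> x * A_star \<nu> a (regular theta) \<phi>)"
        by (rule A_star_eq_on_cong[OF tc.A_star_eq_avg[OF fg]]) (simp add: tc.gen_eq[OF r])
      then show ?thesis
        unfolding pair[OF \<psi>]
        using tc.A_star_eq_avg[OF fg] tc.A_star_eq_gderiv_avg[OF fg] tc.gen_domI[OF r] by blast
    qed
    show ?thesis
      unfolding Let_def
      using tc.time_changed_density[OF YI p] tc.changed_density_smooth[OF YI p] eq by blast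
  qed
  show ?thesis
    unfolding Z_def Q_def L_def F_def tc.hitting_density_eq
    using 1 2 3 4 by blast
qed

end
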